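(* Each reductive Cartan foliation is a foliation with a transversal linear connection.
   Context: All manifolds are smooth and Hausdorff, all maps are smooth. Reductive Cartan geometry. Let $G$ be a Lie group, $H\subset G$ a closed subgroup, with Lie algebras $\mathfrak g,\mathfrak h$. A Cartan geometry of type $(G,H)$ on a (not necessarily connected) manifold $N$ is a pair $\xi=(P(N,H),\omega)$, where $P(N,H)$ is a principal right $H$-bundle over $N$ and $\omega$ is a $\mathfrak g$-valued 1-form on $P$ such that: $\omega_w:T_wP\to\mathfrak g$ is a linear isomorphism for all $w\in P$; $R_h^*\omega=\mathrm{Ad}_G(h^{-1})\omega$ for all $h\in H$; $\omega(A^* )=A$ for all $A\in\mathfrak h$, where $A^*$ is the fundamental vector field of $A$. It is reductive if there is an $\mathrm{Ad}_G(H)$-invariant vector subspace $V\subset\mathfrak g$ with $\mathfrak g=\mathfrak h\oplus V$. Effectivity of the geometry is not assumed. Isomorphisms of Cartan geometries of the same type are principal $H$-bundle isomorphisms $\Gamma$ with $\Gamma^*\omega'=\omega$. Reductive Cartan foliation. A foliation $(M,F)$ is a reductive Cartan foliation if it is modelled on some reductive Cartan geometry $\xi=(P(N,H),\omega)$, i.e. there is a family $\{U_i,f_i,\Gamma_{ij}\}_{i,j\in J}$ such that: $\{U_i\}$ is an open cover of $M$ by connected sets and $f_i:U_i\to V_i\subset N$ are submersions with connected fibres; if $U_i\cap U_j\ne\emptyset$, $\Gamma_{ij}$ is an isomorphism from the Cartan geometry induced by $\xi$ on $f_j(U_i\cap U_j)$ onto the one induced on $f_i(U_i\cap U_j)$,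 whose projection $\gamma_{ij}$ satisfies $f_i=\gamma_{ij}\circ f_j$; $\Gamma_{ij}\circ\Gamma_{jk}=\Gamma_{ik}$ when $U_i\cap U_j\cap U_k\neq\emptyset$ and $\Gamma_{ii}=\mathrm{id}$; and the cocycle $\{U_i,f_i,\gamma_{ij}\}$ defines $F$. Foliation with a transversal linear connection. A foliation $(M,F)$ is a foliation with a transversal (transversely) linear connection if it is defined by an $N$-cocycle $\{U_i,f_i,\gamma_{ij}\}_{i,j\in J}$ for some manifold $N$ carrying a linear connection $\nabla$ (possibly with nonzero torsion) such that each local diffeomorphism $\gamma_{ij}:f_j(U_i\cap U_j)\to f_i(U_i\cap U_j)$ is an isomorphism of the linear connections induced by $\nabla$ on these open subsets, i.e. $(\gamma_{ij})_*(\nabla_XY)=\nabla_{(\gamma_{ij})_*X}(\gamma_{ij})_*Y$ for all vector fields $X,Y$ on $f_j(U_i\cap U_j)$. *)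

theory Defs
  imports "HOL-Analysis.Analysis" "HOL-Algebra.Coset"
begin

section \<open>Finite-dimensional model spaces and smooth maps between them\<close>

text \<open>
  Every instance of \<^class>\<open>euclidean_space\<close> has positive dimension. Model spaces of dimension 0 are
  needed (the subgroup \<open>H\<close> may be discrete), hence this slightly larger class.
\<close>

class finite_dim_normed = real_normed_vector +
  assumes ex_finite_spanning: "\<exists>B::'a set. finite B \<and> (\<forall>x. \<exists>a. x = (\<Sum>b\<in>B. a b *\<^sub>R b))"

instance euclidean_space \<subseteq> finite_dim_normed
proof
  have "x = (\<Sum>b\<in>Basis. (x \<bullet> b) *\<^sub>R b)" for x :: 'a
    by (simp add: euclidean_representation)
  then show "\<exists>B::'a set. finite B \<and> (\<forall>x. \<exists>a. x = (\<Sum>b\<in>B. a b *\<^sub>R b))"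
    using finite_Basis by blast
qed

instance prod :: (finite_dim_normed, finite_dim_normed) finite_dim_normed
proof
  obtain A :: "'a set" where A: "finite A" "\<And>x. \<exists>a. x = (\<Sum>b\<in>A. a b *\<^sub>R b)"
    using ex_finite_spanning by blast
  obtain B :: "'b set" where B: "finite B" "\<And>x. \<exists>a. x = (\<Sum>b\<in>B. a b *\<^sub>R b)"
    using ex_finite_spanning by blast
  define C where "C = (\<lambda>a. (a, 0::'b)) ` A \<union> (\<lambda>b. (0::'a, b)) ` B"
  have fin: "finite C"
    using A(1) B(1) by (simp add: C_def)
  have "z \<in> span C" for z
  proof -
    obtain a b where ab: "fst z = (\<Sum>x\<in>A. a x *\<^sub>R x)" "snd z = (\<Sum>x\<in>B. b x *\<^sub>R x)"
      using A(2) B(2) by metis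
    have "z = (fst z, 0) + (0, snd z)"
      by simp
    also have "(fst z, 0::'b) = (\<Sum>x\<in>A. a x *\<^sub>R (x, 0))"
      by (simp add: ab prod_eq_iff fst_sum snd_sum)
    also have "(0::'a, snd z) = (\<Sum>x\<in>B. b x *\<^sub>R (0, x))"
      by (simp add: ab prod_eq_iff fst_sum snd_sum)
    also have "(\<Sum>x\<in>A. a x *\<^sub>R (x, 0)) + (\<Sum>x\<in>B. b x *\<^sub>R (0, x)) \<in> span C"
      by (intro span_add span_sum span_scale span_base) (auto simp: C_def)
    finally show ?thesis .
  qed
  then have "\<forall>z. \<exists>u. z = (\<Sum>v\<in>C. u v *\<^sub>R v)"
    using span_finite[OF fin] by blast
  with fin show "\<exists>B::('a \<times> 'b) set. finite B \<and> (\<forall>x. \<exists>a. x = (\<Sum>b\<in>B. a b *\<^sub>R b))"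
    by blast
qed

text \<open>
  Used for open \<open>S\<close> only. As the domain is finite-dimensional, continuity of all iterated
  directional derivatives is the usual notion of \<open>C\<^sup>k\<close>.
\<close>

primrec Ck_on :: "nat \<Rightarrow> 'a::finite_dim_normed set \<Rightarrow> ('a \<Rightarrow> 'b::finite_dim_normed) \<Rightarrow> bool" where
  "Ck_on 0 S f \<longleftrightarrow> continuous_on S f"
| "Ck_on (Suc k) S f \<longleftrightarrow> (\<forall>x\<in>S. f differentiable (at x)) \<and>
     (\<forall>v. Ck_on k S (\<lambda>x. frechet_derivative f (at x) v))"

definition smooth_on :: "'a::finite_dim_normed set \<Rightarrow> ('a \<Rightarrow> 'b::finite_dim_normed) \<Rightarrow> bool" where
  "smooth_on S f \<longleftrightarrow> (\<forall>k. Ck_on k S f)"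


section \<open>Smooth manifolds\<close>

text \<open>
  A manifold is given by an atlas; its underlying set and its topology are those determined by
  the atlas. No countability axiom is imposed.
\<close>

type_synonym ('a, 'e) chart = "'a set \<times> ('a \<Rightarrow> 'e)"
type_synonym ('a, 'e) atlas = "('a, 'e) chart set"

abbreviation cdom :: "('a, 'e) chart \<Rightarrow> 'a set" where "cdom \<equiv> fst"
abbreviation cmap :: "('a, 'e) chart \<Rightarrow> 'a \<Rightarrow> 'e" where "cmap \<equiv> snd"

definition cinv :: "('a, 'e) chart \<Rightarrow> 'e \<Rightarrow> 'a" where
  "cinv c = inv_into (cdom c) (cmap c)"

definition mcarrier :: "('a, 'e) atlas \<Rightarrow> 'a set" where
  "mcarrier A = (\<Union>c\<in>A. cdom c)"

definition mtop :: "('a, 'e::finite_dim_normed) atlas \<Rightarrow> 'a topology" where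
  "mtop A = topology (\<lambda>W. W \<subseteq> mcarrier A \<and> (\<forall>c\<in>A. open (cmap c ` (W \<inter> cdom c))))"

definition manifold :: "('a, 'e::finite_dim_normed) atlas \<Rightarrow> bool" where
  "manifold A \<longleftrightarrow>
     (\<forall>c\<in>A. inj_on (cmap c) (cdom c)) \<and>
     (\<forall>c\<in>A. \<forall>d\<in>A. open (cmap c ` (cdom c \<inter> cdom d)) \<and>
        smooth_on (cmap c ` (cdom c \<inter> cdom d)) (cmap d \<circ> cinv c)) \<and>
     Hausdorff_space (mtop A)"

lemma openin_mtop:
  assumes inj: "\<And>c. c \<in> A \<Longrightarrow> inj_on (cmap c) (cdom c)"
  shows "openin (mtop A) W \<longleftrightarrow> W \<subseteq> mcarrier A \<and> (\<forall>c\<in>A. open (cmap c ` (W \<inter> cdom c)))"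
proof -
  have "istopology (\<lambda>W. W \<subseteq> mcarrier A \<and> (\<forall>c\<in>A. open (cmap c ` (W \<inter> cdom c))))"
    unfolding istopology_def
  proof (intro conjI allI impI ballI)
    fix S T c
    assume S: "S \<subseteq> mcarrier A \<and> (\<forall>c\<in>A. open (cmap c ` (S \<inter> cdom c)))"
      and T: "T \<subseteq> mcarrier A \<and> (\<forall>c\<in>A. open (cmap c ` (T \<inter> cdom c)))" and c: "c \<in> A"
    have "cmap c ` (S \<inter> T \<inter> cdom c) = cmap c ` (S \<inter> cdom c) \<inter> cmap c ` (T \<inter> cdom c)"
      using inj[OF c] by (auto simp: inj_on_def)
    then show "open (cmap c ` (S \<inter> T \<inter> cdom c))"
      using S T c by (auto intro: open_Int)
  next
    fix K c
    assume K: "\<forall>W\<in>K. W \<subseteq> mcarrier A \<and> (\<forall>c\<in>A. open (cmap c ` (W \<inter> cdom c)))" and c: "c \<in> A"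
    have "cmap c ` (\<Union>K \<inter> cdom c) = (\<Union>W\<in>K. cmap c ` (W \<inter> cdom c))"
      by auto
    then show "open (cmap c ` (\<Union>K \<inter> cdom c))"
      using K c by (auto intro: open_UN)
  qed blast+
  then show ?thesis
    by (simp add: mtop_def topology_inverse')
qed

text \<open>A model space regarded as a manifold.\<close>

definition model_atlas :: "('e, 'e::finite_dim_normed) atlas" where
  "model_atlas = {(UNIV, \<lambda>x. x)}"

definition prod_atlas :: "('a, 'e) atlas \<Rightarrow> ('b, 'f) atlas \<Rightarrow> ('a \<times> 'b, 'e \<times> 'f) atlas" where
  "prod_atlas A B = {(cdom c \<times> cdom d, map_prod (cmap c) (cmap d)) | c d. c \<in> A \<and> d \<in> B}"

definition msmooth_on ::
  "('a, 'e::finite_dim_normed) atlas \<Rightarrow> ('b, 'f::finite_dim_normed) atlas \<Rightarrow> 'a set \<Rightarrow> ('a \<Rightarrow> 'b) \<Rightarrow> bool"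
where
  "msmooth_on A B W f \<longleftrightarrow>
     continuous_map (subtopology (mtop A) W) (mtop B) f \<and>
     (\<forall>c\<in>A. \<forall>d\<in>B. smooth_on (cmap c ` {p \<in> W \<inter> cdom c. f p \<in> cdom d}) (cmap d \<circ> f \<circ> cinv c))"

definition mdiffeo ::
  "('a, 'e::finite_dim_normed) atlas \<Rightarrow> ('b, 'f::finite_dim_normed) atlas \<Rightarrow>
   'a set \<Rightarrow> 'b set \<Rightarrow> ('a \<Rightarrow> 'b) \<Rightarrow> bool"
where
  "mdiffeo A B W W' f \<longleftrightarrow>
     msmooth_on A B W f \<and> bij_betw f W W' \<and> msmooth_on B A W' (inv_into W f)"

text \<open>
  Tangent spaces: at each point \<open>p\<close> one chart \<open>chart_at A p\<close> around \<open>p\<close> is chosen once and for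
  all, and \<open>T\<^sub>p\<close> is identified with the model space through the differential of this chart. In other
  words, a tangent vector at \<open>p\<close> is recorded by its coordinates in that chart. Since the choice of
  chart may vary wildly with \<open>p\<close>, smoothness of vector fields and forms is tested in the charts of
  the atlas, after applying the differential of the chart (or of its inverse).
\<close>

definition chart_at :: "('a, 'e) atlas \<Rightarrow> 'a \<Rightarrow> ('a, 'e) chart" where
  "chart_at A p = (SOME c. c \<in> A \<and> p \<in> cdom c)"

text \<open>The differential \<open>T\<^sub>p \<rightarrow> T\<^sub>f\<^sub>(\<^sub>p\<^sub>)\<close> of a map that is smooth near \<open>p\<close>.\<close>

definition mderiv ::
  "('a, 'e::finite_dim_normed) atlas \<Rightarrow> ('b, 'f::finite_dim_normed) atlas \<Rightarrow> ('a \<Rightarrow> 'b) \<Rightarrow> 'a \<Rightarrow> 'e \<Rightarrow> 'f"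
where
  "mderiv A B f p =
     frechet_derivative (cmap (chart_at B (f p)) \<circ> f \<circ> cinv (chart_at A p)) (at (cmap (chart_at A p) p))"

definition submersion_on ::
  "('a, 'e::finite_dim_normed) atlas \<Rightarrow> ('b, 'f::finite_dim_normed) atlas \<Rightarrow> 'a set \<Rightarrow> ('a \<Rightarrow> 'b) \<Rightarrow> bool"
where
  "submersion_on A B W f \<longleftrightarrow> msmooth_on A B W f \<and> (\<forall>p\<in>W. surj (mderiv A B f p))"

text \<open>
  Vector fields on an open set \<open>W\<close>, and one-forms on the whole manifold with values in a vector
  space. Values at points outside of \<open>W\<close> (outside of the manifold) carry no meaning.
\<close>

definition vector_fields :: "('a, 'e::finite_dim_normed) atlas \<Rightarrow> 'a set \<Rightarrow> ('a \<Rightarrow> 'e) set" where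
  "vector_fields A W =
     {X. \<forall>c\<in>A. smooth_on (cmap c ` (W \<inter> cdom c))
            (\<lambda>y. mderiv A model_atlas (cmap c) (cinv c y) (X (cinv c y)))}"

definition smooth_one_form ::
  "('a, 'e::finite_dim_normed) atlas \<Rightarrow> ('a \<Rightarrow> 'e \<Rightarrow> 'v::finite_dim_normed) \<Rightarrow> bool" where
  "smooth_one_form A \<omega> \<longleftrightarrow>
     (\<forall>p\<in>mcarrier A. linear (\<omega> p)) \<and>
     (\<forall>c\<in>A. \<forall>v. smooth_on (cmap c ` cdom c) (\<lambda>y. \<omega> (cinv c y) (mderiv model_atlas A (cinv c) y v)))"


section \<open>Linear connections\<close>

text \<open>
  A linear connection on the open submanifold \<open>W\<close>. The second condition only says that \<open>D\<close> is a
  well-defined operation on fields on \<open>W\<close>. Homogeneity in \<open>Y\<close> under real constants is the Leibniz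
  rule for constant \<open>f\<close>. No condition on the torsion.
\<close>

definition linear_connection_on ::
  "('a, 'e::finite_dim_normed) atlas \<Rightarrow> 'a set \<Rightarrow> (('a \<Rightarrow> 'e) \<Rightarrow> ('a \<Rightarrow> 'e) \<Rightarrow> ('a \<Rightarrow> 'e)) \<Rightarrow> bool"
where
  "linear_connection_on A W D \<longleftrightarrow>
     (\<forall>X\<in>vector_fields A W. \<forall>Y\<in>vector_fields A W. D X Y \<in> vector_fields A W) \<and>
     (\<forall>X\<in>vector_fields A W. \<forall>X'\<in>vector_fields A W. \<forall>Y\<in>vector_fields A W. \<forall>Y'\<in>vector_fields A W.
        (\<forall>p\<in>W. X p = X' p) \<and> (\<forall>p\<in>W. Y p = Y' p) \<longrightarrow> (\<forall>p\<in>W. D X Y p = D X' Y' p)) \<and>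
     (\<forall>X\<in>vector_fields A W. \<forall>X'\<in>vector_fields A W. \<forall>Y\<in>vector_fields A W. \<forall>p\<in>W.
        D (\<lambda>q. X q + X' q) Y p = D X Y p + D X' Y p) \<and>
     (\<forall>X\<in>vector_fields A W. \<forall>Y\<in>vector_fields A W. \<forall>Y'\<in>vector_fields A W. \<forall>p\<in>W.
        D X (\<lambda>q. Y q + Y' q) p = D X Y p + D X Y' p) \<and>
     (\<forall>f::'a \<Rightarrow> real. msmooth_on A model_atlas W f \<longrightarrow>
        (\<forall>X\<in>vector_fields A W. \<forall>Y\<in>vector_fields A W. \<forall>p\<in>W.
           D (\<lambda>q. f q *\<^sub>R X q) Y p = f p *\<^sub>R D X Y p \<and>
           D X (\<lambda>q. f q *\<^sub>R Y q) p = mderiv A model_atlas f p (X p) *\<^sub>R Y p + f p *\<^sub>R D X Y p))"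

text \<open>
  \<open>E\<close> is the connection which the connection \<open>D\<close> on the whole manifold induces on the open set \<open>W\<close>.
  On fields on \<open>W\<close>, \<open>E\<close> is uniquely determined by \<open>D\<close>: by means of bump functions every field on
  \<open>W\<close> agrees near a given point with the restriction of a global field.
\<close>

definition induced_connection ::
  "('a, 'e::finite_dim_normed) atlas \<Rightarrow> (('a \<Rightarrow> 'e) \<Rightarrow> ('a \<Rightarrow> 'e) \<Rightarrow> ('a \<Rightarrow> 'e)) \<Rightarrow>
   'a set \<Rightarrow> (('a \<Rightarrow> 'e) \<Rightarrow> ('a \<Rightarrow> 'e) \<Rightarrow> ('a \<Rightarrow> 'e)) \<Rightarrow> bool"
where
  "induced_connection A D W E \<longleftrightarrow> linear_connection_on A W E \<and>
     (\<forall>X\<in>vector_fields A (mcarrier A). \<forall>Y\<in>vector_fields A (mcarrier A). \<forall>p\<in>W. E X Y p = D X Y p)"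

text \<open>Push-forward of a field on \<open>W\<close> under a diffeomorphism \<open>\<gamma>\<close> defined on \<open>W\<close>.\<close>

definition push_field ::
  "('a, 'e::finite_dim_normed) atlas \<Rightarrow> 'a set \<Rightarrow> ('a \<Rightarrow> 'a) \<Rightarrow> ('a \<Rightarrow> 'e) \<Rightarrow> ('a \<Rightarrow> 'e)"
where
  "push_field A W \<gamma> X q = mderiv A A \<gamma> (inv_into W \<gamma> q) (X (inv_into W \<gamma> q))"

definition connection_iso ::
  "('a, 'e::finite_dim_normed) atlas \<Rightarrow> (('a \<Rightarrow> 'e) \<Rightarrow> ('a \<Rightarrow> 'e) \<Rightarrow> ('a \<Rightarrow> 'e)) \<Rightarrow>
   'a set \<Rightarrow> 'a set \<Rightarrow> ('a \<Rightarrow> 'a) \<Rightarrow> bool"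
where
  "connection_iso A D W W' \<gamma> \<longleftrightarrow> mdiffeo A A W W' \<gamma> \<and>
     (\<exists>E E'. induced_connection A D W E \<and> induced_connection A D W' E' \<and>
        (\<forall>X\<in>vector_fields A W. \<forall>Y\<in>vector_fields A W. \<forall>q\<in>W'.
           push_field A W \<gamma> (E X Y) q = E' (push_field A W \<gamma> X) (push_field A W \<gamma> Y) q))"


section \<open>Foliations and cocycles\<close>

text \<open>
  A foliation of \<open>M\<close>, of codimension the dimension of \<open>'q\<close>, is given by the maximal family of its
  distinguished (locally defined) submersions into \<open>'q\<close>: the domains cover \<open>M\<close> and on overlaps any
  two of them differ locally by a diffeomorphism of open subsets of \<open>'q\<close>. Their fibres are the
  leaves, locally.
\<close>

type_synonym ('m, 'q) foliation = "('m set \<times> ('m \<Rightarrow> 'q)) set"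

definition submersions_compatible ::
  "('m, 'e::finite_dim_normed) atlas \<Rightarrow> 'm set \<times> ('m \<Rightarrow> 'q::finite_dim_normed) \<Rightarrow> 'm set \<times> ('m \<Rightarrow> 'q) \<Rightarrow> bool"
where
  "submersions_compatible M s t \<longleftrightarrow>
     (\<forall>x \<in> fst s \<inter> fst t. \<exists>W h. openin (mtop M) W \<and> x \<in> W \<and> W \<subseteq> fst s \<inter> fst t \<and>
        mdiffeo model_atlas model_atlas (snd t ` W) (snd s ` W) h \<and> (\<forall>y\<in>W. snd s y = h (snd t y)))"

definition local_submersion ::
  "('m, 'e::finite_dim_normed) atlas \<Rightarrow> 'm set \<times> ('m \<Rightarrow> 'q::finite_dim_normed) \<Rightarrow> bool" where
  "local_submersion M s \<longleftrightarrow> openin (mtop M) (fst s) \<and> submersion_on M model_atlas (fst s) (snd s)"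

definition foliation ::
  "('m, 'e::finite_dim_normed) atlas \<Rightarrow> ('m, 'q::finite_dim_normed) foliation \<Rightarrow> bool" where
  "foliation M F \<longleftrightarrow>
     manifold M \<and>
     (\<forall>s\<in>F. local_submersion M s) \<and>
     (\<Union>s\<in>F. fst s) = mcarrier M \<and>
     (\<forall>s\<in>F. \<forall>t\<in>F. submersions_compatible M s t) \<and>
     (\<forall>s. local_submersion M s \<and> (\<forall>t\<in>F. submersions_compatible M s t \<and> submersions_compatible M t s)
        \<longrightarrow> s \<in> F)"

text \<open>The family \<open>{U i, f i, \<gamma> i j}\<close>, \<open>i, j \<in> J\<close>, is an \<open>N\<close>-cocycle on \<open>M\<close>.\<close>

definition cocycle ::
  "('m, 'e::finite_dim_normed) atlas \<Rightarrow> ('n, 'q::finite_dim_normed) atlas \<Rightarrow> 'i set \<Rightarrow>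
   ('i \<Rightarrow> 'm set) \<Rightarrow> ('i \<Rightarrow> 'm \<Rightarrow> 'n) \<Rightarrow> ('i \<Rightarrow> 'i \<Rightarrow> 'n \<Rightarrow> 'n) \<Rightarrow> bool"
where
  "cocycle M N J U f \<gamma> \<longleftrightarrow>
     (\<forall>i\<in>J. openin (mtop M) (U i) \<and> connectedin (mtop M) (U i)) \<and>
     (\<Union>i\<in>J. U i) = mcarrier M \<and>
     (\<forall>i\<in>J. submersion_on M N (U i) (f i) \<and>
        (\<forall>v \<in> f i ` U i. connectedin (mtop M) {x \<in> U i. f i x = v})) \<and>
     (\<forall>i\<in>J. \<forall>j\<in>J. U i \<inter> U j \<noteq> {} \<longrightarrow>
        mdiffeo N N (f j ` (U i \<inter> U j)) (f i ` (U i \<inter> U j)) (\<gamma> i j) \<and>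
        (\<forall>x \<in> U i \<inter> U j. f i x = \<gamma> i j (f j x))) \<and>
     (\<forall>i\<in>J. \<forall>j\<in>J. \<forall>k\<in>J. \<forall>v \<in> f k ` (U i \<inter> U j \<inter> U k). \<gamma> i j (\<gamma> j k v) = \<gamma> i k v) \<and>
     (\<forall>i\<in>J. \<forall>v \<in> f i ` U i. \<gamma> i i v = v)"

text \<open>
  A cocycle defines the foliation \<open>F\<close> if its submersions, read in the charts of \<open>N\<close>, are
  distinguished for \<open>F\<close>. By maximality this determines \<open>F\<close>.
\<close>

definition cocycle_defines ::
  "('n, 'q::finite_dim_normed) atlas \<Rightarrow> 'i set \<Rightarrow> ('i \<Rightarrow> 'm set) \<Rightarrow> ('i \<Rightarrow> 'm \<Rightarrow> 'n) \<Rightarrow>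
   ('m, 'q) foliation \<Rightarrow> bool"
where
  "cocycle_defines N J U f F \<longleftrightarrow>
     (\<forall>i\<in>J. \<forall>c\<in>N. ({x \<in> U i. f i x \<in> cdom c}, cmap c \<circ> f i) \<in> F)"

text \<open>
  The type argument only fixes the types over which the existential quantifiers range: \<open>'i\<close> for
  the index set, \<open>'n\<close> for the points of the transversal manifold.
\<close>

definition foliation_with_transversal_linear_connection ::
  "('i \<times> 'n) itself \<Rightarrow> ('m, 'e::finite_dim_normed) atlas \<Rightarrow> ('m, 'q::finite_dim_normed) foliation \<Rightarrow> bool"
where
  "foliation_with_transversal_linear_connection T M F \<longleftrightarrow>
     foliation M F \<and>
     (\<exists>(N :: ('n, 'q) atlas) D (J :: 'i set) U f \<gamma>.
        manifold N \<and> linear_connection_on N (mcarrier N) D \<and>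
        cocycle M N J U f \<gamma> \<and> cocycle_defines N J U f F \<and>
        (\<forall>i\<in>J. \<forall>j\<in>J. U i \<inter> U j \<noteq> {} \<longrightarrow>
           connection_iso N D (f j ` (U i \<inter> U j)) (f i ` (U i \<inter> U j)) (\<gamma> i j)))"


section \<open>Lie groups and Cartan geometries\<close>

definition lie_group :: "'g monoid \<Rightarrow> ('g, 'a::finite_dim_normed) atlas \<Rightarrow> bool" where
  "lie_group G A \<longleftrightarrow>
     group G \<and> manifold A \<and> mcarrier A = carrier G \<and>
     msmooth_on (prod_atlas A A) A (carrier G \<times> carrier G) (\<lambda>(x, y). x \<otimes>\<^bsub>G\<^esub> y) \<and>
     msmooth_on A A (carrier G) (\<lambda>x. inv\<^bsub>G\<^esub> x)"

text \<open>
  A closed subgroup \<open>H\<close> of a Lie group carries exactly one smooth structure as an embedded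
  submanifold (and is then a Lie group). It is given here as an atlas \<open>B\<close> with underlying set \<open>H\<close>.
\<close>

definition closed_lie_subgroup ::
  "'g monoid \<Rightarrow> ('g, 'a::finite_dim_normed) atlas \<Rightarrow> ('g, 'h::finite_dim_normed) atlas \<Rightarrow> bool" where
  "closed_lie_subgroup G A B \<longleftrightarrow>
     subgroup (mcarrier B) G \<and> closedin (mtop A) (mcarrier B) \<and>
     lie_group (G\<lparr>carrier := mcarrier B\<rparr>) B \<and>
     mtop B = subtopology (mtop A) (mcarrier B) \<and>
     msmooth_on B A (mcarrier B) (\<lambda>x. x) \<and>
     (\<forall>x\<in>mcarrier B. inj (mderiv B A (\<lambda>x. x) x))"

text \<open>
  The Lie algebra of \<open>G\<close> is the tangent space at the unit, hence the model space \<open>'a\<close> of \<open>G\<close>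
  as a vector space (the bracket is not needed); likewise for \<open>H\<close>, whose Lie algebra \<open>'h\<close> becomes
  a subspace of \<open>'a\<close> by means of the differential of the inclusion.
\<close>

definition Ad :: "'g monoid \<Rightarrow> ('g, 'a::finite_dim_normed) atlas \<Rightarrow> 'g \<Rightarrow> 'a \<Rightarrow> 'a" where
  "Ad G A g = mderiv A A (\<lambda>x. g \<otimes>\<^bsub>G\<^esub> x \<otimes>\<^bsub>G\<^esub> inv\<^bsub>G\<^esub> g) \<one>\<^bsub>G\<^esub>"

definition lie_incl ::
  "'g monoid \<Rightarrow> ('g, 'a::finite_dim_normed) atlas \<Rightarrow> ('g, 'h::finite_dim_normed) atlas \<Rightarrow> 'h \<Rightarrow> 'a" where
  "lie_incl G A B = mderiv B A (\<lambda>x. x) \<one>\<^bsub>G\<^esub>"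

text \<open>
  \<open>(P, \<pi>, \<cdot>, \<omega>)\<close> over \<open>N\<close>, of type \<open>(G, H)\<close>. The type variables in the second line are the model
  spaces of \<open>G\<close>, \<open>H\<close>, \<open>N\<close> and \<open>P\<close>.
\<close>

record ('g, 'n, 'p,
        'a, 'h, 'q, 'r) cartan_data =
  Grp :: "'g monoid"
  GrpA :: "('g, 'a) atlas"
  SubA :: "('g, 'h) atlas"
  Base :: "('n, 'q) atlas"
  Total :: "('p, 'r) atlas"
  Proj :: "'p \<Rightarrow> 'n"
  Act :: "'p \<Rightarrow> 'g \<Rightarrow> 'p"
  Form :: "'p \<Rightarrow> 'r \<Rightarrow> 'a"

text \<open>The part of the total space over \<open>W\<close>.\<close>

definition over ::
  "('g, 'n, 'p, 'a::finite_dim_normed, 'h::finite_dim_normed, 'q::finite_dim_normed,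
    'r::finite_dim_normed) cartan_data \<Rightarrow> 'n set \<Rightarrow> 'p set" where
  "over \<xi> W = {w \<in> mcarrier (Total \<xi>). Proj \<xi> w \<in> W}"

definition principal_bundle ::
  "('g, 'n, 'p, 'a::finite_dim_normed, 'h::finite_dim_normed, 'q::finite_dim_normed,
    'r::finite_dim_normed) cartan_data \<Rightarrow> bool" where
  "principal_bundle \<xi> \<longleftrightarrow>
    (let G = Grp \<xi>; H = mcarrier (SubA \<xi>); P = mcarrier (Total \<xi>); N = mcarrier (Base \<xi>) in
     manifold (Base \<xi>) \<and> manifold (Total \<xi>) \<and>
     msmooth_on (Total \<xi>) (Base \<xi>) P (Proj \<xi>) \<and> Proj \<xi> ` P = N \<and>
     msmooth_on (prod_atlas (Total \<xi>) (SubA \<xi>)) (Total \<xi>) (P \<times> H) (\<lambda>(w, h). Act \<xi> w h) \<and>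
     (\<forall>w\<in>P. Act \<xi> w \<one>\<^bsub>G\<^esub> = w) \<and>
     (\<forall>w\<in>P. \<forall>h\<in>H. \<forall>k\<in>H. Act \<xi> (Act \<xi> w h) k = Act \<xi> w (h \<otimes>\<^bsub>G\<^esub> k)) \<and>
     (\<forall>w\<in>P. \<forall>h\<in>H. Act \<xi> w h = w \<longrightarrow> h = \<one>\<^bsub>G\<^esub>) \<and>
     (\<forall>w\<in>P. \<forall>w'\<in>P. Proj \<xi> w = Proj \<xi> w' \<longleftrightarrow> (\<exists>h\<in>H. w' = Act \<xi> w h)) \<and>
     (\<forall>x\<in>N. \<exists>U \<psi>. openin (mtop (Base \<xi>)) U \<and> x \<in> U \<and>
        mdiffeo (Total \<xi>) (prod_atlas (Base \<xi>) (SubA \<xi>)) (over \<xi> U) (U \<times> H) \<psi> \<and>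
        (\<forall>w\<in>over \<xi> U. fst (\<psi> w) = Proj \<xi> w \<and>
           (\<forall>h\<in>H. snd (\<psi> (Act \<xi> w h)) = snd (\<psi> w) \<otimes>\<^bsub>G\<^esub> h))))"

text \<open>
  In the last condition \<open>mderiv (SubA \<xi>) (Total \<xi>) (Act \<xi> w) \<one> A\<close> is the value at \<open>w\<close> of the
  fundamental vector field of \<open>A\<close>.
\<close>

definition cartan_geometry ::
  "('g, 'n, 'p, 'a::finite_dim_normed, 'h::finite_dim_normed, 'q::finite_dim_normed,
    'r::finite_dim_normed) cartan_data \<Rightarrow> bool" where
  "cartan_geometry \<xi> \<longleftrightarrow>
    (let G = Grp \<xi>; H = mcarrier (SubA \<xi>); P = mcarrier (Total \<xi>); \<omega> = Form \<xi> in
     lie_group G (GrpA \<xi>) \<and> closed_lie_subgroup G (GrpA \<xi>) (SubA \<xi>) \<and>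
     principal_bundle \<xi> \<and>
     smooth_one_form (Total \<xi>) \<omega> \<and>
     (\<forall>w\<in>P. bij (\<omega> w)) \<and>
     (\<forall>w\<in>P. \<forall>h\<in>H. \<forall>v.
        \<omega> (Act \<xi> w h) (mderiv (Total \<xi>) (Total \<xi>) (\<lambda>u. Act \<xi> u h) w v)
          = Ad G (GrpA \<xi>) (inv\<^bsub>G\<^esub> h) (\<omega> w v)) \<and>
     (\<forall>w\<in>P. \<forall>A. \<omega> w (mderiv (SubA \<xi>) (Total \<xi>) (Act \<xi> w) \<one>\<^bsub>G\<^esub> A)
          = lie_incl G (GrpA \<xi>) (SubA \<xi>) A))"

definition reductive ::
  "('g, 'n, 'p, 'a::finite_dim_normed, 'h::finite_dim_normed, 'q::finite_dim_normed,
    'r::finite_dim_normed) cartan_data \<Rightarrow> bool" where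
  "reductive \<xi> \<longleftrightarrow>
    (let \<hh> = range (lie_incl (Grp \<xi>) (GrpA \<xi>) (SubA \<xi>)) in
     \<exists>V. subspace V \<and> (\<forall>h\<in>mcarrier (SubA \<xi>). Ad (Grp \<xi>) (GrpA \<xi>) h ` V \<subseteq> V) \<and>
         \<hh> \<inter> V = {0} \<and> (\<forall>x. \<exists>a\<in>\<hh>. \<exists>b\<in>V. x = a + b))"

text \<open>
  \<open>\<Gamma>\<close> is an isomorphism from the Cartan geometry induced by \<open>\<xi>\<close> on the open set \<open>W\<close> onto the one
  induced on \<open>W'\<close>, with projection \<open>\<gamma>\<close>.
\<close>

definition cartan_iso ::
  "('g, 'n, 'p, 'a::finite_dim_normed, 'h::finite_dim_normed, 'q::finite_dim_normed,
    'r::finite_dim_normed) cartan_data \<Rightarrow> 'n set \<Rightarrow> 'n set \<Rightarrow> ('p \<Rightarrow> 'p) \<Rightarrow> ('n \<Rightarrow> 'n) \<Rightarrow> bool" where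
  "cartan_iso \<xi> W W' \<Gamma> \<gamma> \<longleftrightarrow>
     mdiffeo (Total \<xi>) (Total \<xi>) (over \<xi> W) (over \<xi> W') \<Gamma> \<and>
     mdiffeo (Base \<xi>) (Base \<xi>) W W' \<gamma> \<and>
     (\<forall>w\<in>over \<xi> W. Proj \<xi> (\<Gamma> w) = \<gamma> (Proj \<xi> w)) \<and>
     (\<forall>w\<in>over \<xi> W. \<forall>h\<in>mcarrier (SubA \<xi>). \<Gamma> (Act \<xi> w h) = Act \<xi> (\<Gamma> w) h) \<and>
     (\<forall>w\<in>over \<xi> W. \<forall>v. Form \<xi> (\<Gamma> w) (mderiv (Total \<xi>) (Total \<xi>) \<Gamma> w v) = Form \<xi> w v)"

text \<open>
  The foliation \<open>F\<close> is modelled on \<open>\<xi>\<close> by means of \<open>{U i, f i, \<Gamma> i j}\<close>. The identity for \<open>\<Gamma>\<close>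
  is required over the image of the triple intersection, where both sides are defined.
\<close>

definition cartan_foliation_cocycle ::
  "('g, 'n, 'p, 'a::finite_dim_normed, 'h::finite_dim_normed, 'q::finite_dim_normed,
    'r::finite_dim_normed) cartan_data \<Rightarrow> ('m, 'e::finite_dim_normed) atlas \<Rightarrow> ('m, 'q) foliation \<Rightarrow>
   'i set \<Rightarrow> ('i \<Rightarrow> 'm set) \<Rightarrow> ('i \<Rightarrow> 'm \<Rightarrow> 'n) \<Rightarrow> ('i \<Rightarrow> 'i \<Rightarrow> 'p \<Rightarrow> 'p) \<Rightarrow> bool"
where
  "cartan_foliation_cocycle \<xi> M F J U f \<Gamma> \<longleftrightarrow>
     (\<exists>\<gamma>. cocycle M (Base \<xi>) J U f \<gamma> \<and> cocycle_defines (Base \<xi>) J U f F \<and>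
        (\<forall>i\<in>J. \<forall>j\<in>J. U i \<inter> U j \<noteq> {} \<longrightarrow>
           cartan_iso \<xi> (f j ` (U i \<inter> U j)) (f i ` (U i \<inter> U j)) (\<Gamma> i j) (\<gamma> i j))) \<and>
     (\<forall>i\<in>J. \<forall>j\<in>J. \<forall>k\<in>J. \<forall>w \<in> over \<xi> (f k ` (U i \<inter> U j \<inter> U k)). \<Gamma> i j (\<Gamma> j k w) = \<Gamma> i k w) \<and>
     (\<forall>i\<in>J. \<forall>w \<in> over \<xi> (f i ` U i). \<Gamma> i i w = w)"

definition reductive_cartan_foliation ::
  "('i \<times> ('g, 'n, 'p, 'a::finite_dim_normed, 'h::finite_dim_normed, 'q::finite_dim_normed,
    'r::finite_dim_normed) cartan_data) itself \<Rightarrow>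
   ('m, 'e::finite_dim_normed) atlas \<Rightarrow> ('m, 'q) foliation \<Rightarrow> bool"
where
  "reductive_cartan_foliation T M F \<longleftrightarrow>
     foliation M F \<and>
     (\<exists>(\<xi> :: ('g, 'n, 'p, 'a, 'h, 'q, 'r) cartan_data) (J :: 'i set) U f \<Gamma>.
        cartan_geometry \<xi> \<and> reductive \<xi> \<and> cartan_foliation_cocycle \<xi> M F J U f \<Gamma>)"

end

(*
Let g = h + V be the reductive splitting. At a point w of the bundle P, the Cartan form omega
and the projection dpi identify V with the tangent space of N at pi(w): a tangent vector v has a
unique lift hlift w v with dpi(hlift w v) = v and omega(hlift w v) in V, since the kernel of dpi is
omega^-1(h). A vector field Y then becomes the V-valued function omega(hlift(Y)) on P, and
  nabla_X Y = dpi(omega^-1(d(omega(hlift(Y)))(hlift(X)))),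
evaluated at any point of the fibre. Ad(H)-invariance of V makes this independent of that point, and
as only omega and pi enter, isomorphisms of Cartan geometries preserve nabla. The formula is local,
so the same operation serves as the induced connection on every open subset of N. The sets
f_j(U_i Int U_j) are open in N because submersions are open maps.
*)

theory Submission
  imports Defs
begin

text \<open>At a point w over x the tangent space of N becomes the fixed vector space V, so a field
  can be differentiated as a V-valued function. Moving to another point of the fibre, or through an
  isomorphism, composes this function with a constant linear map, Ad(h^-1) or the identity. Constant
  linear maps commute with differentiation, so both invariance statements are one computation. The
  obstacle is smoothness. Tangent vectors are recorded in charts chosen point by point with no
  regularity, so neither \<open>hlift\<close> nor the inverse of the Cartan form is smooth as it
  stands. In a fixed chart of P both are solutions s of a linear equation A(z) s(z) = u(z) with
  smooth A and u and bijective A(z). Such solutions are smooth, since differentiating the equation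
  gives one for the derivative of s with the same A. The horizontal lift has this form because the
  differential of the projection together with the h-component of omega is an isomorphism from T_w P
  onto T_x N x h. Local sections of the bundle carry smoothness from P down to N.\<close>

section \<open>Linear algebra in finite-dimensional normed spaces\<close>

text \<open>The class only provides a spanning set, whose coefficients are not unique. Thinning it
  to an independent set makes them linear functions of the vector; these coordinates underlie the
  norm estimates below.\<close>

lemma finite_dim_basis:
  obtains B :: "'a::finite_dim_normed set" and r where "finite B" "independent B"
    "\<And>x. (\<Sum>b\<in>B. r b x *\<^sub>R b) = x" "\<And>b. linear (r b)"
proof -
  obtain C :: "'a set" where C: "finite C" "\<And>x. \<exists>a. x = (\<Sum>b\<in>C. a b *\<^sub>R b)"
    using ex_finite_spanning by blast
  have sp: "span C = UNIV"
    using C span_finite[OF C(1)] by (auto simp: image_def)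
  obtain B where B: "B \<subseteq> C" "independent B" "C \<subseteq> span B"
    using maximal_independent_subset by blast
  have fin: "finite B"
    using B(1) C(1) finite_subset by blast
  have spB: "span B = UNIV"
    using B(3) sp span_mono span_span by blast
  have "(\<Sum>b\<in>B. representation B x b *\<^sub>R b) = x" for x
    using B(2) fin spB by (intro sum_representation_eq) auto
  moreover have "linear (\<lambda>x. representation B x b)" for b
    using B(2) spB by (intro linearI) (auto simp: representation_add representation_scale)
  ultimately show thesis
    using that[of B "\<lambda>b x. representation B x b"] fin B(2) by blast
qed

text \<open>Equivalence of norms, by induction on the basis. The bound for \<open>B\<close> makes
  \<open>span B\<close> closed, so a new vector \<open>b\<close> outside of it has a positive
  distance from it, and this distance controls the coefficient of \<open>b\<close>.\<close>

lemma independent_coeff_bound: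
  fixes B :: "'a::real_normed_vector set"
  assumes "finite B" "independent B"
  shows "\<exists>K\<ge>0. \<forall>r. \<forall>b\<in>B. \<bar>r b\<bar> \<le> K * norm (\<Sum>b\<in>B. r b *\<^sub>R b)"
  using assms
proof (induction B)
  case empty
  then show ?case by auto
next
  case (insert b B)
  have indB: "independent B" and nb: "b \<notin> span B"
    using insert.prems insert.hyps by (auto simp: independent_insert)
  obtain K where K: "K \<ge> 0" "\<And>r c. c \<in> B \<Longrightarrow> \<bar>r c\<bar> \<le> K * norm (\<Sum>b\<in>B. r b *\<^sub>R b)"
    using insert.IH[OF indB] by blast
  \<comment> \<open>By the bound for \<open>B\<close> the coefficients of a convergent sequence are
    Cauchy, and their limits are coefficients of the limit.\<close>
  have closed: "closed (span B)"
    unfolding closed_sequential_limits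
  proof (intro allI impI, elim conjE)
    fix x l assume x: "\<forall>n. x n \<in> span B" "x \<longlonglongrightarrow> l"
    have "\<forall>n. \<exists>r. x n = (\<Sum>c\<in>B. r c *\<^sub>R c)"
      using x(1) span_finite[OF insert.hyps(1)] by auto
    then obtain r where r: "\<And>n. x n = (\<Sum>c\<in>B. r n c *\<^sub>R c)"
      by metis
    have "Cauchy x"
      using x(2) LIMSEQ_imp_Cauchy by blast
    have "convergent (\<lambda>n. r n c)" if c: "c \<in> B" for c
    proof -
      have d: "\<bar>r m c - r n c\<bar> \<le> K * norm (x m - x n)" for m n
        using K(2)[OF c, of "\<lambda>c. r m c - r n c"] by (simp add: r scaleR_diff_left sum_subtractf)
      have "Cauchy (\<lambda>n. r n c)"
      proof (rule metric_CauchyI)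
        fix e :: real assume "e > 0"
        \<comment> \<open>The constant \<open>K\<close> may be 0, hence the division by
          \<open>K + 1\<close>.\<close>
        then have "e / (K + 1) > 0" using K(1) by simp
        then obtain M where M: "\<And>m n. m \<ge> M \<Longrightarrow> n \<ge> M \<Longrightarrow> dist (x m) (x n) < e / (K + 1)"
          using \<open>Cauchy x\<close> metric_CauchyD by metis
        have "dist (r m c) (r n c) < e" if "m \<ge> M" "n \<ge> M" for m n
        proof -
          have "dist (r m c) (r n c) \<le> (K + 1) * dist (x m) (x n)"
            using d[of m n] norm_ge_zero[of "x m - x n"]
            unfolding dist_norm real_norm_def distrib_right by linarith
          also have "\<dots> < (K + 1) * (e / (K + 1))"
            using M[OF that] K(1) by (intro mult_strict_left_mono) auto
          finally show ?thesis using K(1) by simp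
        qed
        then show "\<exists>M. \<forall>m\<ge>M. \<forall>n\<ge>M. dist (r m c) (r n c) < e" by blast
      qed
      then show ?thesis by (simp add: Cauchy_convergent_iff)
    qed
    then obtain s where s: "\<And>c. c \<in> B \<Longrightarrow> (\<lambda>n. r n c) \<longlonglongrightarrow> s c"
      unfolding convergent_def by metis
    have "x \<longlonglongrightarrow> (\<Sum>c\<in>B. s c *\<^sub>R c)"
      unfolding r by (intro tendsto_sum tendsto_scaleR s tendsto_const)
    then have "l = (\<Sum>c\<in>B. s c *\<^sub>R c)"
      using x(2) LIMSEQ_unique by blast
    then show "l \<in> span B"
      by (simp add: span_sum span_scale span_base)
  qed
  obtain \<delta> where \<delta>: "\<delta> > 0" "\<And>y. y \<in> span B \<Longrightarrow> \<delta> \<le> dist b y"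
  proof -
    obtain \<delta> where "\<delta> > 0" "ball b \<delta> \<subseteq> - span B"
      using closed nb open_contains_ball[of "- span B"] by (auto simp: open_Compl)
    then show thesis by (intro that[of \<delta>]) (force simp: subset_iff)+
  qed
  \<comment> \<open>After division by \<open>t\<close> the vector is the difference of
    \<open>b\<close> and an element of \<open>span B\<close>.\<close>
  have main: "\<bar>t\<bar> * \<delta> \<le> norm (t *\<^sub>R b + y)" if y: "y \<in> span B" for t y
  proof (cases "t = 0")
    case False
    have "- (inverse t) *\<^sub>R y \<in> span B" using y by (simp add: span_scale span_neg)
    from \<delta>(2)[OF this] have "\<delta> \<le> norm (b + inverse t *\<^sub>R y)"
      by (simp add: dist_norm)
    then have "\<bar>t\<bar> * \<delta> \<le> \<bar>t\<bar> * norm (b + inverse t *\<^sub>R y)"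
      by (simp add: mult_left_mono)
    also have "\<dots> = norm (t *\<^sub>R (b + inverse t *\<^sub>R y))" by simp
    also have "t *\<^sub>R (b + inverse t *\<^sub>R y) = t *\<^sub>R b + y" using False by (simp add: scaleR_add_right)
    finally show ?thesis .
  qed simp
  \<comment> \<open>The first summand bounds the coefficient of \<open>b\<close>. The second one
    bounds those over \<open>B\<close>, where the norm of the partial sum over \<open>B\<close> is
    estimated by the triangle inequality.\<close>
  define K' where "K' = 1 / \<delta> + K * (1 + norm b / \<delta>)"
  have "\<bar>r c\<bar> \<le> K' * norm (\<Sum>b\<in>insert b B. r b *\<^sub>R b)" if c: "c \<in> insert b B" for r c
  proof -
    define y where "y = (\<Sum>c\<in>B. r c *\<^sub>R c)"
    define T where "T = norm (r b *\<^sub>R b + y)"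
    have tot: "(\<Sum>b\<in>insert b B. r b *\<^sub>R b) = r b *\<^sub>R b + y"
      using insert.hyps by (simp add: y_def)
    have yB: "y \<in> span B" by (simp add: y_def span_sum span_scale span_base)
    have 1: "\<bar>r b\<bar> \<le> T / \<delta>"
      using main[OF yB, of "r b"] \<delta>(1) by (simp add: T_def pos_le_divide_eq)
    have "norm y \<le> T + norm (r b *\<^sub>R b)"
      using norm_triangle_ineq4[of "r b *\<^sub>R b + y" "r b *\<^sub>R b"] by (simp add: T_def)
    also have "\<dots> \<le> T + (T / \<delta>) * norm b"
      using mult_right_mono[OF 1 norm_ge_zero[of b]] by simp
    finally have 2: "norm y \<le> (1 + norm b / \<delta>) * T"
      by (simp add: algebra_simps)
    have T0: "T \<ge> 0" by (simp add: T_def)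
    have p1: "0 \<le> T / \<delta>" and p2: "0 \<le> K * ((1 + norm b / \<delta>) * T)"
      using T0 \<delta>(1) K(1) by simp_all
    have K'T: "K' * T = T / \<delta> + K * ((1 + norm b / \<delta>) * T)"
      by (simp add: K'_def algebra_simps)
    show ?thesis
    proof (cases "c = b")
      case True
      then show ?thesis using 1 p2 K'T by (simp add: tot flip: T_def)
    next
      case False
      then have "\<bar>r c\<bar> \<le> K * norm y" using K(2)[of c r] c by (simp add: y_def)
      also have "\<dots> \<le> K * ((1 + norm b / \<delta>) * T)" using 2 K(1) by (rule mult_left_mono)
      finally show ?thesis using p1 K'T by (simp add: tot flip: T_def)
    qed
  qed
  moreover have "K' \<ge> 0" using K(1) \<delta>(1) by (simp add: K'_def)
  ultimately show ?case by blast
qed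

lemma linear_imp_bounded_linear:
  fixes f :: "'a::finite_dim_normed \<Rightarrow> 'b::real_normed_vector"
  assumes "linear f"
  shows "bounded_linear f"
proof -
  obtain B :: "'a set" and r where B: "finite B" "independent B"
    "\<And>x. (\<Sum>b\<in>B. r b x *\<^sub>R b) = x" "\<And>b. linear (r b)"
    using finite_dim_basis by blast
  obtain K where K: "K \<ge> 0" "\<And>r b. b \<in> B \<Longrightarrow> \<bar>r b\<bar> \<le> K * norm (\<Sum>b\<in>B. r b *\<^sub>R b)"
    using independent_coeff_bound[OF B(1,2)] by blast
  have "norm (f x) \<le> norm x * (\<Sum>b\<in>B. K * norm (f b))" for x
  proof -
    have "f x = f (\<Sum>b\<in>B. r b x *\<^sub>R b)" by (simp add: B(3))
    also have "\<dots> = (\<Sum>b\<in>B. r b x *\<^sub>R f b)"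
      by (simp add: linear_sum[OF assms] linear_scale[OF assms])
    finally have "norm (f x) \<le> (\<Sum>b\<in>B. norm (r b x *\<^sub>R f b))" by (simp add: sum_norm_le)
    also have "\<dots> \<le> (\<Sum>b\<in>B. (K * norm x) * norm (f b))"
      using K(2)[of _ "\<lambda>b. r b x"] by (intro sum_mono) (simp add: B(3) mult_right_mono)
    finally show ?thesis by (simp add: sum_distrib_left mult_ac)
  qed
  then show ?thesis
    using assms by (intro bounded_linear_intro[where K = "\<Sum>b\<in>B. K * norm (f b)"])
      (auto simp: linear_add linear_scale)
qed

text \<open>Coordinates are bounded functionals, so convergence reduces to the reals. Completeness
  enters through Banach's fixed point theorem.\<close>

lemma complete_finite_dim: "complete (UNIV :: 'a::finite_dim_normed set)"
  unfolding complete_def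
proof (intro allI impI, elim conjE)
  fix x :: "nat \<Rightarrow> 'a" assume x: "Cauchy x"
  obtain B :: "'a set" and r where B: "finite B" "independent B"
    "\<And>x. (\<Sum>b\<in>B. r b x *\<^sub>R b) = x" "\<And>b. linear (r b)"
    using finite_dim_basis by blast
  have "convergent (\<lambda>n. r b (x n))" for b
    using bounded_linear.Cauchy[OF linear_imp_bounded_linear[OF B(4)] x]
    by (simp add: Cauchy_convergent_iff)
  then obtain s where s: "\<And>b. (\<lambda>n. r b (x n)) \<longlonglongrightarrow> s b"
    unfolding convergent_def by metis
  have "(\<lambda>n. \<Sum>b\<in>B. r b (x n) *\<^sub>R b) \<longlonglongrightarrow> (\<Sum>b\<in>B. s b *\<^sub>R b)"
    by (intro tendsto_sum tendsto_scaleR s tendsto_const)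
  then show "\<exists>l\<in>UNIV. x \<longlonglongrightarrow> l" by (auto simp: B(3))
qed

lemma linear_right_inverse_bounded:
  fixes f :: "'a::finite_dim_normed \<Rightarrow> 'b::finite_dim_normed"
  assumes "linear f" "surj f"
  obtains g where "bounded_linear g" "\<And>y. f (g y) = y"
  using linear_surj_right_inverse[OF assms(1), of UNIV UNIV] assms(2) 
  by (metis UNIV_I linear_imp_bounded_linear span_UNIV top_greatest)

lemma bounded_linear_inv_into:
  fixes f :: "'a::finite_dim_normed \<Rightarrow> 'b::finite_dim_normed"
  assumes "linear f" "bij f"
  shows "bounded_linear (inv_into UNIV f)"
proof (rule linear_imp_bounded_linear, rule linearI)
  have 1: "f (inv_into UNIV f y) = y" for y
    using assms(2) by (simp add: bij_is_surj surj_f_inv_f)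
  have 2: "x = inv_into UNIV f y" if "f x = y" for x y
    using that assms(2) by (metis bij_is_inj inv_f_f)
  show "inv_into UNIV f (x + y) = inv_into UNIV f x + inv_into UNIV f y" for x y
    by (rule 2[symmetric]) (simp add: linear_add[OF assms(1)] 1)
  show "inv_into UNIV f (c *\<^sub>R x) = c *\<^sub>R inv_into UNIV f x" for c x
    by (rule 2[symmetric]) (simp add: linear_scale[OF assms(1)] 1)
qed

section \<open>Calculus of functions of class \<open>C\<^sup>k\<close>\<close>

lemma has_derivative_frechet:
  "f differentiable (at x) \<Longrightarrow> (f has_derivative frechet_derivative f (at x)) (at x)"
  by (simp add: frechet_derivative_works)

lemma frechet_derivative_cong_open:
  assumes "open S" "x \<in> S" "\<And>y. y \<in> S \<Longrightarrow> f y = g y"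
  shows "frechet_derivative f (at x) = frechet_derivative g (at x)"
proof -
  have "(f has_derivative D) (at x) \<longleftrightarrow> (g has_derivative D) (at x)" for D
    using assms has_derivative_transform_within_open[of _ D x UNIV S] by metis
  then show ?thesis by (simp add: frechet_derivative_def)
qed

lemma differentiable_cong_open:
  assumes "open S" "x \<in> S" "\<And>y. y \<in> S \<Longrightarrow> f y = g y"
  shows "f differentiable (at x) \<Longrightarrow> g differentiable (at x)"
  using assms has_derivative_transform_within_open[of f _ x UNIV S g]
  unfolding differentiable_def by blast

lemma Ck_on_cong:
  assumes "open S" "\<And>x. x \<in> S \<Longrightarrow> f x = g x"
  shows "Ck_on k S f \<Longrightarrow> Ck_on k S g"
  using assms(2)
proof (induction k arbitrary: f g)
  case 0
  then show ?case by (simp cong: continuous_on_cong)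
next
  case (Suc k)
  have "Ck_on k S (\<lambda>x. frechet_derivative g (at x) v)" for v
  proof (rule Suc.IH)
    show "Ck_on k S (\<lambda>x. frechet_derivative f (at x) v)" using Suc.prems by simp
    show "frechet_derivative f (at x) v = frechet_derivative g (at x) v" if "x \<in> S" for x
      using frechet_derivative_cong_open[OF assms(1) that] Suc.prems(2) by metis
  qed
  moreover have "g differentiable (at x)" if "x \<in> S" for x
    using differentiable_cong_open[OF assms(1) that] Suc.prems that by auto
  ultimately show ?case by simp
qed

lemma Ck_on_Suc_imp: "Ck_on (Suc k) S f \<Longrightarrow> Ck_on k S f"
proof (induction k arbitrary: f)
  case 0
  then show ?case
    by (auto intro!: continuous_at_imp_continuous_on differentiable_imp_continuous_within)
next
  case (Suc k)
  then show ?case by (metis Ck_on.simps(2))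
qed

lemma Ck_on_subset:
  assumes "T \<subseteq> S"
  shows "Ck_on k S f \<Longrightarrow> Ck_on k T f"
proof (induction k arbitrary: f)
  case 0
  then show ?case using assms continuous_on_subset by auto
next
  case (Suc k)
  have "Ck_on k T (\<lambda>x. frechet_derivative f (at x) v)" for v
    by (rule Suc.IH) (use Suc.prems in simp)
  then show ?case using Suc.prems assms by auto
qed

text \<open>Derivatives are unique, so an explicit formula \<open>D\<close> may stand in for
  \<open>frechet_derivative\<close>. Most inductions on k below take their step in this
  form.\<close>

lemma Ck_on_SucI:
  assumes "open S" "\<And>x. x \<in> S \<Longrightarrow> (f has_derivative D x) (at x)"
    "\<And>v. Ck_on k S (\<lambda>x. D x v)"
  shows "Ck_on (Suc k) S f"
proof -
  have "D x = frechet_derivative f (at x)" if "x \<in> S" for x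
    using assms(2)[OF that] by (rule frechet_derivative_at)
  then have "Ck_on k S (\<lambda>x. frechet_derivative f (at x) v)" for v
    by (intro Ck_on_cong[OF assms(1) _ assms(3)[of v]]) simp
  then show ?thesis using assms(2) by (auto simp: differentiable_def)
qed

lemma Ck_on_SucD:
  assumes "Ck_on (Suc k) S f" "x \<in> S"
  shows "(f has_derivative frechet_derivative f (at x)) (at x)"
  using assms by (simp add: frechet_derivative_works)

lemma Ck_on_const:
  assumes "open S" shows "Ck_on k S (\<lambda>x. c)"
proof (induction k arbitrary: c)
  case 0
  show ?case unfolding Ck_on.simps by (rule continuous_on_const)
next
  case (Suc k)
  show ?case
    by (rule Ck_on_SucI[OF assms has_derivative_const Suc])
qed

lemma Ck_on_linear_comp:
  assumes "bounded_linear L" "open S"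
  shows "Ck_on k S f \<Longrightarrow> Ck_on k S (\<lambda>x. L (f x))"
proof (induction k arbitrary: f)
  case 0
  then show ?case using assms by (simp add: bounded_linear.continuous_on)
next
  case (Suc k)
  show ?case
  proof (rule Ck_on_SucI[OF assms(2)])
    show "((\<lambda>x. L (f x)) has_derivative (\<lambda>v. L (frechet_derivative f (at x) v))) (at x)" if "x \<in> S" for x
      using bounded_linear.has_derivative[OF assms(1) Ck_on_SucD[OF Suc.prems that]] .
    show "Ck_on k S (\<lambda>x. L (frechet_derivative f (at x) v))" for v
      by (rule Suc.IH) (use Suc.prems in simp)
  qed
qed

lemma Ck_on_id:
  assumes "open S" shows "Ck_on k S (\<lambda>x. x)"
proof (induction k)
  case 0
  show ?case unfolding Ck_on.simps by (rule continuous_on_id)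
next
  case (Suc k)
  show ?case
    by (rule Ck_on_SucI[OF assms has_derivative_ident Ck_on_const[OF assms]])
qed

lemma Ck_on_add:
  assumes "open S"
  shows "Ck_on k S f \<Longrightarrow> Ck_on k S g \<Longrightarrow> Ck_on k S (\<lambda>x. f x + g x)"
proof (induction k arbitrary: f g)
  case 0
  then show ?case by (simp add: continuous_on_add)
next
  case (Suc k)
  show ?case
  proof (rule Ck_on_SucI[OF assms])
    show "((\<lambda>x. f x + g x) has_derivative
        (\<lambda>v. frechet_derivative f (at x) v + frechet_derivative g (at x) v)) (at x)" if "x \<in> S" for x
      by (rule has_derivative_add[OF Ck_on_SucD[OF Suc.prems(1) that] Ck_on_SucD[OF Suc.prems(2) that]])
    show "Ck_on k S (\<lambda>x. frechet_derivative f (at x) v + frechet_derivative g (at x) v)" for v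
      using Suc.prems by (intro Suc.IH) simp_all
  qed
qed

lemma Ck_on_sum:
  assumes "open S"
  shows "(\<And>i. i \<in> I \<Longrightarrow> Ck_on k S (f i)) \<Longrightarrow> Ck_on k S (\<lambda>x. \<Sum>i\<in>I. f i x)"
  using assms by (induction I rule: infinite_finite_induct) (simp_all add: Ck_on_const Ck_on_add)

lemma Ck_on_scaleR:
  assumes "open S"
  shows "Ck_on k S f \<Longrightarrow> Ck_on k S g \<Longrightarrow> Ck_on k S (\<lambda>x. f x *\<^sub>R g x)"
proof (induction k arbitrary: f g)
  case 0
  then show ?case by (simp add: continuous_on_scaleR)
next
  case (Suc k)
  show ?case
  proof (rule Ck_on_SucI[OF assms])
    show "((\<lambda>x. f x *\<^sub>R g x) has_derivative
        (\<lambda>v. f x *\<^sub>R frechet_derivative g (at x) v + frechet_derivative f (at x) v *\<^sub>R g x)) (at x)"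
      if "x \<in> S" for x
      by (rule has_derivative_scaleR[OF Ck_on_SucD[OF Suc.prems(1) that] Ck_on_SucD[OF Suc.prems(2) that]])
    show "Ck_on k S (\<lambda>x. f x *\<^sub>R frechet_derivative g (at x) v + frechet_derivative f (at x) v *\<^sub>R g x)" for v
      using Suc.prems Ck_on_Suc_imp[OF Suc.prems(1)] Ck_on_Suc_imp[OF Suc.prems(2)]
      by (intro Ck_on_add[OF assms] Suc.IH) simp_all
  qed
qed

text \<open>Regularity of a family of linear maps is expressed by the values \<open>A x e\<close> at
  fixed vectors. Expanding \<open>u x\<close> in a basis turns \<open>A x (u x)\<close> into a
  finite sum of scalar multiples of such values.\<close>

lemma Ck_on_family_apply:
  fixes A :: "'x::finite_dim_normed \<Rightarrow> 'a::finite_dim_normed \<Rightarrow> 'b::finite_dim_normed"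
  assumes "open S" "\<And>x. x \<in> S \<Longrightarrow> linear (A x)" "\<And>e. Ck_on k S (\<lambda>x. A x e)" "Ck_on k S u"
  shows "Ck_on k S (\<lambda>x. A x (u x))"
proof -
  obtain B :: "'a set" and r where B: "finite B" "independent B"
    "\<And>x. (\<Sum>b\<in>B. r b x *\<^sub>R b) = x" "\<And>b. linear (r b)"
    using finite_dim_basis by blast
  have eq: "(\<Sum>b\<in>B. r b (u x) *\<^sub>R A x b) = A x (u x)" if "x \<in> S" for x
  proof -
    have "A x (u x) = A x (\<Sum>b\<in>B. r b (u x) *\<^sub>R b)" by (simp add: B(3))
    then show ?thesis
      by (simp add: linear_sum[OF assms(2)[OF that]] linear_scale[OF assms(2)[OF that]])
  qed
  have "Ck_on k S (\<lambda>x. \<Sum>b\<in>B. r b (u x) *\<^sub>R A x b)"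
    by (rule Ck_on_sum[OF assms(1)], rule Ck_on_scaleR[OF assms(1)
          Ck_on_linear_comp[OF linear_imp_bounded_linear[OF B(4)] assms(1,4)] assms(3)])
  then show ?thesis
    by (rule Ck_on_cong[OF assms(1), rotated]) (rule eq)
qed

text \<open>By the chain rule the derivative in a direction is the family
  \<open>frechet_derivative g (at (f x))\<close> applied to a C^k vector. The family is again a
  composition with \<open>f\<close>, with a derivative of \<open>g\<close> in place of
  \<open>g\<close>; therefore the induction generalises \<open>g\<close>.\<close>

lemma Ck_on_compose:
  fixes f :: "'x::finite_dim_normed \<Rightarrow> 'a::finite_dim_normed" and g :: "'a \<Rightarrow> 'b::finite_dim_normed"
  assumes "open S" "open T" "f ` S \<subseteq> T"
  shows "Ck_on k S f \<Longrightarrow> Ck_on k T g \<Longrightarrow> Ck_on k S (\<lambda>x. g (f x))"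
proof (induction k arbitrary: g)
  case 0
  then show ?case
    unfolding Ck_on.simps by (rule continuous_on_compose2[OF _ _ assms(3), rotated])
next
  case (Suc k)
  have fS: "f x \<in> T" if "x \<in> S" for x
    using assms(3) that by auto
  have der: "((\<lambda>x. g (f x)) has_derivative
      (\<lambda>v. frechet_derivative g (at (f x)) (frechet_derivative f (at x) v))) (at x)"
    if "x \<in> S" for x
    using diff_chain_at[OF Ck_on_SucD[OF Suc.prems(1) that] Ck_on_SucD[OF Suc.prems(2) fS[OF that]]]
    by (simp only: o_def)
  have lin: "linear (frechet_derivative g (at (f x)))" if "x \<in> S" for x
    using Ck_on_SucD[OF Suc.prems(2) fS[OF that]] has_derivative_linear by blast
  have 1: "Ck_on k S (\<lambda>x. frechet_derivative g (at (f x)) e)" for e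
    by (rule Suc.IH[OF Ck_on_Suc_imp[OF Suc.prems(1)]]) (use Suc.prems(2) in simp)
  have 2: "Ck_on k S (\<lambda>x. frechet_derivative f (at x) v)" for v
    using Suc.prems(1) by simp
  show ?case
    by (rule Ck_on_SucI[OF assms(1) der Ck_on_family_apply[OF assms(1) lin 1 2]])
qed

lemma Ck_on_Pair:
  assumes "open S"
  shows "Ck_on k S f \<Longrightarrow> Ck_on k S g \<Longrightarrow> Ck_on k S (\<lambda>x. (f x, g x))"
proof (induction k arbitrary: f g)
  case 0
  then show ?case by (simp add: continuous_on_Pair)
next
  case (Suc k)
  show ?case
  proof (rule Ck_on_SucI[OF assms])
    show "((\<lambda>x. (f x, g x)) has_derivative
        (\<lambda>v. (frechet_derivative f (at x) v, frechet_derivative g (at x) v))) (at x)" if "x \<in> S" for x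
      by (rule has_derivative_Pair[OF Ck_on_SucD[OF Suc.prems(1) that] Ck_on_SucD[OF Suc.prems(2) that]])
    show "Ck_on k S (\<lambda>x. (frechet_derivative f (at x) v, frechet_derivative g (at x) v))" for v
      using Suc.prems by (intro Suc.IH) simp_all
  qed
qed

section \<open>Linear equations whose coefficients depend on a parameter\<close>

lemma bij_linear_lower_bound:
  fixes f :: "'a::finite_dim_normed \<Rightarrow> 'b::finite_dim_normed"
  assumes "linear f" "bij f"
  obtains c where "c > 0" "\<And>e. c * norm e \<le> norm (f e)"
proof -
  obtain K where K: "K > 0" "\<And>y. norm (inv_into UNIV f y) \<le> norm y * K"
    using bounded_linear.pos_bounded[OF bounded_linear_inv_into[OF assms]] by blast
  have "(1 / K) * norm e \<le> norm (f e)" for e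
    using K(2)[of "f e"] K(1) assms(2) by (simp add: bij_is_inj field_simps)
  with K(1) show thesis using that[of "1 / K"] by auto
qed

text \<open>On a finite-dimensional space pointwise convergence of linear maps is uniform on the
  unit ball, since it is decided on finitely many basis vectors.\<close>

lemma family_norm_small:
  fixes A :: "'x::topological_space \<Rightarrow> 'a::finite_dim_normed \<Rightarrow> 'b::real_normed_vector"
  assumes ev: "\<forall>\<^sub>F x in F. linear (A x)" and "\<And>e. ((\<lambda>x. A x e) \<longlongrightarrow> L e) F" "linear L" "\<epsilon> > 0"
  shows "\<forall>\<^sub>F x in F. \<forall>e. norm (A x e - L e) \<le> \<epsilon> * norm e"
proof -
  obtain B :: "'a set" and r where B: "finite B" "independent B"
    "\<And>x. (\<Sum>b\<in>B. r b x *\<^sub>R b) = x" "\<And>b. linear (r b)"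
    using finite_dim_basis by blast
  obtain K where K: "K \<ge> 0" "\<And>r b. b \<in> B \<Longrightarrow> \<bar>r b\<bar> \<le> K * norm (\<Sum>b\<in>B. r b *\<^sub>R b)"
    using independent_coeff_bound[OF B(1,2)] by blast
  have "((\<lambda>x. \<Sum>b\<in>B. K * norm (A x b - L b)) \<longlongrightarrow> (\<Sum>b\<in>B. K * norm (L b - L b))) F"
    by (intro tendsto_intros assms)
  then have "\<forall>\<^sub>F x in F. (\<Sum>b\<in>B. K * norm (A x b - L b)) < \<epsilon>"
    using assms(4) by (auto dest: order_tendstoD(2))
  with ev show ?thesis
  proof eventually_elim
    case (elim x)
    show ?case
    proof
      fix e
      have "A x e - L e = A x (\<Sum>b\<in>B. r b e *\<^sub>R b) - L (\<Sum>b\<in>B. r b e *\<^sub>R b)" by (simp add: B(3))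
      also have "\<dots> = (\<Sum>b\<in>B. r b e *\<^sub>R (A x b - L b))"
        by (simp add: linear_sum[OF elim(1)] linear_scale[OF elim(1)] linear_sum[OF assms(3)]
            linear_scale[OF assms(3)] scaleR_diff_right sum_subtractf)
      finally have "norm (A x e - L e) \<le> (\<Sum>b\<in>B. norm (r b e *\<^sub>R (A x b - L b)))"
        by (simp add: sum_norm_le)
      also have "\<dots> \<le> (\<Sum>b\<in>B. (K * norm e) * norm (A x b - L b))"
        using K(2)[of _ "\<lambda>b. r b e"] by (intro sum_mono) (simp add: B(3) mult_right_mono)
      also have "\<dots> = norm e * (\<Sum>b\<in>B. K * norm (A x b - L b))"
        by (simp add: sum_distrib_left mult_ac)
      also have "\<dots> \<le> norm e * \<epsilon>" using elim(2) by (intro mult_left_mono) auto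
      finally show "norm (A x e - L e) \<le> \<epsilon> * norm e" by (simp add: mult.commute)
    qed
  qed
qed

lemma frechet_bound_at:
  assumes "(f has_derivative D) (at x)" "\<epsilon> > 0"
  shows "\<forall>\<^sub>F y in nhds x. norm (f y - f x - D (y - x)) \<le> \<epsilon> * norm (y - x)"
proof -
  obtain d where "d > 0" "\<And>y. norm (y - x) < d \<Longrightarrow> norm (f y - f x - D (y - x)) \<le> \<epsilon> * norm (y - x)"
    using assms unfolding has_derivative_at_alt by blast
  then show ?thesis
    unfolding eventually_nhds_metric by (metis dist_norm)
qed

text \<open>
  The inverse of a family of isomorphisms is differentiated through the identity
  \<open>s y - s x = A y\<^sup>-\<^sup>1 (u y - A y (s x))\<close>, which needs no topology on spaces of linear maps.
\<close>

lemma has_derivative_family_inverse: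
  fixes A :: "'x::finite_dim_normed \<Rightarrow> 'a::finite_dim_normed \<Rightarrow> 'b::finite_dim_normed"
  assumes "open S" and x: "x \<in> S"
    and A: "\<And>y. y \<in> S \<Longrightarrow> linear (A y)" "\<And>y. y \<in> S \<Longrightarrow> bij (A y)"
    and dA: "\<And>e. ((\<lambda>y. A y e) has_derivative (\<lambda>v. A' v e)) (at x)"
    and du: "(u has_derivative u') (at x)"
    and s: "\<And>y. y \<in> S \<Longrightarrow> A y (s y) = u y"
  shows "(s has_derivative (\<lambda>v. inv_into UNIV (A x) (u' v - A' v (s x)))) (at x)"
proof -
  let ?I = "inv_into UNIV (A x)"
  define r' where "r' v = u' v - A' v (s x)" for v
  have linI: "bounded_linear ?I"
    by (rule bounded_linear_inv_into[OF A[OF x]])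
  have AI: "A x (?I y) = y" for y
    using A(2)[OF x] by (simp add: bij_is_surj surj_f_inv_f)
  obtain c where c: "c > 0" "\<And>e. c * norm e \<le> norm (A x e)"
    using bij_linear_lower_bound[OF A[OF x]] by blast
  define r where "r y = u y - A y (s x)" for y
  have rx: "r x = 0" using s[OF x] by (simp add: r_def)
  have dr: "(r has_derivative r') (at x)"
    unfolding r_def r'_def by (intro has_derivative_diff du dA)
  have evS: "\<forall>\<^sub>F y in nhds x. y \<in> S"
    using assms(1) x by (rule eventually_nhds_in_open)
  have small: "\<forall>\<^sub>F y in nhds x. \<forall>e. norm (A y e - A x e) \<le> \<epsilon> * norm e" if "\<epsilon> > 0" for \<epsilon>
  proof (rule family_norm_small[OF _ _ A(1)[OF x] that])
    show "\<forall>\<^sub>F y in nhds x. linear (A y)" using evS by eventually_elim (rule A(1))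
    show "((\<lambda>y. A y e) \<longlongrightarrow> A x e) (nhds x)" for e
      using has_derivative_continuous[OF dA[of e]] tendsto_at_iff_tendsto_nhds[of "\<lambda>y. A y e" x] by (simp add: isCont_def)
  qed
  obtain K where K: "K > 0" "\<And>v. norm (?I (r' v)) \<le> norm v * K"
    using bounded_linear.pos_bounded[OF bounded_linear_compose[OF linI has_derivative_bounded_linear[OF dr]]]
    by blast
  have "(s has_derivative (\<lambda>v. ?I (r' v))) (at x)"
    unfolding has_derivative_at_alt
  proof (intro conjI allI impI)
    show "bounded_linear (\<lambda>v. ?I (r' v))"
      by (rule bounded_linear_compose[OF linI has_derivative_bounded_linear[OF dr]])
    fix \<epsilon> :: real assume \<epsilon>: "\<epsilon> > 0"
    \<comment> \<open>The two error terms below add up to \<open>\<eta> * t\<close> times the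
      distance. The choice of \<open>\<eta>\<close> makes this c/2 times epsilon, and dividing by
      the lower bound c/2 leaves epsilon.\<close>
    define t where "t = 1 + K"
    have t: "t > 0" using K(1) by (simp add: t_def)
    define \<eta> where "\<eta> = (c / 2) * \<epsilon> / t"
    have \<eta>: "\<eta> > 0" using \<epsilon> c(1) t by (simp add: \<eta>_def)
    have "\<forall>\<^sub>F y in nhds x. norm (s y - s x - ?I (r' (y - x))) \<le> \<epsilon> * norm (y - x)"
      using evS small[OF half_gt_zero[OF c(1)]] small[OF \<eta>] frechet_bound_at[OF dr \<eta>]
    proof eventually_elim
      case (elim y)
      let ?w = "s y - s x - ?I (r' (y - x))"
      note lin = A(1)[OF elim(1)]
      \<comment> \<open>Close to \<open>x\<close> the map \<open>A y\<close> keeps half of the lower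
        bound of \<open>A x\<close>.\<close>
      have "c * norm ?w \<le> norm (A x ?w)" by (rule c(2))
      also have "\<dots> \<le> norm (A y ?w) + norm (A y ?w - A x ?w)"
        by (metis norm_minus_commute norm_triangle_sub)
      also have "norm (A y ?w - A x ?w) \<le> c / 2 * norm ?w"
        using elim(2) c(1) by simp
      finally have 1: "(c / 2) * norm ?w \<le> norm (A y ?w)" by simp
      \<comment> \<open>Here \<open>r y\<close> is \<open>A y (s y - s x)\<close> and
        \<open>r x\<close> is 0. So \<open>?w\<close> is measured by the first-order error of
        \<open>r\<close> plus the change from \<open>A x\<close> to \<open>A y\<close> on the
        predicted increment.\<close>
      have "A y ?w = (r y - r x - r' (y - x)) - (A y (?I (r' (y - x))) - A x (?I (r' (y - x))))"
        by (simp add: linear_diff[OF lin] s[OF elim(1)] r_def AI) (simp add: s[OF x])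
      then have "norm (A y ?w) \<le> norm (r y - r x - r' (y - x)) +
          norm (A y (?I (r' (y - x))) - A x (?I (r' (y - x))))"
        by (metis norm_triangle_ineq4)
      also have "\<dots> \<le> \<eta> * norm (y - x) + \<eta> * norm (?I (r' (y - x)))"
        by (intro add_mono elim(4) elim(3)[rule_format])
      also have "\<dots> \<le> \<eta> * norm (y - x) + \<eta> * (norm (y - x) * K)"
        using K(2)[of "y - x"] \<eta> by simp
      also have "\<dots> = (\<eta> * t) * norm (y - x)" by (simp add: t_def algebra_simps)
      also have "\<eta> * t = (c / 2) * \<epsilon>"
        using t by (simp add: \<eta>_def)
      finally have "(c / 2) * norm ?w \<le> (c / 2) * (\<epsilon> * norm (y - x))"
        using 1 by simp
      then show ?case using c(1) by simp
    qed
    then obtain d where "d > 0" "\<And>y. dist y x < d \<Longrightarrow> norm (s y - s x - ?I (r' (y - x))) \<le> \<epsilon> * norm (y - x)"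
      unfolding eventually_nhds_metric by blast
    then show "\<exists>d>0. \<forall>y. norm (y - x) < d \<longrightarrow> norm (s y - s x - ?I (r' (y - x))) \<le> \<epsilon> * norm (y - x)"
      by (metis dist_norm)
  qed
  then show ?thesis by (simp add: r'_def)
qed

lemma Ck_on_diff:
  assumes "open S" "Ck_on k S f" "Ck_on k S g"
  shows "Ck_on k S (\<lambda>x. f x - g x)"
proof -
  have "Ck_on k S (\<lambda>x. f x + (-1) *\<^sub>R g x)"
    by (rule Ck_on_add[OF assms(1,2) Ck_on_scaleR[OF assms(1) Ck_on_const[OF assms(1)] assms(3)]])
  then show ?thesis by simp
qed

text \<open>The case k = 0 of the lemma that follows. Near \<open>x\<close> the map
  \<open>A y\<close> keeps half of the lower bound of \<open>A x\<close>, so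
  \<open>s y - s x\<close> is controlled by the residual \<open>u y - A y (s x)\<close>, which tends
  to 0.\<close>

lemma continuous_family_inverse:
  fixes A :: "'x::finite_dim_normed \<Rightarrow> 'a::finite_dim_normed \<Rightarrow> 'b::finite_dim_normed"
  assumes "open S"
    and A: "\<And>y. y \<in> S \<Longrightarrow> linear (A y)" "\<And>y. y \<in> S \<Longrightarrow> bij (A y)"
    and cA: "\<And>e. continuous_on S (\<lambda>y. A y e)"
    and cu: "continuous_on S u"
    and s: "\<And>y. y \<in> S \<Longrightarrow> A y (s y) = u y"
  shows "continuous_on S s"
proof (rule continuous_at_imp_continuous_on, rule ballI)
  fix x assume x: "x \<in> S"
  obtain c where c: "c > 0" "\<And>e. c * norm e \<le> norm (A x e)"
    using bij_linear_lower_bound[OF A[OF x]] by blast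
  have evS: "\<forall>\<^sub>F y in at x. y \<in> S"
    using assms(1) x by (rule eventually_at_in_open')
  have tA: "((\<lambda>y. A y e) \<longlongrightarrow> A x e) (at x)" for e
    using cA[of e] continuous_on_eq_continuous_at[OF assms(1)] x by (auto simp: isCont_def)
  have tu: "(u \<longlongrightarrow> u x) (at x)"
    using cu continuous_on_eq_continuous_at[OF assms(1)] x by (auto simp: isCont_def)
  have small: "\<forall>\<^sub>F y in at x. \<forall>e. norm (A y e - A x e) \<le> (c / 2) * norm e"
  proof (rule family_norm_small[OF _ tA A(1)[OF x]])
    show "\<forall>\<^sub>F y in at x. linear (A y)" using evS by eventually_elim (rule A(1))
  qed (use c(1) in simp)
  have lim: "((\<lambda>y. (2 / c) * norm (u y - A y (s x))) \<longlongrightarrow> (2 / c) * norm (u x - A x (s x))) (at x)"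
    by (intro tendsto_intros tu tA)
  have "\<forall>\<^sub>F y in at x. norm (s y - s x) \<le> (2 / c) * norm (u y - A y (s x))"
    using small evS
  proof eventually_elim
    case (elim y)
    let ?w = "s y - s x"
    have "c * norm ?w \<le> norm (A x ?w)" by (rule c(2))
    also have "\<dots> \<le> norm (A y ?w) + norm (A y ?w - A x ?w)"
      by (metis norm_minus_commute norm_triangle_sub)
    also have "norm (A y ?w - A x ?w) \<le> c / 2 * norm ?w"
      using elim(1) by simp
    finally have "(c / 2) * norm ?w \<le> norm (A y ?w)" by simp
    also have "A y ?w = u y - A y (s x)"
      by (simp add: linear_diff[OF A(1)[OF elim(2)]] s[OF elim(2)])
    finally show ?case using c(1) by (simp add: field_simps)
  qed
  then have "((\<lambda>y. s y - s x) \<longlongrightarrow> 0) (at x)"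
    by (rule Lim_null_comparison) (use lim s[OF x] in simp)
  then show "isCont s x"
    by (simp add: isCont_def LIM_zero_iff)
qed

text \<open>Differentiating A s = u gives A s' = u' - A' s, an equation with the same A. The
  induction hypothesis thus applies to the derivative of the solution as well as to the
  solution.\<close>

lemma Ck_on_family_inverse:
  fixes A :: "'x::finite_dim_normed \<Rightarrow> 'a::finite_dim_normed \<Rightarrow> 'b::finite_dim_normed"
  assumes "open S" "\<And>x. x \<in> S \<Longrightarrow> linear (A x)" "\<And>x. x \<in> S \<Longrightarrow> bij (A x)"
  shows "(\<And>e. Ck_on k S (\<lambda>x. A x e)) \<Longrightarrow> Ck_on k S u \<Longrightarrow> (\<And>x. x \<in> S \<Longrightarrow> A x (s x) = u x)
    \<Longrightarrow> Ck_on k S s"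
proof (induction k arbitrary: u s)
  case 0
  show ?case unfolding Ck_on.simps
    by (rule continuous_family_inverse[OF assms 0[unfolded Ck_on.simps]])
next
  case (Suc k)
  define A' where "A' x v e = frechet_derivative (\<lambda>x. A x e) (at x) v" for x v e
  have dA: "((\<lambda>y. A y e) has_derivative (\<lambda>v. A' x v e)) (at x)" if "x \<in> S" for x e
    using Ck_on_SucD[OF Suc.prems(1) that] by (simp add: A'_def)
  \<comment> \<open>Linearity in \<open>e\<close> holds at every point of the open set and passes to
    the derivative by uniqueness of derivatives.\<close>
  have linA': "linear (A' x v)" if x: "x \<in> S" for x v
  proof (rule linearI)
    fix e e' :: 'a and c :: real
    have 1: "((\<lambda>y. A y e + A y e') has_derivative (\<lambda>v. A' x v (e + e'))) (at x)"
      by (rule has_derivative_transform_within_open[OF dA[OF x, of "e + e'"] assms(1) x])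
        (simp add: linear_add[OF assms(2)])
    show "A' x v (e + e') = A' x v e + A' x v e'"
      using fun_cong[OF has_derivative_unique[OF 1 has_derivative_add[OF dA[OF x, of e] dA[OF x, of e']]], of v]
      by simp
    have 2: "((\<lambda>y. c *\<^sub>R A y e) has_derivative (\<lambda>v. A' x v (c *\<^sub>R e))) (at x)"
      by (rule has_derivative_transform_within_open[OF dA[OF x, of "c *\<^sub>R e"] assms(1) x])
        (simp add: linear_scale[OF assms(2)])
    show "A' x v (c *\<^sub>R e) = c *\<^sub>R A' x v e"
      using fun_cong[OF has_derivative_unique[OF 2 has_derivative_scaleR_right[OF dA[OF x, of e], of c]], of v]
      by simp
  qed
  have Ak: "Ck_on k S (\<lambda>x. A x e)" and Ak': "Ck_on k S (\<lambda>x. A' x v e)" for v e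
    using Suc.prems(1)[of e] Ck_on_Suc_imp[OF Suc.prems(1)[of e]] by (simp_all add: A'_def)
  have uk: "Ck_on k S (\<lambda>x. frechet_derivative u (at x) v)" for v
    using Suc.prems(2) by simp
  \<comment> \<open>The solution itself occurs on the right-hand side of the equation for its
    derivative, so its own regularity comes first.\<close>
  have sk: "Ck_on k S s"
    by (rule Suc.IH[OF Ak Ck_on_Suc_imp[OF Suc.prems(2)] Suc.prems(3)])
  have s_diff: "(s has_derivative (\<lambda>v. inv_into UNIV (A x) (frechet_derivative u (at x) v - A' x v (s x)))) (at x)"
    if "x \<in> S" for x
    by (rule has_derivative_family_inverse[OF assms(1) that assms(2,3) dA[OF that]
        Ck_on_SucD[OF Suc.prems(2) that] Suc.prems(3)])
  have s'_k: "Ck_on k S (\<lambda>x. inv_into UNIV (A x) (frechet_derivative u (at x) v - A' x v (s x)))" for v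
  proof (rule Suc.IH[OF Ak])
    show "Ck_on k S (\<lambda>x. frechet_derivative u (at x) v - A' x v (s x))"
      by (rule Ck_on_diff[OF assms(1) uk Ck_on_family_apply[OF assms(1) linA' Ak' sk]])
    show "A x (inv_into UNIV (A x) w) = w" if "x \<in> S" for x w
      using assms(3)[OF that] by (simp add: bij_is_surj surj_f_inv_f)
  qed
  show ?case
    by (rule Ck_on_SucI[OF assms(1) s_diff s'_k])
qed

section \<open>Images of submersions between model spaces\<close>

text \<open>
  Banach's fixed point theorem for \<open>u \<mapsto> u + (y - f (x + R u))\<close>, where \<open>R\<close> is a right inverse of the
  differential at \<open>x\<close>.
\<close>

lemma submersion_image_nhd:
  fixes f :: "'a::finite_dim_normed \<Rightarrow> 'b::finite_dim_normed"
  assumes "open S" "x \<in> S" "Ck_on (Suc 0) S f" "surj (frechet_derivative f (at x))"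
  obtains T where "open T" "f x \<in> T" "T \<subseteq> f ` S"
proof -
  let ?D = "frechet_derivative f (at x)"
  have der: "(f has_derivative frechet_derivative f (at y)) (at y)" if "y \<in> S" for y
    by (rule Ck_on_SucD[OF assms(3) that])
  have linD: "linear (frechet_derivative f (at y))" if "y \<in> S" for y
    using der[OF that] by (rule has_derivative_linear)
  obtain R where R: "bounded_linear R" "\<And>y. ?D (R y) = y"
    using linear_right_inverse_bounded[OF linD[OF assms(2)] assms(4)] by blast
  obtain K where K: "K > 0" "\<And>y. norm (R y) \<le> norm y * K"
    using bounded_linear.pos_bounded[OF R(1)] by blast
  have cont: "isCont (\<lambda>y. frechet_derivative f (at y) v) x" for v
    using assms(1,2,3) by (simp add: continuous_on_eq_continuous_at)
  \<comment> \<open>The bound 1/(2K) is chosen because \<open>R\<close> enlarges norms by at most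
    the factor \<open>K\<close>: the map below then contracts by 1/2.\<close>
  have "\<forall>\<^sub>F y in nhds x. \<forall>e. norm (frechet_derivative f (at y) e - ?D e) \<le> 1 / (2 * K) * norm e"
  proof (rule family_norm_small[OF _ _ linD[OF assms(2)]])
    show "\<forall>\<^sub>F y in nhds x. linear (frechet_derivative f (at y))"
      using eventually_nhds_in_open[OF assms(1,2)] by eventually_elim (rule linD)
    show "((\<lambda>y. frechet_derivative f (at y) e) \<longlongrightarrow> ?D e) (nhds x)" for e
      using cont[of e] tendsto_at_iff_tendsto_nhds[of "\<lambda>y. frechet_derivative f (at y) e" x]
      by (simp add: isCont_def)
  qed (use K in simp)
  with eventually_nhds_in_open[OF assms(1,2)]
  have "\<forall>\<^sub>F y in nhds x. y \<in> S \<and> (\<forall>e. norm (frechet_derivative f (at y) e - ?D e) \<le> 1 / (2 * K) * norm e)"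
    by eventually_elim simp
  then obtain d where d: "d > 0"
    "\<And>y. dist y x < d \<Longrightarrow> y \<in> S"
    "\<And>y e. dist y x < d \<Longrightarrow> norm (frechet_derivative f (at y) e - ?D e) \<le> 1 / (2 * K) * norm e"
    unfolding eventually_nhds_metric by blast
  have lip: "norm (f b - f a - ?D (b - a)) \<le> norm (b - a) * (1 / (2 * K))"
    if "a \<in> ball x d" "b \<in> ball x d" for a b
  proof (rule differentiable_bound_linearization[where S = "ball x d"])
    show "a + t *\<^sub>R (b - a) \<in> ball x d" if "t \<in> {0..1}" for t
    proof -
      have "(1 - t) *\<^sub>R a + t *\<^sub>R b \<in> ball x d"
        using that \<open>a \<in> ball x d\<close> \<open>b \<in> ball x d\<close> by (intro convexD[OF convex_ball]) auto
      then show ?thesis by (simp add: algebra_simps)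
    qed
    show "(f has_derivative frechet_derivative f (at y)) (at y within ball x d)" if "y \<in> ball x d" for y
    proof -
      have "y \<in> S" using that by (intro d(2)) (simp add: dist_commute)
      then show ?thesis by (rule has_derivative_at_withinI[OF der])
    qed
    show "onorm (frechet_derivative f (at y) - ?D) \<le> 1 / (2 * K)" if "y \<in> ball x d" for y
    proof (rule onorm_bound)
      show "0 \<le> 1 / (2 * K)" using K(1) by simp
      show "norm ((frechet_derivative f (at y) - ?D) e) \<le> 1 / (2 * K) * norm e" for e
        using d(3)[of y e] that by (simp add: dist_commute)
    qed
  qed (use d(1) in simp)
  \<comment> \<open>With this radius \<open>norm (R u)\<close> is at most d/2, so
    \<open>x + R u\<close> stays in the ball where the derivative is under control.\<close>
  define \<rho> where "\<rho> = d / (2 * K)"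
  have \<rho>: "\<rho> > 0" using d(1) K(1) by (simp add: \<rho>_def)
  have inball: "x + R u \<in> ball x d" if "norm u \<le> \<rho>" for u
  proof -
    have "norm (R u) \<le> \<rho> * K" using K(2)[of u] that K(1) by (meson mult_right_mono less_imp_le order_trans)
    also have "\<dots> < d" using d(1) K(1) by (simp add: \<rho>_def)
    finally show ?thesis by (simp add: dist_norm)
  qed
  have contr: "norm ((u + (y - f (x + R u))) - (v + (y - f (x + R v)))) \<le> 1 / 2 * norm (u - v)"
    if "norm u \<le> \<rho>" "norm v \<le> \<rho>" for u v y
  proof -
    have D: "?D ((x + R u) - (x + R v)) = u - v"
      using linear_diff[OF linD[OF assms(2)], of "R u" "R v"] by (simp add: R(2))
    have "(u + (y - f (x + R u))) - (v + (y - f (x + R v))) =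
        - (f (x + R u) - f (x + R v) - ?D ((x + R u) - (x + R v)))"
      unfolding D by simp
    then have "norm ((u + (y - f (x + R u))) - (v + (y - f (x + R v)))) =
        norm (f (x + R u) - f (x + R v) - ?D ((x + R u) - (x + R v)))"
      by (simp only: norm_minus_cancel)
    also have "\<dots> \<le> norm ((x + R u) - (x + R v)) * (1 / (2 * K))"
      by (rule lip[OF inball[OF that(2)] inball[OF that(1)]])
    also have "(x + R u) - (x + R v) = R (u - v)"
      using R(1) by (simp add: bounded_linear.linear linear_diff)
    also have "norm (R (u - v)) * (1 / (2 * K)) \<le> (norm (u - v) * K) * (1 / (2 * K))"
      using K by (intro mult_right_mono) auto
    also have "\<dots> = 1 / 2 * norm (u - v)" using K(1) by simp
    finally show ?thesis .
  qed
  \<comment> \<open>For such \<open>y\<close> the map \<open>\<Phi>\<close> moves 0 by less than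
    half of the radius \<open>\<rho>\<close>. As it contracts by 1/2, it sends the closed ball of
    radius \<open>\<rho>\<close> into itself.\<close>
  have "ball (f x) (\<rho> / 2) \<subseteq> f ` S"
  proof
    fix y assume "y \<in> ball (f x) (\<rho> / 2)"
    then have y: "norm (y - f x) < \<rho> / 2" by (simp add: dist_norm norm_minus_commute)
    define \<Phi> where "\<Phi> u = u + (y - f (x + R u))" for u
    have R0: "R 0 = 0" using R(1) by (simp add: bounded_linear.linear linear_0)
    have "\<exists>!u\<in>cball 0 \<rho>. \<Phi> u = u"
    proof (rule Banach_fix[of _ "1/2"])
      show "complete (cball (0::'b) \<rho>)"
        using complete_Int_closed[OF complete_finite_dim, of "cball 0 \<rho>"] by simp
      show "cball (0::'b) \<rho> \<noteq> {}" using \<rho> by simp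
      show "\<Phi> ` cball 0 \<rho> \<subseteq> cball 0 \<rho>"
      proof (rule image_subsetI)
        fix u :: 'b assume "u \<in> cball 0 \<rho>"
        then have u: "norm u \<le> \<rho>" by simp
        have "norm (\<Phi> u - \<Phi> 0) \<le> 1 / 2 * norm (u - 0)"
          unfolding \<Phi>_def using u \<rho> by (intro contr) auto
        moreover have "norm (\<Phi> 0) < \<rho> / 2" using y by (simp add: \<Phi>_def R0)
        moreover have "norm (\<Phi> u) \<le> norm (\<Phi> u - \<Phi> 0) + norm (\<Phi> 0)"
          by (metis norm_triangle_sub add.commute)
        ultimately show "\<Phi> u \<in> cball 0 \<rho>" using u by simp
      qed
      show "dist (\<Phi> u) (\<Phi> v) \<le> 1 / 2 * dist u v" if "u \<in> cball 0 \<rho>" "v \<in> cball 0 \<rho>" for u v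
        unfolding dist_norm \<Phi>_def using that by (intro contr) auto
    qed auto
    then obtain u where "norm u \<le> \<rho>" "\<Phi> u = u" by auto
    then have "f (x + R u) = y" "x + R u \<in> S"
      using inball d(2)[of "x + R u"] by (auto simp: \<Phi>_def dist_commute)
    then show "y \<in> f ` S" by blast
  qed
  then show thesis using that[of "ball (f x) (\<rho> / 2)"] \<rho> by simp
qed

section \<open>Smooth functions\<close>

definition smooth_at :: "('a::finite_dim_normed \<Rightarrow> 'b::finite_dim_normed) \<Rightarrow> 'a \<Rightarrow> bool" where
  "smooth_at f x \<longleftrightarrow> (\<exists>S. open S \<and> x \<in> S \<and> smooth_on S f)"

lemma smooth_on_subset: "smooth_on S f \<Longrightarrow> T \<subseteq> S \<Longrightarrow> smooth_on T f"
  unfolding smooth_on_def using Ck_on_subset by blast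

lemma smooth_on_cong: "open S \<Longrightarrow> smooth_on S f \<Longrightarrow> (\<And>x. x \<in> S \<Longrightarrow> f x = g x) \<Longrightarrow> smooth_on S g"
  unfolding smooth_on_def by (metis Ck_on_cong)

lemma smooth_on_compose:
  assumes "open S" "open T" "f ` S \<subseteq> T" "smooth_on S f" "smooth_on T g"
  shows "smooth_on S (\<lambda>x. g (f x))"
  unfolding smooth_on_def
proof
  show "Ck_on k S (\<lambda>x. g (f x))" for k
    by (rule Ck_on_compose[OF assms(1-3) assms(4)[unfolded smooth_on_def, rule_format]
          assms(5)[unfolded smooth_on_def, rule_format]])
qed

lemma smooth_on_family_apply:
  assumes "open S" "\<And>x. x \<in> S \<Longrightarrow> linear (A x)" "\<And>e. smooth_on S (\<lambda>x. A x e)" "smooth_on S u"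
  shows "smooth_on S (\<lambda>x. A x (u x))"
  unfolding smooth_on_def
proof
  show "Ck_on k S (\<lambda>x. A x (u x))" for k
    by (rule Ck_on_family_apply[OF assms(1,2) assms(3)[unfolded smooth_on_def, rule_format]
          assms(4)[unfolded smooth_on_def, rule_format]])
qed

lemma smooth_on_family_inverse:
  assumes "open S" "\<And>x. x \<in> S \<Longrightarrow> linear (A x)" "\<And>x. x \<in> S \<Longrightarrow> bij (A x)"
    "\<And>e. smooth_on S (\<lambda>x. A x e)" "smooth_on S u" "\<And>x. x \<in> S \<Longrightarrow> A x (s x) = u x"
  shows "smooth_on S s"
  unfolding smooth_on_def
proof
  show "Ck_on k S s" for k
    by (rule Ck_on_family_inverse[OF assms(1-3) assms(4)[unfolded smooth_on_def, rule_format]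
          assms(5)[unfolded smooth_on_def, rule_format] assms(6)])
qed

lemma smooth_on_Pair:
  assumes "open S" "smooth_on S f" "smooth_on S g"
  shows "smooth_on S (\<lambda>x. (f x, g x))"
  unfolding smooth_on_def
proof
  show "Ck_on k S (\<lambda>x. (f x, g x))" for k
    by (rule Ck_on_Pair[OF assms(1) assms(2)[unfolded smooth_on_def, rule_format]
          assms(3)[unfolded smooth_on_def, rule_format]])
qed

lemma smooth_on_const: "open S \<Longrightarrow> smooth_on S (\<lambda>x. c)"
  unfolding smooth_on_def by (simp add: Ck_on_const)

lemma smooth_on_id: "open S \<Longrightarrow> smooth_on S (\<lambda>x. x)"
  unfolding smooth_on_def by (simp add: Ck_on_id)

lemma smooth_on_linear_comp:
  assumes "linear L" "open S" "smooth_on S f"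
  shows "smooth_on S (\<lambda>x. L (f x))"
  unfolding smooth_on_def
proof
  show "Ck_on k S (\<lambda>x. L (f x))" for k
    by (rule Ck_on_linear_comp[OF linear_imp_bounded_linear[OF assms(1)] assms(2)
          assms(3)[unfolded smooth_on_def, rule_format]])
qed

lemma smooth_on_Suc: "smooth_on S f \<Longrightarrow> Ck_on (Suc k) S f"
  by (simp only: smooth_on_def)

lemma smooth_on_differentiable: "smooth_on S f \<Longrightarrow> x \<in> S \<Longrightarrow> f differentiable (at x)"
  using smooth_on_Suc[of S f 0] by (simp only: Ck_on.simps)

lemma smooth_on_frechet:
  assumes "smooth_on S f"
  shows "smooth_on S (\<lambda>x. frechet_derivative f (at x) v)"
  unfolding smooth_on_def
proof
  show "Ck_on k S (\<lambda>x. frechet_derivative f (at x) v)" for k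
    using smooth_on_Suc[OF assms, of k] by simp
qed

lemma smooth_on_frechet_apply:
  assumes "open S" "smooth_on S f" "smooth_on S u"
  shows "smooth_on S (\<lambda>x. frechet_derivative f (at x) (u x))"
  by (rule smooth_on_family_apply[OF assms(1)
        linear_frechet_derivative[OF smooth_on_differentiable[OF assms(2)]]
        smooth_on_frechet[OF assms(2)] assms(3)])

lemma Ck_on_local:
  assumes "\<And>x. x \<in> S \<Longrightarrow> \<exists>T. open T \<and> x \<in> T \<and> Ck_on k T f"
  shows "Ck_on k S f"
  using assms
proof (induction k arbitrary: f)
  case 0
  show ?case unfolding Ck_on.simps
  proof (rule continuous_at_imp_continuous_on, rule ballI)
    fix x assume "x \<in> S"
    then obtain T where "open T" "x \<in> T" "Ck_on 0 T f" using 0 by blast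
    then show "isCont f x" by (auto simp: continuous_on_eq_continuous_at)
  qed
next
  case (Suc k)
  have "f differentiable (at x)" if "x \<in> S" for x
    using Suc.prems[OF that] by auto
  moreover have "Ck_on k S (\<lambda>x. frechet_derivative f (at x) v)" for v
  proof (rule Suc.IH)
    fix x assume "x \<in> S"
    then obtain T where T: "open T" "x \<in> T" "Ck_on (Suc k) T f"
      using Suc.prems by blast
    then have "Ck_on k T (\<lambda>x. frechet_derivative f (at x) v)" by simp
    with T show "\<exists>T. open T \<and> x \<in> T \<and> Ck_on k T (\<lambda>x. frechet_derivative f (at x) v)"
      by (intro exI[of _ T] conjI)
  qed
  ultimately show ?case by simp
qed

lemma smooth_on_iff_smooth_at:
  assumes "open S"
  shows "smooth_on S f \<longleftrightarrow> (\<forall>x\<in>S. smooth_at f x)"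
proof
  show "\<forall>x\<in>S. smooth_at f x" if "smooth_on S f"
    using that assms unfolding smooth_at_def by blast
  show "smooth_on S f" if "\<forall>x\<in>S. smooth_at f x"
    unfolding smooth_on_def
  proof (rule allI, rule Ck_on_local)
    show "\<exists>T. open T \<and> x \<in> T \<and> Ck_on k T f" if "x \<in> S" for x k
      using \<open>\<forall>x\<in>S. smooth_at f x\<close> that unfolding smooth_at_def smooth_on_def by metis
  qed
qed

lemma smooth_at_differentiable: "smooth_at f x \<Longrightarrow> f differentiable (at x)"
  unfolding smooth_at_def using smooth_on_differentiable by blast

lemma smooth_at_isCont: "smooth_at f x \<Longrightarrow> isCont f x"
  using smooth_at_differentiable differentiable_imp_continuous_within by blast

lemma smooth_at_cong:
  assumes "smooth_at f x" "\<forall>\<^sub>F y in nhds x. f y = g y"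
  shows "smooth_at g x"
proof -
  obtain S T where "open S" "x \<in> S" "smooth_on S f" "open T" "x \<in> T" "\<And>y. y \<in> T \<Longrightarrow> f y = g y"
    using assms unfolding smooth_at_def eventually_nhds by blast
  then have "smooth_on (S \<inter> T) g"
    by (intro smooth_on_cong[of "S \<inter> T" f g]) (auto intro: smooth_on_subset)
  with \<open>open S\<close> \<open>open T\<close> \<open>x \<in> S\<close> \<open>x \<in> T\<close> show ?thesis
    unfolding smooth_at_def by (intro exI[of _ "S \<inter> T"]) auto
qed

lemma smooth_at_compose:
  assumes "smooth_at f x" "smooth_at g (f x)"
  shows "smooth_at (\<lambda>y. g (f y)) x"
proof -
  obtain S T where S: "open S" "x \<in> S" "smooth_on S f" and T: "open T" "f x \<in> T" "smooth_on T g"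
    using assms unfolding smooth_at_def by blast
  have "continuous_on S f"
    using S(3)[unfolded smooth_on_def, rule_format, of 0] by simp
  then have o: "open (f -` T \<inter> S)"
    using continuous_on_open_vimage[OF S(1)] T(1) by blast
  have "smooth_on (f -` T \<inter> S) (\<lambda>y. g (f y))"
    by (rule smooth_on_compose[OF o T(1) _ smooth_on_subset[OF S(3)] T(3)]) auto
  with o S(2) T(2) show ?thesis
    unfolding smooth_at_def by blast
qed

lemma frechet_derivative_cong_ev:
  assumes "\<forall>\<^sub>F y in nhds x. f y = g y"
  shows "frechet_derivative f (at x) = frechet_derivative g (at x)"
  using assms frechet_derivative_cong_open unfolding eventually_nhds by metis

lemma frechet_derivative_compose_at:
  assumes "f differentiable (at x)" "g differentiable (at (f x))"
  shows "frechet_derivative (\<lambda>y. g (f y)) (at x) v = frechet_derivative g (at (f x)) (frechet_derivative f (at x) v)"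
  using frechet_derivative_compose[OF assms] by (simp add: o_def)

section \<open>Smooth maps of manifolds\<close>

text \<open>Without the Hausdorff condition, so that products need not be shown to be Hausdorff.\<close>

definition smooth_atlas :: "('a, 'e::finite_dim_normed) atlas \<Rightarrow> bool" where
  "smooth_atlas A \<longleftrightarrow>
     (\<forall>c\<in>A. inj_on (cmap c) (cdom c)) \<and>
     (\<forall>c\<in>A. \<forall>d\<in>A. open (cmap c ` (cdom c \<inter> cdom d)) \<and>
        smooth_on (cmap c ` (cdom c \<inter> cdom d)) (cmap d \<circ> cinv c))"

lemma manifold_smooth_atlas: "manifold A \<Longrightarrow> smooth_atlas A"
  unfolding manifold_def smooth_atlas_def by blast

lemma cinv_cmap:
  "smooth_atlas A \<Longrightarrow> c \<in> A \<Longrightarrow> p \<in> cdom c \<Longrightarrow> cinv c (cmap c p) = p"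
  unfolding smooth_atlas_def cinv_def by simp

lemma cmap_cinv: "y \<in> cmap c ` cdom c \<Longrightarrow> cmap c (cinv c y) = y"
  unfolding cinv_def by (rule f_inv_into_f)

lemma cinv_in: "y \<in> cmap c ` cdom c \<Longrightarrow> cinv c y \<in> cdom c"
  unfolding cinv_def by (rule inv_into_into)

lemma open_chart_image:
  assumes "smooth_atlas A" "c \<in> A"
  shows "open (cmap c ` cdom c)"
  using assms unfolding smooth_atlas_def by (metis Int_absorb)

lemma openin_atlas:
  "smooth_atlas A \<Longrightarrow> openin (mtop A) W \<longleftrightarrow> W \<subseteq> mcarrier A \<and> (\<forall>c\<in>A. open (cmap c ` (W \<inter> cdom c)))"
  unfolding smooth_atlas_def by (intro openin_mtop) blast

lemma openin_cdom:
  assumes "smooth_atlas A" "c \<in> A"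
  shows "openin (mtop A) (cdom c)"
proof -
  have "open (cmap d ` (cdom c \<inter> cdom d))" if "d \<in> A" for d
    using assms that unfolding smooth_atlas_def by (metis Int_commute)
  then show ?thesis
    using assms by (auto simp: openin_atlas mcarrier_def)
qed

lemma openin_mcarrier:
  assumes "smooth_atlas A"
  shows "openin (mtop A) (mcarrier A)"
proof -
  have "mcarrier A \<inter> cdom c = cdom c" if "c \<in> A" for c
    using that by (auto simp: mcarrier_def)
  then show ?thesis using assms by (simp add: openin_atlas open_chart_image)
qed

lemma topspace_mtop:
  assumes "smooth_atlas A"
  shows "topspace (mtop A) = mcarrier A"
  using openin_mcarrier[OF assms] openin_topspace[of "mtop A"] assms openin_subset
  by (metis openin_atlas subset_antisym)

lemma open_image_chart:
  "smooth_atlas A \<Longrightarrow> openin (mtop A) W \<Longrightarrow> c \<in> A \<Longrightarrow> open (cmap c ` (W \<inter> cdom c))"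
  by (simp add: openin_atlas)

lemma eventually_cinv:
  assumes "smooth_atlas A" "openin (mtop A) W" "c \<in> A" "p \<in> W" "p \<in> cdom c"
  shows "\<forall>\<^sub>F y in nhds (cmap c p). y \<in> cmap c ` cdom c \<and> cinv c y \<in> W"
proof -
  have "\<forall>\<^sub>F y in nhds (cmap c p). y \<in> cmap c ` (W \<inter> cdom c)"
    using open_image_chart[OF assms(1-3)] assms(4,5) by (intro eventually_nhds_in_open) auto
  then show ?thesis
    by eventually_elim (use cinv_cmap[OF assms(1,3)] in auto)
qed

lemma chart_at:
  assumes "p \<in> mcarrier A"
  shows "chart_at A p \<in> A" "p \<in> cdom (chart_at A p)"
  using assms someI_ex[of "\<lambda>c. c \<in> A \<and> p \<in> cdom c"] unfolding chart_at_def mcarrier_def by blast+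

lemma chart_at_model [simp]: "chart_at model_atlas y = (UNIV, \<lambda>x. x)"
  unfolding chart_at_def model_atlas_def by (rule some_equality) auto

lemma cinv_model [simp]: "cinv (UNIV, \<lambda>x. x) = (\<lambda>x. x)"
  by (rule ext) (simp add: cinv_def inv_into_f_eq)

lemma mcarrier_model [simp]: "mcarrier model_atlas = UNIV"
  by (simp add: mcarrier_def model_atlas_def)

lemma smooth_atlas_model: "smooth_atlas model_atlas"
  by (simp add: smooth_atlas_def model_atlas_def smooth_on_id o_def)

text \<open>A pointwise form of \<open>msmooth_on\<close>. The eventual clause is continuity in the
  form that composition uses: near \<open>p\<close> the values stay in the domain of
  \<open>d\<close>, outside of which \<open>cmap d\<close> is arbitrary.\<close>

definition smooth_map_at ::
  "('a, 'e::finite_dim_normed) atlas \<Rightarrow> ('b, 'f::finite_dim_normed) atlas \<Rightarrow> ('a \<Rightarrow> 'b) \<Rightarrow> 'a \<Rightarrow> bool"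
where
  "smooth_map_at A B f p \<longleftrightarrow> p \<in> mcarrier A \<and> f p \<in> mcarrier B \<and>
     (\<forall>c\<in>A. \<forall>d\<in>B. p \<in> cdom c \<longrightarrow> f p \<in> cdom d \<longrightarrow>
        (\<forall>\<^sub>F y in nhds (cmap c p). f (cinv c y) \<in> cdom d) \<and>
        smooth_at (\<lambda>y. cmap d (f (cinv c y))) (cmap c p))"

lemma smooth_map_atD:
  assumes "smooth_map_at A B f p" "c \<in> A" "p \<in> cdom c" "d \<in> B" "f p \<in> cdom d"
  shows "\<forall>\<^sub>F y in nhds (cmap c p). f (cinv c y) \<in> cdom d"
    "smooth_at (\<lambda>y. cmap d (f (cinv c y))) (cmap c p)"
  using assms by (simp_all add: smooth_map_at_def)

lemma smooth_map_at_carrier: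
  "smooth_map_at A B f p \<Longrightarrow> p \<in> mcarrier A" "smooth_map_at A B f p \<Longrightarrow> f p \<in> mcarrier B"
  by (simp_all add: smooth_map_at_def)

lemma msmooth_on_openin_preimage:
  assumes "msmooth_on A B W f" "openin (mtop A) W" "openin (mtop B) V"
  shows "openin (mtop A) {q \<in> W. f q \<in> V}"
proof -
  have "openin (subtopology (mtop A) W) {q \<in> topspace (subtopology (mtop A) W). f q \<in> V}"
    using assms unfolding msmooth_on_def continuous_map_def by blast
  moreover have "topspace (subtopology (mtop A) W) = W"
    using openin_subset[OF assms(2)] by auto
  ultimately have "openin (subtopology (mtop A) W) {q \<in> W. f q \<in> V}"
    by (simp only:)
  then show ?thesis
    using openin_open_subtopology[OF assms(2)] by blast
qed

lemma msmooth_on_imp_smooth_map_at: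
  assumes A: "smooth_atlas A" and B: "smooth_atlas B"
    and W: "openin (mtop A) W" and p: "p \<in> W" and f: "msmooth_on A B W f"
  shows "smooth_map_at A B f p"
proof -
  have WA: "W \<subseteq> topspace (mtop A)" by (rule openin_subset[OF W])
  have "f p \<in> topspace (mtop B)"
    using f p WA unfolding msmooth_on_def continuous_map_def by auto
  moreover have "(\<forall>\<^sub>F y in nhds (cmap c p). f (cinv c y) \<in> cdom d) \<and>
        smooth_at (\<lambda>y. cmap d (f (cinv c y))) (cmap c p)"
    if c: "c \<in> A" "p \<in> cdom c" and d: "d \<in> B" "f p \<in> cdom d" for c d
  proof
    let ?V = "{q \<in> W. f q \<in> cdom d}"
    have V: "openin (mtop A) ?V"
      by (rule msmooth_on_openin_preimage[OF f W openin_cdom[OF B d(1)]])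
    have pV: "p \<in> ?V" using p d by simp
    show "\<forall>\<^sub>F y in nhds (cmap c p). f (cinv c y) \<in> cdom d"
      using eventually_cinv[OF A V c(1) pV c(2)] by eventually_elim simp
    have eq: "?V \<inter> cdom c = {p \<in> W \<inter> cdom c. f p \<in> cdom d}" by auto
    have "open (cmap c ` {p \<in> W \<inter> cdom c. f p \<in> cdom d})"
      using open_image_chart[OF A V c(1)] by (simp only: eq)
    moreover have "smooth_on (cmap c ` {p \<in> W \<inter> cdom c. f p \<in> cdom d}) (\<lambda>y. cmap d (f (cinv c y)))"
      using f c(1) d(1) unfolding msmooth_on_def o_def by blast
    moreover have "cmap c p \<in> cmap c ` {p \<in> W \<inter> cdom c. f p \<in> cdom d}"
      using p c d by auto
    ultimately show "smooth_at (\<lambda>y. cmap d (f (cinv c y))) (cmap c p)"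
      unfolding smooth_at_def by blast
  qed
  ultimately show ?thesis
    using WA p topspace_mtop[OF A] topspace_mtop[OF B] unfolding smooth_map_at_def by auto
qed

lemma smooth_map_at_cong:
  assumes "smooth_atlas A" "openin (mtop A) W" "p \<in> W" "\<And>q. q \<in> W \<Longrightarrow> f q = g q"
    and "smooth_map_at A B f p"
  shows "smooth_map_at A B g p"
  unfolding smooth_map_at_def
proof (intro conjI ballI impI)
  show "p \<in> mcarrier A" "g p \<in> mcarrier B"
    using assms(5) assms(4)[OF assms(3)] unfolding smooth_map_at_def by auto
  fix c d assume *: "c \<in> A" "d \<in> B" "p \<in> cdom c" "g p \<in> cdom d"
  have fp: "f p \<in> cdom d" using * assms(4)[OF assms(3)] by simp
  have ev: "\<forall>\<^sub>F y in nhds (cmap c p). y \<in> cmap c ` cdom c \<and> cinv c y \<in> W"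
    by (rule eventually_cinv[OF assms(1,2) *(1) assms(3) *(3)])
  show "\<forall>\<^sub>F y in nhds (cmap c p). g (cinv c y) \<in> cdom d"
    using ev smooth_map_atD(1)[OF assms(5) *(1,3,2) fp]
    by eventually_elim (use assms(4) in auto)
  show "smooth_at (\<lambda>y. cmap d (g (cinv c y))) (cmap c p)"
    by (rule smooth_at_cong[OF smooth_map_atD(2)[OF assms(5) *(1,3,2) fp]])
      (rule eventually_mono[OF ev], simp add: assms(4))
qed

lemma mderiv_cong:
  assumes "smooth_atlas A" "openin (mtop A) W" "p \<in> W" "\<And>q. q \<in> W \<Longrightarrow> f q = g q"
  shows "mderiv A B f p = mderiv A B g p"
proof -
  have pA: "p \<in> mcarrier A" using assms by (auto simp: openin_atlas)
  have "\<forall>\<^sub>F y in nhds (cmap (chart_at A p) p). (cmap (chart_at B (f p)) \<circ> f \<circ> cinv (chart_at A p)) y =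
     (cmap (chart_at B (f p)) \<circ> g \<circ> cinv (chart_at A p)) y"
    using eventually_cinv[OF assms(1,2) chart_at(1)[OF pA] assms(3) chart_at(2)[OF pA]]
    by eventually_elim (use assms(4) in auto)
  then show ?thesis
    using frechet_derivative_cong_ev assms(4)[OF assms(3)] unfolding mderiv_def by metis
qed

lemma smooth_map_at_compose:
  assumes A: "smooth_atlas A" and B: "smooth_atlas B"
    and f: "smooth_map_at A B f p" and g: "smooth_map_at B C g (f p)"
  shows "smooth_map_at A C (\<lambda>x. g (f x)) p"
  unfolding smooth_map_at_def
proof (intro conjI ballI impI)
  show "p \<in> mcarrier A" "g (f p) \<in> mcarrier C"
    by (rule smooth_map_at_carrier[OF f], rule smooth_map_at_carrier[OF g])
  have fpB: "f p \<in> mcarrier B" by (rule smooth_map_at_carrier[OF f])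
  let ?d = "chart_at B (f p)"
  note d = chart_at[OF fpB]
  fix c e assume c: "c \<in> A" and e: "e \<in> C" and pc: "p \<in> cdom c" and ge: "g (f p) \<in> cdom e"
  note f1 = smooth_map_atD[OF f c pc d] and g1 = smooth_map_atD[OF g d e ge]
  have fc: "cmap ?d (f (cinv c (cmap c p))) = cmap ?d (f p)"
    by (simp add: cinv_cmap[OF A c pc])
  \<comment> \<open>Convergence is stated with \<open>nhds\<close> on both sides, because the map
    may take its limit value at other points too.\<close>
  have lim: "filterlim (\<lambda>y. cmap ?d (f (cinv c y))) (nhds (cmap ?d (f p))) (nhds (cmap c p))"
    using smooth_at_isCont[OF f1(2)] fc
      tendsto_at_iff_tendsto_nhds[of "\<lambda>y. cmap ?d (f (cinv c y))" "cmap c p"]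
    by (simp add: isCont_def)
  have ev: "\<forall>\<^sub>F y in nhds (cmap c p). cinv ?d (cmap ?d (f (cinv c y))) = f (cinv c y)"
    using f1(1) by eventually_elim (rule cinv_cmap[OF B d(1)])
  have "\<forall>\<^sub>F y in nhds (cmap c p). g (cinv ?d (cmap ?d (f (cinv c y)))) \<in> cdom e"
    using g1(1) lim by (rule eventually_compose_filterlim)
  with ev show "\<forall>\<^sub>F y in nhds (cmap c p). g (f (cinv c y)) \<in> cdom e"
    by eventually_elim simp
  have "smooth_at (\<lambda>y. cmap e (g (cinv ?d (cmap ?d (f (cinv c y)))))) (cmap c p)"
    by (rule smooth_at_compose[OF f1(2), of "\<lambda>z. cmap e (g (cinv ?d z))"]) (use g1(2) fc in simp)
  then show "smooth_at (\<lambda>y. cmap e (g (f (cinv c y)))) (cmap c p)"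
    by (rule smooth_at_cong) (rule eventually_mono[OF ev], simp)
qed

text \<open>Both factors use the same chosen chart at \<open>f p\<close>, so their coordinate
  expressions compose and the classical chain rule applies.\<close>

lemma mderiv_compose:
  assumes A: "smooth_atlas A" and B: "smooth_atlas B"
    and f: "smooth_map_at A B f p" and g: "smooth_map_at B C g (f p)"
  shows "mderiv A C (\<lambda>x. g (f x)) p v = mderiv B C g (f p) (mderiv A B f p v)"
proof -
  note pA = smooth_map_at_carrier(1)[OF f] and fpB = smooth_map_at_carrier(2)[OF f]
    and gC = smooth_map_at_carrier(2)[OF g]
  let ?c = "chart_at A p" and ?d = "chart_at B (f p)" and ?e = "chart_at C (g (f p))"
  note c = chart_at[OF pA] and d = chart_at[OF fpB] and e = chart_at[OF gC]
  note f1 = smooth_map_atD[OF f c d] and g1 = smooth_map_atD[OF g d e]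
  have fc: "cmap ?d (f (cinv ?c (cmap ?c p))) = cmap ?d (f p)"
    by (simp add: cinv_cmap[OF A c])
  have ev: "\<forall>\<^sub>F y in nhds (cmap ?c p).
      cmap ?e (g (f (cinv ?c y))) = cmap ?e (g (cinv ?d (cmap ?d (f (cinv ?c y)))))"
    using f1(1) by eventually_elim (simp add: cinv_cmap[OF B d(1)])
  have "mderiv A C (\<lambda>x. g (f x)) p v =
      frechet_derivative (\<lambda>y. cmap ?e (g (cinv ?d (cmap ?d (f (cinv ?c y)))))) (at (cmap ?c p)) v"
    unfolding mderiv_def o_def using frechet_derivative_cong_ev[OF ev] by simp
  also have "\<dots> = frechet_derivative (\<lambda>z. cmap ?e (g (cinv ?d z))) (at (cmap ?d (f p)))
      (frechet_derivative (\<lambda>y. cmap ?d (f (cinv ?c y))) (at (cmap ?c p)) v)"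
    using frechet_derivative_compose_at[OF smooth_at_differentiable[OF f1(2)], of "\<lambda>z. cmap ?e (g (cinv ?d z))" v]
      smooth_at_differentiable[OF g1(2)] by (simp add: fc)
  finally show ?thesis by (simp add: mderiv_def o_def)
qed

lemma linear_mderiv:
  assumes "smooth_map_at A B f p"
  shows "linear (mderiv A B f p)"
proof -
  note c = smooth_map_at_carrier[OF assms]
  show ?thesis
    unfolding mderiv_def o_def
    by (rule linear_frechet_derivative[OF smooth_at_differentiable[OF
          smooth_map_atD(2)[OF assms chart_at[OF c(1)] chart_at[OF c(2)]]]])
qed

section \<open>Model spaces, charts and coordinate expressions of derivatives\<close>

lemma smooth_map_at_modelI:
  assumes "p \<in> mcarrier A" "\<And>c. c \<in> A \<Longrightarrow> p \<in> cdom c \<Longrightarrow> smooth_at (\<lambda>y. f (cinv c y)) (cmap c p)"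
  shows "smooth_map_at A model_atlas f p"
  using assms unfolding smooth_map_at_def by (simp add: model_atlas_def mcarrier_def)

lemma smooth_map_at_model_iff:
  "smooth_map_at model_atlas model_atlas f x \<longleftrightarrow> smooth_at f x"
  unfolding smooth_map_at_def by (simp add: model_atlas_def mcarrier_def)

lemma mderiv_model: "mderiv model_atlas model_atlas f x = frechet_derivative f (at x)"
  by (simp add: mderiv_def o_def)

lemma mderiv_linear:
  assumes "linear L"
  shows "mderiv model_atlas model_atlas L x = L"
  unfolding mderiv_model
  using frechet_derivative_at[OF bounded_linear_imp_has_derivative[OF linear_imp_bounded_linear[OF assms]]]
  by simp

lemma smooth_at_linear: "linear L \<Longrightarrow> smooth_at L x"
  unfolding smooth_at_def
  using smooth_on_linear_comp[of L UNIV "\<lambda>x. x"] smooth_on_id[of UNIV] by auto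

lemma smooth_map_at_cmap:
  assumes "smooth_atlas A" "c \<in> A" "p \<in> cdom c"
  shows "smooth_map_at A model_atlas (cmap c) p"
proof (rule smooth_map_at_modelI)
  show "p \<in> mcarrier A" using assms by (auto simp: mcarrier_def)
  show "smooth_at (\<lambda>y. cmap c (cinv d y)) (cmap d p)" if "d \<in> A" "p \<in> cdom d" for d
    using assms that unfolding smooth_atlas_def smooth_at_def o_def by blast
qed

lemma smooth_map_at_cinv:
  fixes A :: "('a, 'e::finite_dim_normed) atlas"
  assumes A: "smooth_atlas A" and c: "c \<in> A" and y: "y \<in> cmap c ` cdom c"
  shows "smooth_map_at model_atlas A (cinv c) y"
  unfolding smooth_map_at_def
proof (intro conjI ballI impI)
  show "y \<in> mcarrier model_atlas" by simp
  show "cinv c y \<in> mcarrier A" using cinv_in[OF y] c by (auto simp: mcarrier_def)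
  fix b :: "('e, 'e) chart" and d assume b: "b \<in> model_atlas" and d: "d \<in> A" and *: "cinv c y \<in> cdom d"
  have b: "b = (UNIV, \<lambda>x. x)" using b by (simp add: model_atlas_def)
  let ?S = "cmap c ` (cdom c \<inter> cdom d)"
  have S: "open ?S" "smooth_on ?S (\<lambda>y. cmap d (cinv c y))"
    using A c d unfolding smooth_atlas_def o_def by blast+
  have yS: "y \<in> ?S" using y * cmap_cinv[OF y] cinv_in[OF y] by (metis IntI image_eqI)
  have "\<forall>\<^sub>F z in nhds y. z \<in> ?S" using S(1) yS by (rule eventually_nhds_in_open)
  then have "\<forall>\<^sub>F z in nhds y. cinv c z \<in> cdom d"
    by eventually_elim (use cinv_cmap[OF A c] in auto)
  then show "\<forall>\<^sub>F z in nhds (cmap b y). cinv c (cinv b z) \<in> cdom d" by (simp add: b)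
  show "smooth_at (\<lambda>z. cmap d (cinv c (cinv b z))) (cmap b y)"
    unfolding smooth_at_def using S yS by (auto simp: b)
qed

lemma mderiv_id:
  assumes "smooth_atlas A" "p \<in> mcarrier A"
  shows "mderiv A A (\<lambda>x. x) p = (\<lambda>v. v)"
proof -
  let ?c = "chart_at A p"
  note c = chart_at[OF assms(2)]
  have "\<forall>\<^sub>F y in nhds (cmap ?c p). cmap ?c (cinv ?c y) = y"
    using eventually_cinv[OF assms(1) openin_cdom[OF assms(1) c(1)] c(1,2,2)]
    by eventually_elim (auto simp: cmap_cinv)
  from frechet_derivative_cong_ev[OF this] show ?thesis
    unfolding mderiv_def o_def by simp
qed

lemma smooth_at_const: "smooth_at (\<lambda>x. c) x"
  unfolding smooth_at_def using smooth_on_const[OF open_UNIV] by (intro exI[of _ UNIV]) simp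

lemma smooth_map_at_const:
  assumes "p \<in> mcarrier A" "q \<in> mcarrier B"
  shows "smooth_map_at A B (\<lambda>x. q) p"
  using assms unfolding smooth_map_at_def
  by (auto simp: smooth_at_const)

lemma mderiv_const: "mderiv A B (\<lambda>x. q) p = (\<lambda>v. 0)"
  unfolding mderiv_def o_def by (simp add: frechet_derivative_const)

lemma mderiv_left_inverse:
  assumes "smooth_atlas A" "smooth_atlas B" "smooth_map_at A B f p" "smooth_map_at B A g (f p)"
    and "openin (mtop A) W" "p \<in> W" "\<And>q. q \<in> W \<Longrightarrow> g (f q) = q"
  shows "mderiv B A g (f p) (mderiv A B f p v) = v"
proof -
  have "mderiv A A (\<lambda>x. g (f x)) p = mderiv A A (\<lambda>x. x) p"
    by (rule mderiv_cong[OF assms(1,5,6,7)])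
  then show ?thesis
    using mderiv_compose[OF assms(1-4), of v] mderiv_id[OF assms(1) smooth_map_at_carrier(1)[OF assms(3)]]
    by simp
qed

text \<open>The differential of \<open>c\<close> changes coordinates from the chart chosen at
  \<open>p\<close> to \<open>c\<close>. This lemma and the next one make the change
  invertible.\<close>

lemma mderiv_cinv_cmap:
  assumes "smooth_atlas A" "c \<in> A" "p \<in> cdom c"
  shows "mderiv model_atlas A (cinv c) (cmap c p) (mderiv A model_atlas (cmap c) p v) = v"
proof (rule mderiv_left_inverse[OF assms(1) smooth_atlas_model smooth_map_at_cmap[OF assms]
        _ openin_cdom[OF assms(1,2)] assms(3)])
  show "smooth_map_at model_atlas A (cinv c) (cmap c p)"
    using assms(3) by (intro smooth_map_at_cinv[OF assms(1,2)]) simp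
  show "cinv c (cmap c q) = q" if "q \<in> cdom c" for q
    by (rule cinv_cmap[OF assms(1,2) that])
qed

lemma mderiv_cmap_cinv:
  assumes "smooth_atlas A" "c \<in> A" "p \<in> cdom c"
  shows "mderiv A model_atlas (cmap c) p (mderiv model_atlas A (cinv c) (cmap c p) v) = v"
proof -
  have y: "cmap c p \<in> cmap c ` cdom c" using assms by auto
  have o: "openin (mtop model_atlas) (cmap c ` cdom c)"
    using open_chart_image[OF assms(1,2)] by (simp add: openin_atlas[OF smooth_atlas_model]) (simp add: model_atlas_def)
  have "mderiv A model_atlas (cmap c) (cinv c (cmap c p)) (mderiv model_atlas A (cinv c) (cmap c p) v) = v"
    by (rule mderiv_left_inverse[OF smooth_atlas_model assms(1) smooth_map_at_cinv[OF assms(1,2) y] _ o y])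
      (use assms in \<open>simp_all add: cinv_cmap smooth_map_at_cmap cmap_cinv\<close>)
  then show ?thesis by (simp add: cinv_cmap[OF assms])
qed

text \<open>The bridge from \<open>mderiv\<close>, which lives in the chosen charts, to derivatives
  in fixed charts, where smooth dependence on the point can be expressed.\<close>

lemma mderiv_in_charts:
  assumes A: "smooth_atlas A" and B: "smooth_atlas B" and f: "smooth_map_at A B f p"
    and c: "c \<in> A" "p \<in> cdom c" and d: "d \<in> B" "f p \<in> cdom d"
  shows "frechet_derivative (\<lambda>y. cmap d (f (cinv c y))) (at (cmap c p)) (mderiv A model_atlas (cmap c) p v) =
    mderiv B model_atlas (cmap d) (f p) (mderiv A B f p v)"
proof -
  let ?y = "cmap c p"
  have y: "?y \<in> cmap c ` cdom c" using c by auto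
  have cy: "cinv c ?y = p" by (rule cinv_cmap[OF A c])
  note ci = smooth_map_at_cinv[OF A c(1) y]
  have f': "smooth_map_at A B f (cinv c ?y)" using f cy by simp
  have fc: "smooth_map_at model_atlas B (\<lambda>y. f (cinv c y)) ?y"
    by (rule smooth_map_at_compose[OF smooth_atlas_model A ci f'])
  have dd: "smooth_map_at B model_atlas (cmap d) (f (cinv c ?y))"
    unfolding cy by (rule smooth_map_at_cmap[OF B d])
  show ?thesis
    using mderiv_compose[OF smooth_atlas_model B fc dd] mderiv_compose[OF smooth_atlas_model A ci f']
    by (simp add: mderiv_model cy mderiv_cinv_cmap[OF A c])
qed

lemma smooth_map_at_id:
  assumes "smooth_atlas A" "p \<in> mcarrier A"
  shows "smooth_map_at A A (\<lambda>x. x) p"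
  unfolding smooth_map_at_def
proof (intro conjI ballI impI)
  fix c d assume *: "c \<in> A" "d \<in> A" "p \<in> cdom c" "p \<in> cdom d"
  show "\<forall>\<^sub>F y in nhds (cmap c p). cinv c y \<in> cdom d"
    using eventually_cinv[OF assms(1) openin_cdom[OF assms(1) *(2)] *(1,4,3)] by eventually_elim simp
  show "smooth_at (\<lambda>y. cmap d (cinv c y)) (cmap c p)"
    using assms(1) * unfolding smooth_atlas_def smooth_at_def o_def by blast
qed (rule assms(2))+

text \<open>Differentials of charts are isomorphisms, so surjectivity of \<open>mderiv\<close>
  passes to the coordinate expression, to which \<open>submersion_image_nhd\<close> applies.\<close>

lemma submersion_image_open:
  assumes A: "smooth_atlas A" and B: "smooth_atlas B"
    and W: "openin (mtop A) W" and f: "submersion_on A B W f"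
    and V: "openin (mtop A) V" "V \<subseteq> W"
  shows "openin (mtop B) (f ` V)"
proof -
  have sm: "smooth_map_at A B f p" if "p \<in> V" for p
    using that V f by (intro msmooth_on_imp_smooth_map_at[OF A B W]) (auto simp: submersion_on_def)
  have "open (cmap d ` (f ` V \<inter> cdom d))" if d: "d \<in> B" for d
  proof (subst open_subopen, rule ballI)
    fix z assume "z \<in> cmap d ` (f ` V \<inter> cdom d)"
    then obtain p where p: "p \<in> V" "f p \<in> cdom d" "z = cmap d (f p)" by blast
    have pA: "p \<in> mcarrier A" by (rule smooth_map_at_carrier[OF sm[OF p(1)]])
    let ?c = "chart_at A p"
    note c = chart_at[OF pA]
    let ?g = "\<lambda>y. cmap d (f (cinv ?c y))"
    note s = smooth_map_atD[OF sm[OF p(1)] c d p(2)]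
    obtain S where S: "open S" "cmap ?c p \<in> S" "smooth_on S ?g"
      using s(2) unfolding smooth_at_def by blast
    have "\<forall>\<^sub>F y in nhds (cmap ?c p). f (cinv ?c y) \<in> cdom d \<and> cinv ?c y \<in> V"
      using s(1) eventually_cinv[OF A V(1) c(1) p(1) c(2)] by eventually_elim simp
    then obtain S' where S': "open S'" "cmap ?c p \<in> S'"
      "\<And>y. y \<in> S' \<Longrightarrow> f (cinv ?c y) \<in> cdom d \<and> cinv ?c y \<in> V"
      unfolding eventually_nhds by blast
    have surj: "surj (frechet_derivative ?g (at (cmap ?c p)))"
    proof (rule surjI)
      fix w
      have "surj (mderiv A B f p)" using f p(1) V unfolding submersion_on_def by blast
      then have "mderiv A B f p (inv_into UNIV (mderiv A B f p) u) = u" for u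
        by (rule surj_f_inv_f)
      \<comment> \<open>The preimage of \<open>w\<close> arises by moving \<open>w\<close> to the
        chosen coordinates at \<open>f p\<close>, lifting it there, and moving the lift to the
        coordinates of \<open>?c\<close>.\<close>
      then show "frechet_derivative ?g (at (cmap ?c p)) (mderiv A model_atlas (cmap ?c) p
          (inv_into UNIV (mderiv A B f p) (mderiv model_atlas B (cinv d) (cmap d (f p)) w))) = w"
        by (simp add: mderiv_in_charts[OF A B sm[OF p(1)] c d p(2)] mderiv_cmap_cinv[OF B d p(2)])
    qed
    have "Ck_on (Suc 0) (S \<inter> S') ?g"
      by (rule smooth_on_Suc[OF smooth_on_subset[OF S(3)]]) simp
    then obtain T where T: "open T" "?g (cmap ?c p) \<in> T" "T \<subseteq> ?g ` (S \<inter> S')"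
      using submersion_image_nhd[of "S \<inter> S'" "cmap ?c p" ?g] S S' surj by auto
    have "z \<in> T" using T(2) by (simp add: p(3) cinv_cmap[OF A c])
    moreover have "T \<subseteq> cmap d ` (f ` V \<inter> cdom d)" using T(3) S'(3) by blast
    ultimately show "\<exists>T. open T \<and> z \<in> T \<and> T \<subseteq> cmap d ` (f ` V \<inter> cdom d)" using T(1) by blast
  qed
  moreover have "f ` V \<subseteq> mcarrier B" using smooth_map_at_carrier(2)[OF sm] by auto
  ultimately show ?thesis by (simp add: openin_atlas[OF B])
qed

section \<open>Products of manifolds\<close>

lemma prod_atlasE:
  assumes "e \<in> prod_atlas A B"
  obtains c d where "c \<in> A" "d \<in> B" "e = (cdom c \<times> cdom d, map_prod (cmap c) (cmap d))"
  using assms unfolding prod_atlas_def by blast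

lemma prod_atlasI: "c \<in> A \<Longrightarrow> d \<in> B \<Longrightarrow> (cdom c \<times> cdom d, map_prod (cmap c) (cmap d)) \<in> prod_atlas A B"
  unfolding prod_atlas_def by blast

lemma mcarrier_prod: "mcarrier (prod_atlas A B) = mcarrier A \<times> mcarrier B"
proof (rule Set.set_eqI)
  fix z
  show "z \<in> mcarrier (prod_atlas A B) \<longleftrightarrow> z \<in> mcarrier A \<times> mcarrier B"
  proof
    assume "z \<in> mcarrier (prod_atlas A B)"
    then obtain e where "e \<in> prod_atlas A B" "z \<in> cdom e" by (auto simp: mcarrier_def)
    then show "z \<in> mcarrier A \<times> mcarrier B"
      by (elim prod_atlasE) (auto simp: mcarrier_def)
  next
    assume "z \<in> mcarrier A \<times> mcarrier B"
    then obtain c d where "c \<in> A" "d \<in> B" "z \<in> cdom c \<times> cdom d" by (auto simp: mcarrier_def)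
    then show "z \<in> mcarrier (prod_atlas A B)"
      unfolding mcarrier_def using prod_atlasI[of c A d B] by (intro UN_I) auto
  qed
qed

lemma cinv_prod:
  assumes "smooth_atlas A" "smooth_atlas B" "c \<in> A" "d \<in> B"
    and "z \<in> map_prod (cmap c) (cmap d) ` (cdom c \<times> cdom d)"
  shows "cinv (cdom c \<times> cdom d, map_prod (cmap c) (cmap d)) z = (cinv c (fst z), cinv d (snd z))"
proof -
  obtain p q where pq: "p \<in> cdom c" "q \<in> cdom d" "z = (cmap c p, cmap d q)"
    using assms(5) by auto
  have "inj_on (map_prod (cmap c) (cmap d)) (cdom c \<times> cdom d)"
    using assms(1-4) unfolding smooth_atlas_def by (intro map_prod_inj_on) blast+
  then have "cinv (cdom c \<times> cdom d, map_prod (cmap c) (cmap d)) (map_prod (cmap c) (cmap d) (p, q)) = (p, q)"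
    unfolding cinv_def fst_conv snd_conv by (rule inv_into_f_f) (use pq in simp)
  with pq show ?thesis using cinv_cmap[OF assms(1,3)] cinv_cmap[OF assms(2,4)] by simp
qed

lemma smooth_on_prod:
  assumes "open S" "open T" "smooth_on S f" "smooth_on T g"
  shows "smooth_on (S \<times> T) (\<lambda>z. (f (fst z), g (snd z)))"
proof -
  have o: "open (S \<times> T)" using assms(1,2) by (rule open_Times)
  have "smooth_on (S \<times> T) (\<lambda>z. fst z)" "smooth_on (S \<times> T) (\<lambda>z. snd z)"
    using smooth_on_linear_comp[OF _ o smooth_on_id[OF o], of fst]
      smooth_on_linear_comp[OF _ o smooth_on_id[OF o], of snd]
    by (simp_all add: bounded_linear.linear bounded_linear_fst bounded_linear_snd)
  then have "smooth_on (S \<times> T) (\<lambda>z. f (fst z))" "smooth_on (S \<times> T) (\<lambda>z. g (snd z))"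
    using smooth_on_compose[OF o assms(1) _ _ assms(3), of fst]
      smooth_on_compose[OF o assms(2) _ _ assms(4), of snd] by auto
  then show ?thesis by (rule smooth_on_Pair[OF o])
qed

lemma smooth_atlas_prod:
  assumes A: "smooth_atlas A" and B: "smooth_atlas B"
  shows "smooth_atlas (prod_atlas A B)"
  unfolding smooth_atlas_def
proof (intro conjI ballI)
  fix e assume "e \<in> prod_atlas A B"
  then obtain c d where e: "c \<in> A" "d \<in> B" "e = (cdom c \<times> cdom d, map_prod (cmap c) (cmap d))"
    by (rule prod_atlasE)
  show "inj_on (cmap e) (cdom e)"
    using A B e unfolding smooth_atlas_def by (simp add: map_prod_inj_on)
  fix e' assume "e' \<in> prod_atlas A B"
  then obtain c' d' where e': "c' \<in> A" "d' \<in> B" "e' = (cdom c' \<times> cdom d', map_prod (cmap c') (cmap d'))"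
    by (rule prod_atlasE)
  let ?S = "cmap c ` (cdom c \<inter> cdom c')" and ?T = "cmap d ` (cdom d \<inter> cdom d')"
  have S: "open ?S" "smooth_on ?S (\<lambda>y. cmap c' (cinv c y))"
    using A e(1) e'(1) unfolding smooth_atlas_def o_def by blast+
  have T: "open ?T" "smooth_on ?T (\<lambda>y. cmap d' (cinv d y))"
    using B e(2) e'(2) unfolding smooth_atlas_def o_def by blast+
  have eq: "cmap e ` (cdom e \<inter> cdom e') = ?S \<times> ?T"
    by (auto simp: e(3) e'(3) map_prod_def image_iff)
  show o: "open (cmap e ` (cdom e \<inter> cdom e'))"
    unfolding eq by (rule open_Times[OF S(1) T(1)])
  show "smooth_on (cmap e ` (cdom e \<inter> cdom e')) (cmap e' \<circ> cinv e)"
  proof (rule smooth_on_cong[OF o])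
    show "smooth_on (cmap e ` (cdom e \<inter> cdom e')) (\<lambda>z. (cmap c' (cinv c (fst z)), cmap d' (cinv d (snd z))))"
      unfolding eq by (rule smooth_on_prod[OF S(1) T(1) S(2) T(2)])
    fix z assume "z \<in> cmap e ` (cdom e \<inter> cdom e')"
    then have "z \<in> map_prod (cmap c) (cmap d) ` (cdom c \<times> cdom d)" by (auto simp: e(3))
    then show "(cmap c' (cinv c (fst z)), cmap d' (cinv d (snd z))) = (cmap e' \<circ> cinv e) z"
      using cinv_prod[OF A B e(1,2)] by (simp add: e(3) e'(3))
  qed
qed

lemma openin_prod_Times:
  assumes A: "smooth_atlas A" and B: "smooth_atlas B" and U: "openin (mtop A) U" and V: "openin (mtop B) V"
  shows "openin (mtop (prod_atlas A B)) (U \<times> V)"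
proof -
  have "open (cmap e ` (U \<times> V \<inter> cdom e))" if "e \<in> prod_atlas A B" for e
  proof -
    from that obtain c d where e: "c \<in> A" "d \<in> B" "e = (cdom c \<times> cdom d, map_prod (cmap c) (cmap d))"
      by (rule prod_atlasE)
    have "cmap e ` (U \<times> V \<inter> cdom e) = cmap c ` (U \<inter> cdom c) \<times> cmap d ` (V \<inter> cdom d)"
      by (auto simp: e(3) map_prod_def image_iff)
    then show ?thesis
      using open_Times[OF open_image_chart[OF A U e(1)] open_image_chart[OF B V e(2)]] by simp
  qed
  moreover have "U \<times> V \<subseteq> mcarrier (prod_atlas A B)"
    using U V A B by (auto simp: mcarrier_prod openin_atlas)
  ultimately show ?thesis by (simp add: openin_atlas[OF smooth_atlas_prod[OF A B]])
qed

lemma smooth_at_Pair: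
  assumes "smooth_at f x" "smooth_at g x"
  shows "smooth_at (\<lambda>y. (f y, g y)) x"
proof -
  obtain S where S: "open S" "x \<in> S" "smooth_on S f"
    using assms(1) unfolding smooth_at_def by (elim exE conjE)
  obtain T where T: "open T" "x \<in> T" "smooth_on T g"
    using assms(2) unfolding smooth_at_def by (elim exE conjE)
  have "open (S \<inter> T)" using S T by blast
  moreover have "smooth_on (S \<inter> T) (\<lambda>y. (f y, g y))"
    by (rule smooth_on_Pair[OF _ smooth_on_subset[OF S(3)] smooth_on_subset[OF T(3)]]) (use S T in auto)
  ultimately show ?thesis using S(2) T(2) unfolding smooth_at_def by (intro exI[of _ "S \<inter> T"]) simp
qed

lemma smooth_map_at_Pair:
  assumes A: "smooth_atlas A" and B: "smooth_atlas B"
    and f: "smooth_map_at C A f x" and g: "smooth_map_at C B g x"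
  shows "smooth_map_at C (prod_atlas A B) (\<lambda>y. (f y, g y)) x"
  unfolding smooth_map_at_def
proof (intro conjI ballI impI)
  show "x \<in> mcarrier C" by (rule smooth_map_at_carrier[OF f])
  show "(f x, g x) \<in> mcarrier (prod_atlas A B)"
    using smooth_map_at_carrier(2)[OF f] smooth_map_at_carrier(2)[OF g] by (simp add: mcarrier_prod)
  fix b e assume b: "b \<in> C" "x \<in> cdom b" and "e \<in> prod_atlas A B" and fg: "(f x, g x) \<in> cdom e"
  then obtain c d where e: "c \<in> A" "d \<in> B" "e = (cdom c \<times> cdom d, map_prod (cmap c) (cmap d))"
    by (elim prod_atlasE)
  have fx: "f x \<in> cdom c" and gx: "g x \<in> cdom d" using fg by (simp_all add: e(3))
  show "\<forall>\<^sub>F y in nhds (cmap b x). (f (cinv b y), g (cinv b y)) \<in> cdom e"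
    using smooth_map_atD(1)[OF f b e(1) fx] smooth_map_atD(1)[OF g b e(2) gx]
    by eventually_elim (simp add: e(3))
  show "smooth_at (\<lambda>y. cmap e (f (cinv b y), g (cinv b y))) (cmap b x)"
    using smooth_at_Pair[OF smooth_map_atD(2)[OF f b e(1) fx] smooth_map_atD(2)[OF g b e(2) gx]]
    by (simp add: e(3))
qed

lemma smooth_map_at_fst_snd:
  assumes A: "smooth_atlas A" and B: "smooth_atlas B" and pq: "pq \<in> mcarrier (prod_atlas A B)"
  shows "smooth_map_at (prod_atlas A B) A fst pq" "smooth_map_at (prod_atlas A B) B snd pq"
proof -
  have p: "fst pq \<in> mcarrier A" and q: "snd pq \<in> mcarrier B" using pq by (auto simp: mcarrier_prod)
  have ev: "\<forall>\<^sub>F z in nhds (cmap e pq). z \<in> cmap e ` cdom e" if "e \<in> prod_atlas A B" "pq \<in> cdom e" for e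
    using open_chart_image[OF smooth_atlas_prod[OF A B] that(1)] that(2) by (intro eventually_nhds_in_open) auto
  have lim: "filterlim fst (nhds (fst z)) (nhds z)" "filterlim snd (nhds (snd z)) (nhds z)" for z :: "'b \<times> 'd"
    by (rule tendsto_fst[OF filterlim_ident], rule tendsto_snd[OF filterlim_ident])
  show "smooth_map_at (prod_atlas A B) A fst pq"
    unfolding smooth_map_at_def
  proof (intro conjI ballI impI)
    fix e c' assume "e \<in> prod_atlas A B" and c': "c' \<in> A" "fst pq \<in> cdom c'" and pe: "pq \<in> cdom e"
    then obtain c d where e: "c \<in> A" "d \<in> B" "e = (cdom c \<times> cdom d, map_prod (cmap c) (cmap d))"
      by (elim prod_atlasE)
    note ev' = ev[OF \<open>e \<in> prod_atlas A B\<close> pe]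
    have z: "fst (cmap e pq) = cmap c (fst pq)" by (simp add: e(3))
    have pc: "fst pq \<in> cdom c" using pe by (auto simp: e(3))
    note i = smooth_map_atD[OF smooth_map_at_id[OF A p] e(1) pc c']
    have "\<forall>\<^sub>F z in nhds (cmap e pq). cinv c (fst z) \<in> cdom c'"
      by (rule eventually_compose_filterlim[OF i(1)]) (use lim(1)[of "cmap e pq"] z in simp)
    with ev' show "\<forall>\<^sub>F z in nhds (cmap e pq). fst (cinv e z) \<in> cdom c'"
      by eventually_elim (use cinv_prod[OF A B e(1,2)] in \<open>simp add: e(3)\<close>)
    have "smooth_at (\<lambda>z. cmap c' (cinv c (fst z))) (cmap e pq)"
      by (rule smooth_at_compose[OF smooth_at_linear[OF bounded_linear.linear[OF bounded_linear_fst]],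
            of "\<lambda>y. cmap c' (cinv c y)"]) (use i(2) z in simp)
    then show "smooth_at (\<lambda>z. cmap c' (fst (cinv e z))) (cmap e pq)"
      by (rule smooth_at_cong)
        (rule eventually_mono[OF ev'], use cinv_prod[OF A B e(1,2)] in \<open>simp add: e(3)\<close>)
  qed (use p pq in simp_all)
  show "smooth_map_at (prod_atlas A B) B snd pq"
    unfolding smooth_map_at_def
  proof (intro conjI ballI impI)
    fix e c' assume "e \<in> prod_atlas A B" and c': "c' \<in> B" "snd pq \<in> cdom c'" and pe: "pq \<in> cdom e"
    then obtain c d where e: "c \<in> A" "d \<in> B" "e = (cdom c \<times> cdom d, map_prod (cmap c) (cmap d))"
      by (elim prod_atlasE)
    note ev' = ev[OF \<open>e \<in> prod_atlas A B\<close> pe]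
    have z: "snd (cmap e pq) = cmap d (snd pq)" by (simp add: e(3))
    have pc: "snd pq \<in> cdom d" using pe by (auto simp: e(3))
    note i = smooth_map_atD[OF smooth_map_at_id[OF B q] e(2) pc c']
    have "\<forall>\<^sub>F z in nhds (cmap e pq). cinv d (snd z) \<in> cdom c'"
      by (rule eventually_compose_filterlim[OF i(1)]) (use lim(2)[of "cmap e pq"] z in simp)
    with ev' show "\<forall>\<^sub>F z in nhds (cmap e pq). snd (cinv e z) \<in> cdom c'"
      by eventually_elim (use cinv_prod[OF A B e(1,2)] in \<open>simp add: e(3)\<close>)
    have "smooth_at (\<lambda>z. cmap c' (cinv d (snd z))) (cmap e pq)"
      by (rule smooth_at_compose[OF smooth_at_linear[OF bounded_linear.linear[OF bounded_linear_snd]],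
            of "\<lambda>y. cmap c' (cinv d y)"]) (use i(2) z in simp)
    then show "smooth_at (\<lambda>z. cmap c' (snd (cinv e z))) (cmap e pq)"
      by (rule smooth_at_cong)
        (rule eventually_mono[OF ev'], use cinv_prod[OF A B e(1,2)] in \<open>simp add: e(3)\<close>)
  qed (use q pq in simp_all)
qed

text \<open>The chart chosen at \<open>pq\<close> is a product chart, but perhaps not the product of
  the charts chosen at the components. So \<open>v\<close> is moved to coordinates in that chart,
  where its components come from the differentials of \<open>fst\<close> and
  \<open>snd\<close>.\<close>

lemma mderiv_fst_snd_eq_0:
  assumes A: "smooth_atlas A" and B: "smooth_atlas B" and pq: "pq \<in> mcarrier (prod_atlas A B)"
    and 0: "mderiv (prod_atlas A B) A fst pq v = 0" "mderiv (prod_atlas A B) B snd pq v = 0"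
  shows "v = 0"
proof -
  let ?e = "chart_at (prod_atlas A B) pq"
  note AB = smooth_atlas_prod[OF A B]
  note e = chart_at[OF pq]
  obtain c d where cd: "c \<in> A" "d \<in> B" "?e = (cdom c \<times> cdom d, map_prod (cmap c) (cmap d))"
    using e(1) by (rule prod_atlasE)
  have p: "fst pq \<in> cdom c" and q: "snd pq \<in> cdom d" using e(2) by (auto simp: cd(3))
  let ?t = "mderiv (prod_atlas A B) model_atlas (cmap ?e) pq v"
  note fs = smooth_map_at_fst_snd[OF A B pq]
  note te = smooth_map_at_cmap[OF AB e]
  note lf = bounded_linear.linear[OF bounded_linear_fst] bounded_linear.linear[OF bounded_linear_snd]
  have s: "smooth_map_at model_atlas model_atlas fst y" "smooth_map_at model_atlas model_atlas snd y" for y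
    by (simp_all add: smooth_map_at_model_iff smooth_at_linear lf)
  have "fst ?t = mderiv (prod_atlas A B) model_atlas (\<lambda>z. fst (cmap ?e z)) pq v"
    using mderiv_compose[OF AB smooth_atlas_model te s(1)] by (simp add: mderiv_linear lf)
  also have "(\<lambda>z. fst (cmap ?e z)) = (\<lambda>z. cmap c (fst z))"
    by (simp add: cd(3))
  also have "mderiv (prod_atlas A B) model_atlas (\<lambda>z. cmap c (fst z)) pq v = 0"
    using mderiv_compose[OF AB A fs(1) smooth_map_at_cmap[OF A cd(1) p]]
      linear_0[OF linear_mderiv[OF smooth_map_at_cmap[OF A cd(1) p]]] by (simp add: 0)
  finally have f0: "fst ?t = 0" .
  have "snd ?t = mderiv (prod_atlas A B) model_atlas (\<lambda>z. snd (cmap ?e z)) pq v"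
    using mderiv_compose[OF AB smooth_atlas_model te s(2)] by (simp add: mderiv_linear lf)
  also have "(\<lambda>z. snd (cmap ?e z)) = (\<lambda>z. cmap d (snd z))"
    by (simp add: cd(3))
  also have "mderiv (prod_atlas A B) model_atlas (\<lambda>z. cmap d (snd z)) pq v = 0"
    using mderiv_compose[OF AB B fs(2) smooth_map_at_cmap[OF B cd(2) q]]
      linear_0[OF linear_mderiv[OF smooth_map_at_cmap[OF B cd(2) q]]] by (simp add: 0)
  finally have "snd ?t = 0" .
  with f0 have t0: "?t = 0" by (simp add: prod_eq_iff)
  have "smooth_map_at model_atlas (prod_atlas A B) (cinv ?e) (cmap ?e pq)"
    using e by (intro smooth_map_at_cinv[OF AB]) auto
  from linear_0[OF linear_mderiv[OF this]] show ?thesis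
    using mderiv_cinv_cmap[OF AB e, of v] unfolding t0 by simp
qed

section \<open>The connection of a reductive Cartan geometry\<close>

text \<open>The complement \<open>V\<close> is a parameter because the connection depends on
  it.\<close>

locale reductive_geometry =
  fixes \<xi> :: "('g, 'n, 'p, 'a::finite_dim_normed, 'h::finite_dim_normed, 'q::finite_dim_normed,
    'r::finite_dim_normed) cartan_data" and V :: "'a set"
  assumes cartan: "cartan_geometry \<xi>"
    and V_subspace: "subspace V"
    and Ad_V: "h \<in> mcarrier (SubA \<xi>) \<Longrightarrow> Ad (Grp \<xi>) (GrpA \<xi>) h ` V \<subseteq> V"
    and h_Int_V: "range (lie_incl (Grp \<xi>) (GrpA \<xi>) (SubA \<xi>)) \<inter> V = {0}"
    and h_plus_V: "\<exists>a\<in>range (lie_incl (Grp \<xi>) (GrpA \<xi>) (SubA \<xi>)). \<exists>b\<in>V. x = a + b"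
begin

section \<open>The bundle, the group action and the Cartan form\<close>

abbreviation "N \<equiv> Base \<xi>"
abbreviation "P \<equiv> Total \<xi>"
abbreviation "H \<equiv> SubA \<xi>"
abbreviation "proj \<equiv> Proj \<xi>"
abbreviation "act \<equiv> Act \<xi>"
abbreviation "\<omega> \<equiv> Form \<xi>"
abbreviation "unit \<equiv> \<one>\<^bsub>Grp \<xi>\<^esub>"
abbreviation "incl \<equiv> lie_incl (Grp \<xi>) (GrpA \<xi>) H"
abbreviation "dproj w \<equiv> mderiv P N proj w"

lemmas cartan' = cartan[unfolded cartan_geometry_def Let_def]

lemma principal: "principal_bundle \<xi>"
  using cartan' by (elim conjE)

lemmas principal' = principal[unfolded principal_bundle_def Let_def]

lemma lie_group_G: "lie_group (Grp \<xi>) (GrpA \<xi>)"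
  using cartan' by (elim conjE)

lemma closed_H: "closed_lie_subgroup (Grp \<xi>) (GrpA \<xi>) H"
  using cartan' by (elim conjE)

lemma N_manifold: "manifold N"
  using principal' by (elim conjE)

lemma P_manifold: "manifold P"
  using principal' by (elim conjE)

lemmas N_atlas = manifold_smooth_atlas[OF N_manifold]
lemmas P_atlas = manifold_smooth_atlas[OF P_manifold]

lemma H_lie: "lie_group (Grp \<xi>\<lparr>carrier := mcarrier H\<rparr>) H"
  using closed_H unfolding closed_lie_subgroup_def by blast

lemma H_atlas: "smooth_atlas H"
  using H_lie manifold_smooth_atlas unfolding lie_group_def by blast

lemma H_subgroup: "subgroup (mcarrier H) (Grp \<xi>)"
  using closed_H unfolding closed_lie_subgroup_def by blast

lemma G_group: "Group.group (Grp \<xi>)"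
  using lie_group_G unfolding lie_group_def by blast

lemma unit_H: "unit \<in> mcarrier H"
  by (rule subgroup.one_closed[OF H_subgroup])

lemma H_carrier: "h \<in> mcarrier H \<Longrightarrow> h \<in> carrier (Grp \<xi>)"
  using subgroup.mem_carrier[OF H_subgroup] .

lemma inv_H: "h \<in> mcarrier H \<Longrightarrow> inv\<^bsub>Grp \<xi>\<^esub> h \<in> mcarrier H"
  by (rule subgroup.m_inv_closed[OF H_subgroup])

lemma proj_smooth_on: "msmooth_on P N (mcarrier P) proj"
  using principal' by (elim conjE)

lemma proj_smooth: "w \<in> mcarrier P \<Longrightarrow> smooth_map_at P N proj w"
  by (rule msmooth_on_imp_smooth_map_at[OF P_atlas N_atlas openin_mcarrier[OF P_atlas] _ proj_smooth_on])

lemma proj_in: "w \<in> mcarrier P \<Longrightarrow> proj w \<in> mcarrier N"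
  by (rule smooth_map_at_carrier(2)[OF proj_smooth])

lemma proj_onto: "x \<in> mcarrier N \<Longrightarrow> \<exists>w\<in>mcarrier P. proj w = x"
proof -
  have "proj ` mcarrier P = mcarrier N" using principal' by (elim conjE)
  then show "x \<in> mcarrier N \<Longrightarrow> \<exists>w\<in>mcarrier P. proj w = x" by force
qed

lemma over_open: "openin (mtop N) W \<Longrightarrow> openin (mtop P) (over \<xi> W)"
  unfolding over_def by (rule msmooth_on_openin_preimage[OF proj_smooth_on openin_mcarrier[OF P_atlas]])

lemma act_smooth:
  assumes "w \<in> mcarrier P" "h \<in> mcarrier H"
  shows "smooth_map_at (prod_atlas P H) P (\<lambda>(w, h). act w h) (w, h)"
proof (rule msmooth_on_imp_smooth_map_at[OF smooth_atlas_prod[OF P_atlas H_atlas] P_atlas])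
  show "openin (mtop (prod_atlas P H)) (mcarrier P \<times> mcarrier H)"
    by (rule openin_prod_Times[OF P_atlas H_atlas openin_mcarrier[OF P_atlas] openin_mcarrier[OF H_atlas]])
  show "msmooth_on (prod_atlas P H) P (mcarrier P \<times> mcarrier H) (\<lambda>(w, h). act w h)"
    using principal' by (elim conjE)
qed (use assms in simp)

lemma right_translation_smooth:
  assumes "w \<in> mcarrier P" "h \<in> mcarrier H"
  shows "smooth_map_at P P (\<lambda>u. act u h) w"
proof -
  have "smooth_map_at P (prod_atlas P H) (\<lambda>u. (u, h)) w"
    by (rule smooth_map_at_Pair[OF P_atlas H_atlas smooth_map_at_id[OF P_atlas assms(1)]
          smooth_map_at_const[OF assms]])
  from smooth_map_at_compose[OF P_atlas smooth_atlas_prod[OF P_atlas H_atlas] this act_smooth[OF assms]]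
  show ?thesis by simp
qed

lemma orbit_map_smooth:
  assumes "w \<in> mcarrier P" "h \<in> mcarrier H"
  shows "smooth_map_at H P (act w) h"
proof -
  have "smooth_map_at H (prod_atlas P H) (\<lambda>k. (w, k)) h"
    by (rule smooth_map_at_Pair[OF P_atlas H_atlas smooth_map_at_const[OF assms(2,1)]
          smooth_map_at_id[OF H_atlas assms(2)]])
  from smooth_map_at_compose[OF H_atlas smooth_atlas_prod[OF P_atlas H_atlas] this act_smooth[OF assms]]
  show ?thesis by simp
qed

lemma act_in: "w \<in> mcarrier P \<Longrightarrow> h \<in> mcarrier H \<Longrightarrow> act w h \<in> mcarrier P"
  by (rule smooth_map_at_carrier(2)[OF right_translation_smooth])

lemma act_unit: "w \<in> mcarrier P \<Longrightarrow> act w unit = w"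
proof -
  have "\<forall>w\<in>mcarrier P. act w unit = w" using principal' by (elim conjE)
  then show "w \<in> mcarrier P \<Longrightarrow> act w unit = w" by blast
qed

lemma proj_eq_iff:
  "w \<in> mcarrier P \<Longrightarrow> w' \<in> mcarrier P \<Longrightarrow> proj w = proj w' \<longleftrightarrow> (\<exists>h\<in>mcarrier H. w' = act w h)"
proof -
  have "\<forall>w\<in>mcarrier P. \<forall>w'\<in>mcarrier P. proj w = proj w' \<longleftrightarrow> (\<exists>h\<in>mcarrier H. w' = act w h)"
    using principal' by (elim conjE)
  then show "w \<in> mcarrier P \<Longrightarrow> w' \<in> mcarrier P \<Longrightarrow> proj w = proj w' \<longleftrightarrow> (\<exists>h\<in>mcarrier H. w' = act w h)"
    by (elim ballE) auto
qed

lemma proj_act: "w \<in> mcarrier P \<Longrightarrow> h \<in> mcarrier H \<Longrightarrow> proj (act w h) = proj w"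
  using proj_eq_iff[OF _ act_in] by metis

text \<open>Serves to move tangent vectors of H to the unit, where they become elements of the Lie
  algebra.\<close>

lemma left_mult_smooth:
  assumes "g \<in> mcarrier H" "h \<in> mcarrier H"
  shows "smooth_map_at H H (\<lambda>x. g \<otimes>\<^bsub>Grp \<xi>\<^esub> x) h"
proof -
  have a: "smooth_map_at H (prod_atlas H H) (\<lambda>k. (g, k)) h"
    by (rule smooth_map_at_Pair[OF H_atlas H_atlas smooth_map_at_const[OF assms(2,1)]
          smooth_map_at_id[OF H_atlas assms(2)]])
  have b: "smooth_map_at (prod_atlas H H) H (\<lambda>(x, y). x \<otimes>\<^bsub>Grp \<xi>\<^esub> y) (g, h)"
  proof (rule msmooth_on_imp_smooth_map_at[OF smooth_atlas_prod[OF H_atlas H_atlas] H_atlas])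
    show "openin (mtop (prod_atlas H H)) (mcarrier H \<times> mcarrier H)"
      by (rule openin_prod_Times[OF H_atlas H_atlas openin_mcarrier[OF H_atlas] openin_mcarrier[OF H_atlas]])
    show "msmooth_on (prod_atlas H H) H (mcarrier H \<times> mcarrier H) (\<lambda>(x, y). x \<otimes>\<^bsub>Grp \<xi>\<^esub> y)"
      using H_lie unfolding lie_group_def by simp
  qed (use assms in simp)
  from smooth_map_at_compose[OF H_atlas smooth_atlas_prod[OF H_atlas H_atlas] a b]
  show ?thesis by simp
qed

lemma form_linear: "w \<in> mcarrier P \<Longrightarrow> linear (\<omega> w)"
proof -
  have "smooth_one_form P \<omega>" using cartan' by (elim conjE)
  then show "w \<in> mcarrier P \<Longrightarrow> linear (\<omega> w)" unfolding smooth_one_form_def by (elim conjE) simp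
qed

lemma form_bij: "w \<in> mcarrier P \<Longrightarrow> bij (\<omega> w)"
proof -
  have "\<forall>w\<in>mcarrier P. bij (\<omega> w)" using cartan' by (elim conjE)
  then show "w \<in> mcarrier P \<Longrightarrow> bij (\<omega> w)" by (rule bspec)
qed

lemma form_act:
  "w \<in> mcarrier P \<Longrightarrow> h \<in> mcarrier H \<Longrightarrow>
    \<omega> (act w h) (mderiv P P (\<lambda>u. act u h) w v) = Ad (Grp \<xi>) (GrpA \<xi>) (inv\<^bsub>Grp \<xi>\<^esub> h) (\<omega> w v)"
proof -
  have *: "\<forall>w\<in>mcarrier P. \<forall>h\<in>mcarrier H. \<forall>v.
      \<omega> (act w h) (mderiv P P (\<lambda>u. act u h) w v) = Ad (Grp \<xi>) (GrpA \<xi>) (inv\<^bsub>Grp \<xi>\<^esub> h) (\<omega> w v)"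
    using cartan' by (elim conjE)
  show "w \<in> mcarrier P \<Longrightarrow> h \<in> mcarrier H \<Longrightarrow>
    \<omega> (act w h) (mderiv P P (\<lambda>u. act u h) w v) = Ad (Grp \<xi>) (GrpA \<xi>) (inv\<^bsub>Grp \<xi>\<^esub> h) (\<omega> w v)"
    by (rule *[rule_format])
qed

lemma form_fundamental:
  "w \<in> mcarrier P \<Longrightarrow> \<omega> w (mderiv H P (act w) unit A) = incl A"
proof -
  have *: "\<forall>w\<in>mcarrier P. \<forall>A. \<omega> w (mderiv H P (act w) unit A) = incl A"
    using cartan' by (elim conjE)
  show "w \<in> mcarrier P \<Longrightarrow> \<omega> w (mderiv H P (act w) unit A) = incl A"
    by (rule *[rule_format])
qed

definition form_inv :: "'p \<Rightarrow> 'a \<Rightarrow> 'r" where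
  "form_inv w = inv_into UNIV (\<omega> w)"

lemma form_form_inv: "w \<in> mcarrier P \<Longrightarrow> \<omega> w (form_inv w a) = a"
  unfolding form_inv_def using form_bij by (simp add: bij_is_surj surj_f_inv_f)

lemma form_inv_form: "w \<in> mcarrier P \<Longrightarrow> form_inv w (\<omega> w v) = v"
  unfolding form_inv_def using form_bij by (simp add: bij_is_inj)

lemma form_inv_linear: "w \<in> mcarrier P \<Longrightarrow> linear (form_inv w)"
  unfolding form_inv_def
  by (rule bounded_linear.linear[OF bounded_linear_inv_into[OF form_linear form_bij]])

lemma dproj_linear: "w \<in> mcarrier P \<Longrightarrow> linear (dproj w)"
  by (rule linear_mderiv[OF proj_smooth])

section \<open>Local triviality and vertical vectors\<close>

definition trivialized :: "'n set \<Rightarrow> ('p \<Rightarrow> 'n \<times> 'g) \<Rightarrow> ('n \<times> 'g \<Rightarrow> 'p) \<Rightarrow> bool" where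
  "trivialized U \<psi> \<psi>' \<longleftrightarrow> openin (mtop N) U \<and>
     (\<forall>w\<in>over \<xi> U. smooth_map_at P (prod_atlas N H) \<psi> w \<and> \<psi> w \<in> U \<times> mcarrier H \<and> \<psi>' (\<psi> w) = w \<and>
        fst (\<psi> w) = proj w \<and> (\<forall>h\<in>mcarrier H. snd (\<psi> (act w h)) = snd (\<psi> w) \<otimes>\<^bsub>Grp \<xi>\<^esub> h)) \<and>
     (\<forall>q\<in>U \<times> mcarrier H. smooth_map_at (prod_atlas N H) P \<psi>' q \<and> \<psi>' q \<in> over \<xi> U \<and> \<psi> (\<psi>' q) = q)"

lemma trivializedD:
  assumes "trivialized U \<psi> \<psi>'"
  shows "openin (mtop N) U"
    "w \<in> over \<xi> U \<Longrightarrow> smooth_map_at P (prod_atlas N H) \<psi> w"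
    "w \<in> over \<xi> U \<Longrightarrow> \<psi> w \<in> U \<times> mcarrier H"
    "w \<in> over \<xi> U \<Longrightarrow> \<psi>' (\<psi> w) = w"
    "w \<in> over \<xi> U \<Longrightarrow> fst (\<psi> w) = proj w"
    "w \<in> over \<xi> U \<Longrightarrow> h \<in> mcarrier H \<Longrightarrow> snd (\<psi> (act w h)) = snd (\<psi> w) \<otimes>\<^bsub>Grp \<xi>\<^esub> h"
    "q \<in> U \<times> mcarrier H \<Longrightarrow> smooth_map_at (prod_atlas N H) P \<psi>' q"
    "q \<in> U \<times> mcarrier H \<Longrightarrow> \<psi>' q \<in> over \<xi> U"
    "q \<in> U \<times> mcarrier H \<Longrightarrow> \<psi> (\<psi>' q) = q"
  using assms unfolding trivialized_def by blast+

lemma trivialization: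
  assumes "x \<in> mcarrier N"
  shows "\<exists>U \<psi> \<psi>'. trivialized U \<psi> \<psi>' \<and> x \<in> U"
proof -
  have "\<forall>x\<in>mcarrier N. \<exists>U \<psi>. openin (mtop N) U \<and> x \<in> U \<and>
      mdiffeo P (prod_atlas N H) (over \<xi> U) (U \<times> mcarrier H) \<psi> \<and>
      (\<forall>w\<in>over \<xi> U. fst (\<psi> w) = proj w \<and>
         (\<forall>h\<in>mcarrier H. snd (\<psi> (act w h)) = snd (\<psi> w) \<otimes>\<^bsub>Grp \<xi>\<^esub> h))"
    using principal' by (elim conjE)
  from bspec[OF this assms] obtain U \<psi> where U: "openin (mtop N) U" "x \<in> U"
    and \<psi>: "mdiffeo P (prod_atlas N H) (over \<xi> U) (U \<times> mcarrier H) \<psi>"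
    "\<forall>w\<in>over \<xi> U. fst (\<psi> w) = proj w \<and>
         (\<forall>h\<in>mcarrier H. snd (\<psi> (act w h)) = snd (\<psi> w) \<otimes>\<^bsub>Grp \<xi>\<^esub> h)"
    by (elim exE conjE)
  have bij: "bij_betw \<psi> (over \<xi> U) (U \<times> mcarrier H)"
    and s: "msmooth_on P (prod_atlas N H) (over \<xi> U) \<psi>"
    and s': "msmooth_on (prod_atlas N H) P (U \<times> mcarrier H) (inv_into (over \<xi> U) \<psi>)"
    using \<psi>(1) unfolding mdiffeo_def by blast+
  note NH = smooth_atlas_prod[OF N_atlas H_atlas]
  have "trivialized U \<psi> (inv_into (over \<xi> U) \<psi>)"
    unfolding trivialized_def
  proof (intro conjI ballI U(1))
    fix w assume w: "w \<in> over \<xi> U"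
    show "smooth_map_at P (prod_atlas N H) \<psi> w"
      by (rule msmooth_on_imp_smooth_map_at[OF P_atlas NH over_open[OF U(1)] w s])
    show "\<psi> w \<in> U \<times> mcarrier H"
      using bij_betwE[OF bij] w by blast
    show "inv_into (over \<xi> U) \<psi> (\<psi> w) = w"
      by (rule inv_into_f_f[OF bij_betw_imp_inj_on[OF bij] w])
    show "fst (\<psi> w) = proj w"
      using \<psi>(2) w by blast
    show "snd (\<psi> (act w h)) = snd (\<psi> w) \<otimes>\<^bsub>Grp \<xi>\<^esub> h" if "h \<in> mcarrier H" for h
      using bspec[OF \<psi>(2) w] that by blast
  next
    fix q assume q: "q \<in> U \<times> mcarrier H"
    show "smooth_map_at (prod_atlas N H) P (inv_into (over \<xi> U) \<psi>) q"
      by (rule msmooth_on_imp_smooth_map_at[OF NH P_atlas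
            openin_prod_Times[OF N_atlas H_atlas U(1) openin_mcarrier[OF H_atlas]] q s'])
    have q': "q \<in> \<psi> ` over \<xi> U" using bij q unfolding bij_betw_def by simp
    show "inv_into (over \<xi> U) \<psi> q \<in> over \<xi> U" by (rule inv_into_into[OF q'])
    show "\<psi> (inv_into (over \<xi> U) \<psi> q) = q" by (rule f_inv_into_f[OF q'])
  qed
  with U(2) show ?thesis by blast
qed

lemma overI: "w \<in> mcarrier P \<Longrightarrow> proj w \<in> W \<Longrightarrow> w \<in> over \<xi> W"
  by (simp add: over_def)

lemma overD: "w \<in> over \<xi> W \<Longrightarrow> w \<in> mcarrier P" "w \<in> over \<xi> W \<Longrightarrow> proj w \<in> W"
  by (simp_all add: over_def)

text \<open>In a trivialization the H-coordinate is frozen at that of \<open>w\<close>, so the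
  section passes through the prescribed point.\<close>

lemma local_section:
  assumes w: "w \<in> mcarrier P"
  shows "\<exists>U \<sigma>. openin (mtop N) U \<and> proj w \<in> U \<and> \<sigma> (proj w) = w \<and>
    (\<forall>x\<in>U. smooth_map_at N P \<sigma> x \<and> proj (\<sigma> x) = x)"
proof -
  obtain U \<psi> \<psi>' where t: "trivialized U \<psi> \<psi>'" and wU': "proj w \<in> U"
    using trivialization[OF proj_in[OF w]] by blast
  note \<psi> = trivializedD[OF t]
  have wU: "w \<in> over \<xi> U" by (rule overI[OF w wU'])
  define g where "g = snd (\<psi> w)"
  have g: "g \<in> mcarrier H" using \<psi>(3)[OF wU] by (auto simp: g_def)
  have \<psi>w: "\<psi> w = (proj w, g)" using \<psi>(5)[OF wU] by (simp add: g_def prod_eq_iff)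
  have "smooth_map_at N P (\<lambda>x. \<psi>' (x, g)) x \<and> proj (\<psi>' (x, g)) = x" if x: "x \<in> U" for x
  proof
    have xN: "x \<in> mcarrier N" and xg: "(x, g) \<in> U \<times> mcarrier H"
      using \<psi>(1) x g openin_atlas[OF N_atlas] by auto
    have a: "smooth_map_at N (prod_atlas N H) (\<lambda>x. (x, g)) x"
      by (rule smooth_map_at_Pair[OF N_atlas H_atlas smooth_map_at_id[OF N_atlas xN] smooth_map_at_const[OF xN g]])
    show "smooth_map_at N P (\<lambda>x. \<psi>' (x, g)) x"
      by (rule smooth_map_at_compose[OF N_atlas smooth_atlas_prod[OF N_atlas H_atlas] a]) (rule \<psi>(7)[OF xg])
    show "proj (\<psi>' (x, g)) = x"
      using \<psi>(5)[OF \<psi>(8)[OF xg]] \<psi>(9)[OF xg] by simp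
  qed
  moreover have "\<psi>' (proj w, g) = w" using \<psi>(4)[OF wU] \<psi>w by simp
  ultimately show ?thesis
    using \<psi>(1) wU' by (intro exI[of _ U] exI[of _ "\<lambda>x. \<psi>' (x, g)"]) simp
qed

text \<open>A section through \<open>w\<close> differentiates to a right inverse.\<close>

lemma dproj_surj:
  assumes w: "w \<in> mcarrier P"
  shows "\<exists>u. dproj w u = v"
proof -
  obtain U \<sigma> where U: "openin (mtop N) U" "proj w \<in> U" and \<sigma>: "\<sigma> (proj w) = w"
    and \<sigma>': "\<forall>x\<in>U. smooth_map_at N P \<sigma> x \<and> proj (\<sigma> x) = x"
    using local_section[OF w] by (elim exE conjE)
  have s: "smooth_map_at N P \<sigma> (proj w)" and ps: "\<And>x. x \<in> U \<Longrightarrow> proj (\<sigma> x) = x"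
    using \<sigma>' U(2) by simp_all
  have "mderiv P N proj (\<sigma> (proj w)) (mderiv N P \<sigma> (proj w) v) = v"
    by (rule mderiv_left_inverse[OF N_atlas P_atlas s _ U ps])
      (simp_all add: \<sigma> proj_smooth[OF w])
  then show ?thesis unfolding \<sigma> by blast
qed

lemma dproj_fundamental:
  assumes w: "w \<in> mcarrier P"
  shows "dproj w (mderiv H P (act w) unit A) = 0"
proof -
  have s: "smooth_map_at P N proj (act w unit)"
    by (rule proj_smooth[OF act_in[OF w unit_H]])
  have "dproj w (mderiv H P (act w) unit A) = mderiv H N (\<lambda>h. proj (act w h)) unit A"
    using mderiv_compose[OF H_atlas P_atlas orbit_map_smooth[OF w unit_H] s] act_unit[OF w] by simp
  also have "\<dots> = mderiv H N (\<lambda>h. proj w) unit A"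
    using mderiv_cong[OF H_atlas openin_mcarrier[OF H_atlas] unit_H, of "\<lambda>h. proj (act w h)" "\<lambda>h. proj w" N]
      proj_act[OF w] by simp
  finally show ?thesis by (simp add: mderiv_const)
qed

text \<open>Fundamental vectors are vertical because orbits lie in fibres. Conversely, in a
  trivialization a vertical vector is determined by its H-component, a tangent vector of H at
  \<open>g\<close>. Left translation moves that to an element A of the Lie algebra, and the
  fundamental vector of A has the same components as the given vector.\<close>

lemma dproj_eq_0_iff:
  assumes w: "w \<in> mcarrier P"
  shows "dproj w v = 0 \<longleftrightarrow> \<omega> w v \<in> range incl"
proof
  assume "\<omega> w v \<in> range incl"
  then obtain A where "\<omega> w v = \<omega> w (mderiv H P (act w) unit A)"
    using form_fundamental[OF w] by auto
  then have v: "v = mderiv H P (act w) unit A"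
    using form_inv_form[OF w] by metis
  show "dproj w v = 0" unfolding v by (rule dproj_fundamental[OF w])
next
  assume 0: "dproj w v = 0"
  let ?NH = "prod_atlas N H"
  note NH = smooth_atlas_prod[OF N_atlas H_atlas]
  obtain U \<psi> \<psi>' where t: "trivialized U \<psi> \<psi>'" and wU': "proj w \<in> U"
    using trivialization[OF proj_in[OF w]] by blast
  note \<psi> = trivializedD[OF t]
  have wU: "w \<in> over \<xi> U" by (rule overI[OF w wU'])
  note oU = over_open[OF \<psi>(1)]
  define g where "g = snd (\<psi> w)"
  have g: "g \<in> mcarrier H" using \<psi>(3)[OF wU] by (auto simp: g_def)
  let ?g' = "inv\<^bsub>Grp \<xi>\<^esub> g"
  have g': "?g' \<in> mcarrier H" by (rule inv_H[OF g])
  have \<psi>wNH: "\<psi> w \<in> mcarrier ?NH" by (rule smooth_map_at_carrier(2)[OF \<psi>(2)[OF wU]])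
  note fs = smooth_map_at_fst_snd[OF N_atlas H_atlas \<psi>wNH]
  let ?d\<psi> = "mderiv P ?NH \<psi> w"
  have fst_d\<psi>: "mderiv ?NH N fst (\<psi> w) (?d\<psi> u) = dproj w u" for u
    using mderiv_compose[OF P_atlas NH \<psi>(2)[OF wU] fs(1), of u]
      mderiv_cong[OF P_atlas oU wU, of "\<lambda>w. fst (\<psi> w)" proj N] \<psi>(5) by simp
  define a where "a = mderiv ?NH H snd (\<psi> w) (?d\<psi> v)"
  let ?L = "\<lambda>g x. g \<otimes>\<^bsub>Grp \<xi>\<^esub> x"
  \<comment> \<open>By equivariance of the trivialization, the H-component of a fundamental vector
    is the image of the Lie algebra element under the differential of left translation by
    \<open>g\<close>; this inverts it.\<close>
  define A where "A = mderiv H H (?L ?g') g a"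
  have g'g: "?g' \<otimes>\<^bsub>Grp \<xi>\<^esub> g = unit"
    by (rule Group.group.l_inv[OF G_group H_carrier[OF g]])
  have gg': "g \<otimes>\<^bsub>Grp \<xi>\<^esub> (?g' \<otimes>\<^bsub>Grp \<xi>\<^esub> x) = x" if "x \<in> mcarrier H" for x
    using H_carrier[OF g] H_carrier[OF that] H_carrier[OF g'] G_group
    by (metis Group.group.r_inv Group.group.is_monoid monoid.m_assoc monoid.l_one)
  have LA: "mderiv H H (?L g) unit A = a"
    unfolding A_def
    using mderiv_left_inverse[OF H_atlas H_atlas left_mult_smooth[OF g' g], of "?L g", OF _ openin_mcarrier[OF H_atlas] g gg']
      left_mult_smooth[OF g unit_H] by (simp add: g'g)
  define v' where "v' = mderiv H P (act w) unit A"
  note so = orbit_map_smooth[OF w unit_H]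
  have proj_v': "dproj w v' = 0" unfolding v'_def by (rule dproj_fundamental[OF w])
  have snd_v': "mderiv ?NH H snd (\<psi> w) (?d\<psi> v') = a"
  proof -
    have s1: "smooth_map_at P H (\<lambda>u. snd (\<psi> u)) w"
      by (rule smooth_map_at_compose[OF P_atlas NH \<psi>(2)[OF wU] fs(2)])
    have s1': "smooth_map_at P H (\<lambda>u. snd (\<psi> u)) (act w unit)"
      using s1 act_unit[OF w] by simp
    have "mderiv ?NH H snd (\<psi> w) (?d\<psi> v') = mderiv P H (\<lambda>u. snd (\<psi> u)) w v'"
      using mderiv_compose[OF P_atlas NH \<psi>(2)[OF wU] fs(2)] by simp
    also have "\<dots> = mderiv H H (\<lambda>h. snd (\<psi> (act w h))) unit A"
      using mderiv_compose[OF H_atlas P_atlas so s1'] act_unit[OF w] by (simp add: v'_def)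
    also have "\<dots> = mderiv H H (?L g) unit A"
      using mderiv_cong[OF H_atlas openin_mcarrier[OF H_atlas] unit_H, of "\<lambda>h. snd (\<psi> (act w h))" "?L g" H]
        \<psi>(6)[OF wU] by (simp add: g_def)
    finally show ?thesis using LA by simp
  qed
  have lin: "linear ?d\<psi>" by (rule linear_mderiv[OF \<psi>(2)[OF wU]])
  have "?d\<psi> (v - v') = 0"
  proof (rule mderiv_fst_snd_eq_0[OF N_atlas H_atlas \<psi>wNH])
    show "mderiv ?NH N fst (\<psi> w) (?d\<psi> (v - v')) = 0"
      using linear_diff[OF dproj_linear[OF w]] by (simp add: fst_d\<psi> 0 proj_v')
    show "mderiv ?NH H snd (\<psi> w) (?d\<psi> (v - v')) = 0"
      by (simp add: linear_diff[OF lin] linear_diff[OF linear_mderiv[OF fs(2)]] snd_v' a_def)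
  qed
  moreover have inv: "mderiv ?NH P \<psi>' (\<psi> w) (?d\<psi> u) = u" for u
    by (rule mderiv_left_inverse[OF P_atlas NH \<psi>(2)[OF wU] \<psi>(7)[OF \<psi>(3)[OF wU]] oU wU \<psi>(4)])
  ultimately have "v - v' = 0"
    using linear_0[OF linear_mderiv[OF \<psi>(7)[OF \<psi>(3)[OF wU]]]] by metis
  then show "\<omega> w v \<in> range incl"
    using form_fundamental[OF w, of A] by (simp add: v'_def)
qed

section \<open>Horizontal lifts and the covariant derivative at a point of the fibre\<close>

definition hlift :: "'p \<Rightarrow> 'q \<Rightarrow> 'r" where
  "hlift w v = (THE u. dproj w u = v \<and> \<omega> w u \<in> V)"

text \<open>The difference is vertical, so its form value lies in both summands of the reductive
  splitting.\<close>

lemma hlift_unique: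
  assumes w: "w \<in> mcarrier P" and "dproj w u = dproj w u'" "\<omega> w u \<in> V" "\<omega> w u' \<in> V"
  shows "u = u'"
proof -
  have "dproj w (u - u') = 0" using assms(2) by (simp add: linear_diff[OF dproj_linear[OF w]])
  then have "\<omega> w (u - u') \<in> range incl" using dproj_eq_0_iff[OF w] by blast
  moreover have "\<omega> w (u - u') \<in> V"
    using assms(3,4) V_subspace by (simp add: linear_diff[OF form_linear[OF w]] subspace_diff)
  ultimately have "\<omega> w (u - u') = 0" using h_Int_V by blast
  then have "\<omega> w u = \<omega> w u'" by (simp add: linear_diff[OF form_linear[OF w]])
  then show ?thesis using form_inv_form[OF w] by metis
qed

text \<open>Any lift becomes horizontal after removal of its vertical part, the vector on which the
  form takes the h-component.\<close>

lemma hlift_ex: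
  assumes w: "w \<in> mcarrier P"
  shows "\<exists>u. dproj w u = v \<and> \<omega> w u \<in> V"
proof -
  obtain u0 where u0: "dproj w u0 = v" using dproj_surj[OF w] by blast
  obtain a b where ab: "a \<in> range incl" "b \<in> V" "\<omega> w u0 = a + b" using h_plus_V by blast
  have "dproj w (form_inv w a) = 0"
    using dproj_eq_0_iff[OF w] ab(1) form_form_inv[OF w] by simp
  moreover have "u0 = form_inv w a + form_inv w b"
    using form_inv_form[OF w, of u0] ab(3) linear_add[OF form_inv_linear[OF w]] by simp
  ultimately have "dproj w (form_inv w b) = v"
    using u0 linear_add[OF dproj_linear[OF w]] by simp
  then show ?thesis using form_form_inv[OF w] ab(2) by auto
qed

lemma hlift_eqI:
  assumes "w \<in> mcarrier P" "dproj w u = v" "\<omega> w u \<in> V"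
  shows "hlift w v = u"
  unfolding hlift_def
proof (rule the_equality)
  show "dproj w u = v \<and> \<omega> w u \<in> V" using assms(2,3) by blast
  show "u' = u" if "dproj w u' = v \<and> \<omega> w u' \<in> V" for u'
    using hlift_unique[OF assms(1), of u' u] that assms(2,3) by simp
qed

lemma hlift:
  assumes "w \<in> mcarrier P"
  shows "dproj w (hlift w v) = v" "\<omega> w (hlift w v) \<in> V"
proof -
  obtain u where "dproj w u = v" "\<omega> w u \<in> V" using hlift_ex[OF assms] by blast
  moreover from this have "hlift w v = u" by (rule hlift_eqI[OF assms])
  ultimately show "dproj w (hlift w v) = v" "\<omega> w (hlift w v) \<in> V" by simp_all
qed

lemma hlift_linear:
  assumes w: "w \<in> mcarrier P"
  shows "linear (hlift w)"
proof (rule linearI)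
  show "hlift w (u + v) = hlift w u + hlift w v" for u v
    using V_subspace
    by (intro hlift_eqI[OF w])
      (simp_all add: linear_add[OF dproj_linear[OF w]] linear_add[OF form_linear[OF w]] hlift[OF w] subspace_add)
  show "hlift w (c *\<^sub>R v) = c *\<^sub>R hlift w v" for c v
    using V_subspace
    by (intro hlift_eqI[OF w])
      (simp_all add: linear_scale[OF dproj_linear[OF w]] linear_scale[OF form_linear[OF w]] hlift[OF w] subspace_scale)
qed

text \<open>A vector field is encoded by the \<open>V\<close>-valued equivariant function on the total space.\<close>

definition equivariant_rep :: "('n \<Rightarrow> 'q) \<Rightarrow> 'p \<Rightarrow> 'a" where
  "equivariant_rep Y w = \<omega> w (hlift w (Y (proj w)))"

definition nabla_at :: "'p \<Rightarrow> ('n \<Rightarrow> 'q) \<Rightarrow> ('n \<Rightarrow> 'q) \<Rightarrow> 'q" where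
  "nabla_at w X Y = dproj w (form_inv w
     (mderiv P model_atlas (equivariant_rep Y) w (hlift w (X (proj w)))))"

text \<open>The choice in the fibre is harmless for fields \<open>Y\<close> with smooth
  \<open>equivariant_rep Y\<close>, by \<open>nabla_eq\<close>. For an arbitrary function
  \<open>Y\<close> the value carries no meaning.\<close>

definition nabla :: "('n \<Rightarrow> 'q) \<Rightarrow> ('n \<Rightarrow> 'q) \<Rightarrow> 'n \<Rightarrow> 'q" where
  "nabla X Y x = nabla_at (SOME w. w \<in> mcarrier P \<and> proj w = x) X Y"

section \<open>Behaviour of lift and derivative under symmetries\<close>

text \<open>
  The two instances are the right translations of the structure group (\<open>\<phi>\<close> the identity, \<open>L\<close> an adjoint
  map) and the isomorphisms of Cartan geometries
  (\<open>L\<close> the identity).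
\<close>

definition local_symmetry :: "'p set \<Rightarrow> ('p \<Rightarrow> 'p) \<Rightarrow> ('n \<Rightarrow> 'n) \<Rightarrow> ('a \<Rightarrow> 'a) \<Rightarrow> bool" where
  "local_symmetry Q \<Phi> \<phi> L \<longleftrightarrow> openin (mtop P) Q \<and> linear L \<and> L ` V \<subseteq> V \<and>
     (\<forall>u\<in>Q. smooth_map_at P P \<Phi> u \<and> smooth_map_at N N \<phi> (proj u) \<and> proj (\<Phi> u) = \<phi> (proj u) \<and>
        (\<forall>v. \<omega> (\<Phi> u) (mderiv P P \<Phi> u v) = L (\<omega> u v)))"

context
  fixes Q \<Phi> \<phi> L
  assumes symm: "local_symmetry Q \<Phi> \<phi> L"
begin

lemma symmD:
  "openin (mtop P) Q" "linear L" "L ` V \<subseteq> V"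
  "u \<in> Q \<Longrightarrow> smooth_map_at P P \<Phi> u" "u \<in> Q \<Longrightarrow> smooth_map_at N N \<phi> (proj u)"
  "u \<in> Q \<Longrightarrow> proj (\<Phi> u) = \<phi> (proj u)"
  "u \<in> Q \<Longrightarrow> \<omega> (\<Phi> u) (mderiv P P \<Phi> u v) = L (\<omega> u v)"
  using symm unfolding local_symmetry_def by simp_all

lemma symm_in: "u \<in> Q \<Longrightarrow> u \<in> mcarrier P" "u \<in> Q \<Longrightarrow> \<Phi> u \<in> mcarrier P"
  by (rule smooth_map_at_carrier[OF symmD(4)], assumption)+

lemma dproj_symm:
  assumes u: "u \<in> Q"
  shows "dproj (\<Phi> u) (mderiv P P \<Phi> u v) = mderiv N N \<phi> (proj u) (dproj u v)"
proof -
  have "dproj (\<Phi> u) (mderiv P P \<Phi> u v) = mderiv P N (\<lambda>u. proj (\<Phi> u)) u v"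
    using mderiv_compose[OF P_atlas P_atlas symmD(4)[OF u] proj_smooth[OF symm_in(2)[OF u]]] by simp
  also have "\<dots> = mderiv P N (\<lambda>u. \<phi> (proj u)) u v"
    using mderiv_cong[OF P_atlas symmD(1) u, of "\<lambda>u. proj (\<Phi> u)" "\<lambda>u. \<phi> (proj u)" N] symmD(6) by simp
  also have "\<dots> = mderiv N N \<phi> (proj u) (dproj u v)"
    by (rule mderiv_compose[OF P_atlas N_atlas proj_smooth[OF symm_in(1)[OF u]] symmD(5)[OF u]])
  finally show ?thesis .
qed

text \<open>The image of a horizontal lift has the right projection, and it is horizontal since
  \<open>L\<close> preserves \<open>V\<close>; uniqueness of lifts does the rest.\<close>

lemma hlift_symm:
  assumes u: "u \<in> Q"
  shows "hlift (\<Phi> u) (mderiv N N \<phi> (proj u) v) = mderiv P P \<Phi> u (hlift u v)"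
  using symmD(3) hlift[OF symm_in(1)[OF u]]
  by (intro hlift_eqI[OF symm_in(2)[OF u]]) (auto simp: dproj_symm[OF u] symmD(7)[OF u])

lemma equivariant_rep_symm:
  assumes u: "u \<in> Q" and Y: "Y' (\<phi> (proj u)) = mderiv N N \<phi> (proj u) (Y (proj u))"
  shows "equivariant_rep Y' (\<Phi> u) = L (equivariant_rep Y u)"
  unfolding equivariant_rep_def by (simp add: symmD(6)[OF u] Y hlift_symm[OF u] symmD(7)[OF u])

lemma form_inv_symm:
  assumes u: "u \<in> Q"
  shows "form_inv (\<Phi> u) (L a) = mderiv P P \<Phi> u (form_inv u a)"
  using symmD(7)[OF u, of "form_inv u a"] form_form_inv[OF symm_in(1)[OF u], of a]
    form_inv_form[OF symm_in(2)[OF u], of "mderiv P P \<Phi> u (form_inv u a)"] by simp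

text \<open>The constant linear map \<open>L\<close> comes out of the derivative and is then
  absorbed by \<open>form_inv_symm\<close>. The fields \<open>X\<close> and \<open>X'\<close> are
  related at one point but \<open>Y\<close> and \<open>Y'\<close> on all of \<open>Q\<close>,
  because only the second argument is differentiated.\<close>

lemma nabla_at_symm:
  assumes w: "w \<in> Q"
    and X: "X' (\<phi> (proj w)) = mderiv N N \<phi> (proj w) (X (proj w))"
    and Y: "\<And>u. u \<in> Q \<Longrightarrow> Y' (\<phi> (proj u)) = mderiv N N \<phi> (proj u) (Y (proj u))"
    and sY: "smooth_map_at P model_atlas (equivariant_rep Y) w"
    and sY': "smooth_map_at P model_atlas (equivariant_rep Y') (\<Phi> w)"
  shows "nabla_at (\<Phi> w) X' Y' = mderiv N N \<phi> (proj w) (nabla_at w X Y)"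
proof -
  let ?D = "mderiv P model_atlas"
  have d: "?D (equivariant_rep Y') (\<Phi> w) (mderiv P P \<Phi> w v) = L (?D (equivariant_rep Y) w v)" for v
  proof -
    have "?D (equivariant_rep Y') (\<Phi> w) (mderiv P P \<Phi> w v) = ?D (\<lambda>u. equivariant_rep Y' (\<Phi> u)) w v"
      using mderiv_compose[OF P_atlas P_atlas symmD(4)[OF w] sY'] by simp
    also have "\<dots> = ?D (\<lambda>u. L (equivariant_rep Y u)) w v"
      using mderiv_cong[OF P_atlas symmD(1) w, of "\<lambda>u. equivariant_rep Y' (\<Phi> u)" "\<lambda>u. L (equivariant_rep Y u)" model_atlas]
        equivariant_rep_symm[of _ Y' Y, OF _ Y] by simp
    also have "\<dots> = L (?D (equivariant_rep Y) w v)"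
      using mderiv_compose[OF P_atlas smooth_atlas_model sY, of model_atlas L v] symmD(2)
      by (simp add: smooth_map_at_model_iff smooth_at_linear mderiv_linear)
    finally show ?thesis .
  qed
  show ?thesis
    unfolding nabla_at_def symmD(6)[OF w] X hlift_symm[OF w] d form_inv_symm[OF w] dproj_symm[OF w] ..
qed

end

end

section \<open>Smoothness in charts\<close>

lemma mderiv_model_add:
  assumes A: "smooth_atlas A" and f: "smooth_map_at A model_atlas f p" and g: "smooth_map_at A model_atlas g p"
  shows "mderiv A model_atlas (\<lambda>x. f x + g x) p v = mderiv A model_atlas f p v + mderiv A model_atlas g p v"
proof -
  let ?c = "chart_at A p"
  note c = chart_at[OF smooth_map_at_carrier(1)[OF f]]
  have m: "(UNIV, \<lambda>x. x) \<in> model_atlas" by (simp add: model_atlas_def)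
  have "(\<lambda>y. f (cinv ?c y)) differentiable (at (cmap ?c p))" "(\<lambda>y. g (cinv ?c y)) differentiable (at (cmap ?c p))"
    using smooth_at_differentiable[OF smooth_map_atD(2)[OF f c m]] smooth_at_differentiable[OF smooth_map_atD(2)[OF g c m]]
    by simp_all
  from frechet_derivative_at[OF has_derivative_add[OF this[THEN has_derivative_frechet]]]
  show ?thesis
    unfolding mderiv_def o_def by (simp add: fun_eq_iff)
qed

lemma mderiv_model_scaleR:
  fixes f :: "'a \<Rightarrow> real"
  assumes A: "smooth_atlas A" and f: "smooth_map_at A model_atlas f p" and g: "smooth_map_at A model_atlas g p"
  shows "mderiv A model_atlas (\<lambda>x. f x *\<^sub>R g x) p v =
    f p *\<^sub>R mderiv A model_atlas g p v + mderiv A model_atlas f p v *\<^sub>R g p"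
proof -
  let ?c = "chart_at A p"
  note c = chart_at[OF smooth_map_at_carrier(1)[OF f]]
  have m: "(UNIV, \<lambda>x. x) \<in> model_atlas" by (simp add: model_atlas_def)
  have "(\<lambda>y. f (cinv ?c y)) differentiable (at (cmap ?c p))" "(\<lambda>y. g (cinv ?c y)) differentiable (at (cmap ?c p))"
    using smooth_at_differentiable[OF smooth_map_atD(2)[OF f c m]] smooth_at_differentiable[OF smooth_map_atD(2)[OF g c m]]
    by simp_all
  from frechet_derivative_at[OF has_derivative_scaleR[OF this[THEN has_derivative_frechet]]]
  show ?thesis
    unfolding mderiv_def o_def by (simp add: fun_eq_iff cinv_cmap[OF A c])
qed

text \<open>A common scheme for sums and scalar multiples, with \<open>h\<close> the operation on
  pairs.\<close>

lemma smooth_map_at_model_compose_Pair: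
  assumes A: "smooth_atlas A" and f: "smooth_map_at A model_atlas f p" and g: "smooth_map_at A model_atlas g p"
    and h: "\<And>x. smooth_at h x"
  shows "smooth_map_at A model_atlas (\<lambda>x. h (f x, g x)) p"
proof (rule smooth_map_at_modelI)
  show p: "p \<in> mcarrier A" by (rule smooth_map_at_carrier[OF f])
  have m: "(UNIV, \<lambda>x. x) \<in> model_atlas" by (simp add: model_atlas_def)
  fix c assume c: "c \<in> A" "p \<in> cdom c"
  have "smooth_at (\<lambda>y. f (cinv c y)) (cmap c p)" "smooth_at (\<lambda>y. g (cinv c y)) (cmap c p)"
    using smooth_map_atD(2)[OF f c m] smooth_map_atD(2)[OF g c m] by simp_all
  from smooth_at_compose[OF smooth_at_Pair[OF this] h]
  show "smooth_at (\<lambda>y. h (f (cinv c y), g (cinv c y))) (cmap c p)" .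
qed

lemma smooth_map_at_model_add:
  fixes f g :: "'a \<Rightarrow> 'c::finite_dim_normed"
  assumes "smooth_atlas A" "smooth_map_at A model_atlas f p" "smooth_map_at A model_atlas g p"
  shows "smooth_map_at A model_atlas (\<lambda>x. f x + g x) p"
proof -
  have "smooth_at (\<lambda>z. fst z + snd z) z" for z :: "'c \<times> 'c"
    by (rule smooth_at_linear, rule linearI) (simp_all add: scaleR_add_right)
  from smooth_map_at_model_compose_Pair[OF assms this] show ?thesis by simp
qed

lemma smooth_map_at_model_scaleR:
  fixes f :: "'a \<Rightarrow> real" and g :: "'a \<Rightarrow> 'c::finite_dim_normed"
  assumes "smooth_atlas A" "smooth_map_at A model_atlas f p" "smooth_map_at A model_atlas g p"
  shows "smooth_map_at A model_atlas (\<lambda>x. f x *\<^sub>R g x) p"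
proof -
  have o: "open (UNIV :: (real \<times> 'c) set)" by simp
  have "smooth_on (UNIV :: (real \<times> 'c) set) (\<lambda>z. fst z *\<^sub>R snd z)"
  proof (rule smooth_on_family_apply[OF o, of "\<lambda>z v. fst z *\<^sub>R v" snd])
    show "linear (\<lambda>v. fst z *\<^sub>R v)" for z :: "real \<times> 'c"
      by (rule linearI) (simp_all add: scaleR_add_right)
    have l: "linear (\<lambda>z :: real \<times> 'c. fst z *\<^sub>R e)" for e :: 'c
      by (rule linearI) (simp_all add: scaleR_add_left)
    show "smooth_on (UNIV :: (real \<times> 'c) set) (\<lambda>z. fst z *\<^sub>R e)" for e :: 'c
      by (rule smooth_on_linear_comp[OF l o smooth_on_id[OF o]])
    show "smooth_on (UNIV :: (real \<times> 'c) set) snd"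
      by (rule smooth_on_linear_comp[OF bounded_linear.linear[OF bounded_linear_snd] o smooth_on_id[OF o]])
  qed
  then have "smooth_at (\<lambda>z. fst z *\<^sub>R snd z) z" for z :: "real \<times> 'c"
    unfolding smooth_on_iff_smooth_at[OF o] by (rule bspec) (rule UNIV_I)
  from smooth_map_at_model_compose_Pair[OF assms this] show ?thesis by simp
qed

lemma vector_fieldsD:
  "X \<in> vector_fields A W \<Longrightarrow> c \<in> A \<Longrightarrow>
    smooth_on (cmap c ` (W \<inter> cdom c)) (\<lambda>y. mderiv A model_atlas (cmap c) (cinv c y) (X (cinv c y)))"
  unfolding vector_fields_def by blast

lemma bij_linearI:
  assumes "linear f" "\<And>u. f u = 0 \<Longrightarrow> u = 0" "\<And>y. \<exists>u. f u = y"
  shows "bij f"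
proof (rule bijI)
  show "inj f" using assms(1,2) by (simp add: linear_injective_0)
  show "surj f" using assms(3) by (metis surjI)
qed

section \<open>Projection to the Lie algebra of H along V\<close>

context reductive_geometry
begin

lemma incl_linear: "linear incl" and incl_inj: "inj incl"
proof -
  have "manifold (GrpA \<xi>)" using lie_group_G unfolding lie_group_def by blast
  then have G: "smooth_atlas (GrpA \<xi>)" by (rule manifold_smooth_atlas)
  have m: "msmooth_on H (GrpA \<xi>) (mcarrier H) (\<lambda>x. x)"
    and inj: "\<forall>x\<in>mcarrier H. inj (mderiv H (GrpA \<xi>) (\<lambda>x. x) x)"
    using closed_H unfolding closed_lie_subgroup_def by blast+
  show "linear incl" unfolding lie_incl_def
    by (rule linear_mderiv[OF msmooth_on_imp_smooth_map_at[OF H_atlas G openin_mcarrier[OF H_atlas] unit_H m]])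
  show "inj incl" unfolding lie_incl_def by (rule bspec[OF inj unit_H])
qed

text \<open>
  The projection to the Lie algebra of the structure group along \<open>V\<close>; composed with the Cartan form
  it is a principal connection.
\<close>

definition vert :: "'a \<Rightarrow> 'h" where
  "vert a = (THE A. a - incl A \<in> V)"

lemma vert_eqI: "a - incl A \<in> V \<Longrightarrow> vert a = A"
  unfolding vert_def
proof (rule the_equality)
  fix A' assume "a - incl A \<in> V" "a - incl A' \<in> V"
  then have "(a - incl A) - (a - incl A') \<in> V" using V_subspace by (rule subspace_diff[rotated])
  then have "incl (A' - A) \<in> V" by (simp add: linear_diff[OF incl_linear])
  then have "incl (A' - A) = incl 0" using h_Int_V linear_0[OF incl_linear] by auto
  then show "A' = A" using injD[OF incl_inj] by fastforce
qed

lemma vert: "a - incl (vert a) \<in> V"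
proof -
  obtain A b where "a = incl A + b" "b \<in> V" using h_plus_V[of a] by blast
  then have "a - incl A \<in> V" by simp
  then show ?thesis using vert_eqI[of a A] by simp
qed

lemma vert_incl: "vert (incl A) = A"
  by (rule vert_eqI) (simp add: subspace_0[OF V_subspace])

lemma vert_eq_0_iff: "vert a = 0 \<longleftrightarrow> a \<in> V"
  using vert[of a] vert_eqI[of a 0] by (auto simp: linear_0[OF incl_linear])

lemma vert_linear: "linear vert"
proof (rule linearI)
  fix a b and r :: real
  have "(a - incl (vert a)) + (b - incl (vert b)) \<in> V" using vert V_subspace by (simp add: subspace_add)
  then show "vert (a + b) = vert a + vert b"
    by (intro vert_eqI) (simp add: linear_add[OF incl_linear] algebra_simps)
  have "r *\<^sub>R (a - incl (vert a)) \<in> V" using vert V_subspace by (simp add: subspace_scale)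
  then show "vert (r *\<^sub>R a) = r *\<^sub>R vert a"
    by (intro vert_eqI) (simp add: linear_scale[OF incl_linear] algebra_simps)
qed

section \<open>Coordinate expressions over a chart of the base and a chart of the total
  space\<close>

context
  fixes W c d
  assumes W: "openin (mtop N) W" and c: "c \<in> N" and d: "d \<in> P"
begin

definition "dom_loc = cmap d ` (over \<xi> (W \<inter> cdom c) \<inter> cdom d)"
definition "pt z = cinv d z"
definition "proj_loc z = cmap c (proj (pt z))"
text \<open>\<open>from_loc\<close> and \<open>to_loc\<close> convert between coordinates in the
  fixed chart \<open>d\<close> and those in the chart chosen at the point;
  \<open>to_base_loc\<close> passes to the fixed chart \<open>c\<close> on the base. Irregular
  choices of charts cancel in the combinations used below.\<close>

definition "from_loc z = mderiv model_atlas P (cinv d) z"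
definition "to_loc z = mderiv P model_atlas (cmap d) (pt z)"
definition "to_base_loc z = mderiv N model_atlas (cmap c) (proj (pt z))"
definition "form_loc z u = \<omega> (pt z) (from_loc z u)"

lemma dom_loc_open: "open dom_loc"
  unfolding dom_loc_def
  by (rule open_image_chart[OF P_atlas over_open[OF openin_Int[OF W openin_cdom[OF N_atlas c]]] d])

lemma dom_locD:
  assumes "z \<in> dom_loc"
  shows "pt z \<in> cdom d" "cmap d (pt z) = z" "pt z \<in> mcarrier P" "proj (pt z) \<in> W" "proj (pt z) \<in> cdom c"
    "z \<in> cmap d ` cdom d" "pt z \<in> over \<xi> W" "proj (pt z) \<in> mcarrier N"
proof -
  obtain w where w: "w \<in> over \<xi> (W \<inter> cdom c)" "w \<in> cdom d" "z = cmap d w"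
    using assms unfolding dom_loc_def by blast
  have "pt z = w" unfolding pt_def w(3) by (rule cinv_cmap[OF P_atlas d w(2)])
  with w show "pt z \<in> cdom d" "cmap d (pt z) = z" "pt z \<in> mcarrier P" "proj (pt z) \<in> W" "proj (pt z) \<in> cdom c"
    "z \<in> cmap d ` cdom d" "pt z \<in> over \<xi> W" "proj (pt z) \<in> mcarrier N"
    using proj_in by (auto simp: over_def)
qed

lemma dom_locI: "w \<in> over \<xi> W \<Longrightarrow> w \<in> cdom d \<Longrightarrow> proj w \<in> cdom c \<Longrightarrow> cmap d w \<in> dom_loc"
  unfolding dom_loc_def over_def by blast

lemma to_from_loc: "z \<in> dom_loc \<Longrightarrow> to_loc z (from_loc z u) = u"
  using mderiv_cmap_cinv[OF P_atlas d dom_locD(1)[of z], of u] dom_locD(2)[of z]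
  by (simp add: to_loc_def from_loc_def)

lemma from_to_loc: "z \<in> dom_loc \<Longrightarrow> from_loc z (to_loc z u) = u"
  using mderiv_cinv_cmap[OF P_atlas d dom_locD(1)[of z], of u] dom_locD(2)[of z]
  by (simp add: to_loc_def from_loc_def)

lemma from_loc_linear: "z \<in> dom_loc \<Longrightarrow> linear (from_loc z)"
  unfolding from_loc_def by (rule linear_mderiv[OF smooth_map_at_cinv[OF P_atlas d dom_locD(6)]])

lemma to_base_loc_bij:
  assumes z: "z \<in> dom_loc"
  shows "to_base_loc z u = 0 \<Longrightarrow> u = 0" "\<exists>u. to_base_loc z u = y"
proof -
  let ?x = "proj (pt z)"
  let ?I = "mderiv model_atlas N (cinv c) (cmap c ?x)"
  note x = dom_locD(5)[OF z]
  have I: "?I (to_base_loc z u) = u" for u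
    unfolding to_base_loc_def by (rule mderiv_cinv_cmap[OF N_atlas c x])
  have lin: "linear ?I"
    by (rule linear_mderiv[OF smooth_map_at_cinv[OF N_atlas c]]) (use x in simp)
  show "to_base_loc z u = 0 \<Longrightarrow> u = 0" using I[of u] linear_0[OF lin] by simp
  show "\<exists>u. to_base_loc z u = y"
    unfolding to_base_loc_def using mderiv_cmap_cinv[OF N_atlas c x] by blast
qed

lemma proj_loc_smooth: "smooth_on dom_loc proj_loc"
  unfolding smooth_on_iff_smooth_at[OF dom_loc_open]
proof
  fix z assume z: "z \<in> dom_loc"
  show "smooth_at proj_loc z"
    using smooth_map_atD(2)[OF proj_smooth[OF dom_locD(3)[OF z]] d dom_locD(1)[OF z] c dom_locD(5)[OF z]]
    unfolding dom_locD(2)[OF z] by (simp add: proj_loc_def[abs_def] pt_def)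
qed

lemma proj_loc_deriv:
  assumes z: "z \<in> dom_loc"
  shows "frechet_derivative proj_loc (at z) u = to_base_loc z (dproj (pt z) (from_loc z u))"
  using mderiv_in_charts[OF P_atlas N_atlas proj_smooth[OF dom_locD(3)[OF z]] d dom_locD(1)[OF z] c
      dom_locD(5)[OF z], of "from_loc z u"] to_from_loc[OF z, of u]
  unfolding dom_locD(2)[OF z] by (simp add: proj_loc_def[abs_def] pt_def to_base_loc_def to_loc_def)

lemma form_loc_smooth: "smooth_on dom_loc (\<lambda>z. form_loc z u)"
proof -
  have "smooth_one_form P \<omega>" using cartan' by (elim conjE)
  then have "smooth_on (cmap d ` cdom d) (\<lambda>z. \<omega> (cinv d z) (mderiv model_atlas P (cinv d) z u))"
    using d unfolding smooth_one_form_def by simp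
  moreover have "dom_loc \<subseteq> cmap d ` cdom d" using dom_locD(6) by blast
  ultimately show ?thesis
    unfolding form_loc_def pt_def from_loc_def by (rule smooth_on_subset)
qed

lemma form_loc_linear: "z \<in> dom_loc \<Longrightarrow> linear (form_loc z)"
  using linear_compose[OF from_loc_linear form_linear[OF dom_locD(3)], of z z]
  by (simp add: form_loc_def[abs_def] o_def)

lemma form_loc_bij:
  assumes z: "z \<in> dom_loc"
  shows "bij (form_loc z)"
proof (rule bij_linearI[OF form_loc_linear[OF z]])
  note w = dom_locD(3)[OF z]
  show "u = 0" if "form_loc z u = 0" for u
  proof -
    have "from_loc z u = form_inv (pt z) 0"
      using that form_inv_form[OF w, of "from_loc z u"] by (simp add: form_loc_def)
    then have "from_loc z u = from_loc z 0"
      by (simp add: linear_0[OF form_inv_linear[OF w]] linear_0[OF from_loc_linear[OF z]])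
    then show ?thesis using to_from_loc[OF z] by metis
  qed
  show "\<exists>u. form_loc z u = y" for y
    using from_to_loc[OF z] form_form_inv[OF w, of y]
    by (intro exI[of _ "to_loc z (form_inv (pt z) y)"]) (simp add: form_loc_def)
qed

text \<open>The splitting of the tangent space into base part and vertical part, read in fixed
  charts. Horizontal vectors are those with second component 0, so a horizontal lift solves an
  equation with right-hand side (v, 0).\<close>

definition "split_loc z u = (frechet_derivative proj_loc (at z) u, vert (form_loc z u))"

lemma split_loc_linear:
  assumes z: "z \<in> dom_loc"
  shows "linear (split_loc z)"
proof -
  have 1: "linear (frechet_derivative proj_loc (at z))"
    by (rule linear_frechet_derivative[OF smooth_on_differentiable[OF proj_loc_smooth z]])
  show ?thesis
    by (rule linearI) (simp_all add: split_loc_def linear_add[OF 1] linear_scale[OF 1]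
        linear_add[OF form_loc_linear[OF z]] linear_scale[OF form_loc_linear[OF z]]
        linear_add[OF vert_linear] linear_scale[OF vert_linear])
qed

text \<open>A vector in the kernel is vertical and horizontal, hence 0. For surjectivity a
  horizontal lift supplies the first component and a vertical vector the second.\<close>

lemma split_loc_bij:
  assumes z: "z \<in> dom_loc"
  shows "bij (split_loc z)"
proof (rule bij_linearI[OF split_loc_linear[OF z]])
  note w = dom_locD(3)[OF z]
  show "u = 0" if "split_loc z u = 0" for u
  proof -
    have "to_base_loc z (dproj (pt z) (from_loc z u)) = 0" and v: "vert (form_loc z u) = 0"
      using that by (simp_all add: split_loc_def proj_loc_deriv[OF z] zero_prod_def)
    then have "dproj (pt z) (from_loc z u) = dproj (pt z) 0"
      using to_base_loc_bij(1)[OF z] by (simp add: linear_0[OF dproj_linear[OF w]])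
    moreover have "\<omega> (pt z) (from_loc z u) \<in> V"
      using v by (simp add: vert_eq_0_iff form_loc_def)
    ultimately have "from_loc z u = 0"
      by (rule hlift_unique[OF w]) (simp add: linear_0[OF form_linear[OF w]] subspace_0[OF V_subspace])
    then show ?thesis
      using to_from_loc[OF z, of u] to_from_loc[OF z, of 0] linear_0[OF from_loc_linear[OF z]] by simp
  qed
  show "\<exists>u. split_loc z u = y" for y
  proof -
    obtain v where v: "to_base_loc z v = fst y" using to_base_loc_bij(2)[OF z] by blast
    let ?u = "hlift (pt z) v + form_inv (pt z) (incl (snd y))"
    have "dproj (pt z) (form_inv (pt z) (incl (snd y))) = 0"
      using dproj_eq_0_iff[OF w] form_form_inv[OF w] by simp
    then have 1: "dproj (pt z) ?u = v"
      by (simp add: linear_add[OF dproj_linear[OF w]] hlift(1)[OF w])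
    have "vert (\<omega> (pt z) (hlift (pt z) v)) = 0"
      using hlift(2)[OF w] by (simp add: vert_eq_0_iff)
    then have 2: "vert (\<omega> (pt z) ?u) = snd y"
      by (simp add: linear_add[OF form_linear[OF w]] linear_add[OF vert_linear] form_form_inv[OF w] vert_incl)
    have "split_loc z (to_loc z ?u) = y"
      using 1 2 v by (simp add: split_loc_def proj_loc_deriv[OF z] from_to_loc[OF z] form_loc_def prod_eq_iff)
    then show ?thesis by blast
  qed
qed

lemma split_loc_smooth: "smooth_on dom_loc (\<lambda>z. split_loc z u)"
  unfolding split_loc_def
  by (rule smooth_on_Pair[OF dom_loc_open smooth_on_frechet[OF proj_loc_smooth]
        smooth_on_linear_comp[OF vert_linear dom_loc_open form_loc_smooth]])

definition "hlift_loc X z = to_loc z (hlift (pt z) (X (proj (pt z))))"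

text \<open>Smooth dependence of solutions of linear equations, applied to \<open>split_loc\<close>
  with the coordinate expression of \<open>X\<close>, paired with 0, on the right.\<close>

lemma hlift_loc_smooth:
  assumes X: "X \<in> vector_fields N W"
  shows "smooth_on dom_loc (hlift_loc X)"
proof (rule smooth_on_family_inverse[OF dom_loc_open split_loc_linear split_loc_bij split_loc_smooth])
  let ?X = "\<lambda>y. mderiv N model_atlas (cmap c) (cinv c y) (X (cinv c y))"
  have "smooth_on dom_loc (\<lambda>z. ?X (proj_loc z))"
  proof (rule smooth_on_compose[OF dom_loc_open open_image_chart[OF N_atlas W c] _ proj_loc_smooth
        vector_fieldsD[OF X c]])
    show "proj_loc ` dom_loc \<subseteq> cmap c ` (W \<inter> cdom c)"
      using dom_locD(4,5) by (auto simp: proj_loc_def)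
  qed
  then show "smooth_on dom_loc (\<lambda>z. (?X (proj_loc z), 0))"
    by (rule smooth_on_Pair[OF dom_loc_open _ smooth_on_const[OF dom_loc_open]])
  fix z assume z: "z \<in> dom_loc"
  note w = dom_locD(3)[OF z]
  have "cinv c (proj_loc z) = proj (pt z)"
    unfolding proj_loc_def by (rule cinv_cmap[OF N_atlas c dom_locD(5)[OF z]])
  then show "split_loc z (hlift_loc X z) = (?X (proj_loc z), 0)"
    by (simp add: split_loc_def hlift_loc_def proj_loc_deriv[OF z] from_to_loc[OF z] form_loc_def
        hlift[OF w] vert_eq_0_iff to_base_loc_def)
qed

lemma equivariant_rep_loc_smooth:
  assumes Y: "Y \<in> vector_fields N W"
  shows "smooth_on dom_loc (\<lambda>z. equivariant_rep Y (pt z))"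
proof (rule smooth_on_cong[OF dom_loc_open])
  show "smooth_on dom_loc (\<lambda>z. form_loc z (hlift_loc Y z))"
    by (rule smooth_on_family_apply[OF dom_loc_open form_loc_linear form_loc_smooth hlift_loc_smooth[OF Y]])
  show "form_loc z (hlift_loc Y z) = equivariant_rep Y (pt z)" if "z \<in> dom_loc" for z
    using from_to_loc[OF that] by (simp add: form_loc_def hlift_loc_def equivariant_rep_def)
qed

end

lemma equivariant_rep_smooth:
  assumes W: "openin (mtop N) W" and Y: "Y \<in> vector_fields N W" and w: "w \<in> over \<xi> W"
  shows "smooth_map_at P model_atlas (equivariant_rep Y) w"
proof (rule smooth_map_at_modelI)
  note wP = overD(1)[OF w]
  show "w \<in> mcarrier P" by (rule wP)
  fix d assume d: "d \<in> P" "w \<in> cdom d"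
  note c = chart_at[OF proj_in[OF wP]]
  show "smooth_at (\<lambda>y. equivariant_rep Y (cinv d y)) (cmap d w)"
    using equivariant_rep_loc_smooth[OF W c(1) d(1) Y] dom_loc_open[OF W c(1) d(1)]
      dom_locI[OF W c(1) d(1) w d(2) c(2)]
    unfolding smooth_at_def pt_def[OF W c(1) d(1)] by blast
qed

end

section \<open>The covariant derivative as a connection on open subsets of the base\<close>

context reductive_geometry
begin

lemma nabla_at_loc_smooth:
  assumes W: "openin (mtop N) W" and c: "c \<in> N" and d: "d \<in> P"
    and X: "X \<in> vector_fields N W" and Y: "Y \<in> vector_fields N W"
  shows "smooth_on (cmap d ` (over \<xi> (W \<inter> cdom c) \<inter> cdom d))
    (\<lambda>z. mderiv N model_atlas (cmap c) (proj (cinv d z)) (nabla_at (cinv d z) X Y))"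
proof -
  let ?S = "dom_loc W c d"
  let ?pt = "pt d"
  note S = dom_loc_open[OF W c d]
  let ?\<rho> = "\<lambda>z. equivariant_rep Y (?pt z)"
  define \<zeta> where "\<zeta> z = mderiv P model_atlas (equivariant_rep Y) (?pt z) (hlift (?pt z) (X (proj (?pt z))))" for z
  \<comment> \<open>\<open>\<eta>\<close> solves \<open>form_loc d z (\<eta> z) = \<zeta> z\<close>,
    so it inherits smoothness from \<open>\<zeta>\<close> although \<open>form_inv\<close> is taken
    in irregularly chosen coordinates.\<close>
  define \<eta> where "\<eta> z = to_loc d z (form_inv (?pt z) (\<zeta> z))" for z
  have m: "(UNIV, \<lambda>x. x) \<in> model_atlas" by (simp add: model_atlas_def)
  have \<rho>': "smooth_on ?S (\<lambda>z. frechet_derivative ?\<rho> (at z) (hlift_loc d X z))"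
    by (rule smooth_on_frechet_apply[OF S equivariant_rep_loc_smooth[OF W c d Y] hlift_loc_smooth[OF W c d X]])
  have \<zeta>: "smooth_on ?S \<zeta>"
  proof (rule smooth_on_cong[OF S \<rho>'])
    fix z assume z: "z \<in> ?S"
    note D = dom_locD[OF W c d z]
    have s: "smooth_map_at P model_atlas (equivariant_rep Y) (?pt z)"
      by (rule equivariant_rep_smooth[OF W Y D(7)])
    show "frechet_derivative ?\<rho> (at z) (hlift_loc d X z) = \<zeta> z"
      using mderiv_in_charts[OF P_atlas smooth_atlas_model s d D(1) m, of "hlift (?pt z) (X (proj (?pt z)))"]
      unfolding D(2)
      by (simp add: \<zeta>_def hlift_loc_def[OF W c d] to_loc_def[OF W c d] pt_def[OF W c d]
          mderiv_id[OF smooth_atlas_model])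
  qed
  have \<eta>: "smooth_on ?S \<eta>"
    by (rule smooth_on_family_inverse[OF S form_loc_linear[OF W c d] form_loc_bij[OF W c d]
          form_loc_smooth[OF W c d] \<zeta>])
      (simp_all add: form_loc_def[OF W c d] \<eta>_def from_to_loc[OF W c d]
        form_form_inv dom_locD(3)[OF W c d])
  have *: "smooth_on ?S (\<lambda>z. frechet_derivative (proj_loc c d) (at z) (\<eta> z))"
    by (rule smooth_on_frechet_apply[OF S proj_loc_smooth[OF W c d] \<eta>])
  show ?thesis
    unfolding dom_loc_def[OF W c d, symmetric]
  proof (rule smooth_on_cong[OF S *])
    fix z assume z: "z \<in> ?S"
    show "frechet_derivative (proj_loc c d) (at z) (\<eta> z) =
        mderiv N model_atlas (cmap c) (proj (cinv d z)) (nabla_at (cinv d z) X Y)"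
      unfolding proj_loc_deriv[OF W c d z] \<eta>_def from_to_loc[OF W c d z] \<zeta>_def nabla_at_def
        to_base_loc_def[OF W c d] pt_def[OF W c d] ..
  qed
qed

lemma right_translation_symmetry:
  assumes h: "h \<in> mcarrier H" and W: "openin (mtop N) W" and wW: "w \<in> over \<xi> W"
  shows "local_symmetry (over \<xi> W) (\<lambda>u. act u h) (\<lambda>x. x) (Ad (Grp \<xi>) (GrpA \<xi>) (inv\<^bsub>Grp \<xi>\<^esub> h))"
  unfolding local_symmetry_def
proof (intro conjI ballI allI)
  let ?L = "Ad (Grp \<xi>) (GrpA \<xi>) (inv\<^bsub>Grp \<xi>\<^esub> h)"
  show "openin (mtop P) (over \<xi> W)" by (rule over_open[OF W])
  show "?L ` V \<subseteq> V" by (rule Ad_V[OF inv_H[OF h]])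
  note w = overD(1)[OF wW]
  \<comment> \<open>Linearity of the adjoint map is read off the equivariance of the form at one
    point; the hypothesis \<open>wW\<close> provides that point.\<close>
  have "?L = (\<lambda>a. \<omega> (act w h) (mderiv P P (\<lambda>u. act u h) w (form_inv w a)))"
    using form_act[OF w h] form_form_inv[OF w] by (simp add: fun_eq_iff)
  then show "linear ?L"
    using linear_compose[OF form_inv_linear[OF w] linear_compose[OF
          linear_mderiv[OF right_translation_smooth[OF w h]] form_linear[OF act_in[OF w h]]]]
    by (simp add: o_def)
  fix u assume u: "u \<in> over \<xi> W"
  show "smooth_map_at P P (\<lambda>u. act u h) u" by (rule right_translation_smooth[OF overD(1)[OF u] h])
  show "smooth_map_at N N (\<lambda>x. x) (proj u)" by (rule smooth_map_at_id[OF N_atlas proj_in[OF overD(1)[OF u]]])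
  show "proj (act u h) = proj u" by (rule proj_act[OF overD(1)[OF u] h])
  show "\<omega> (act u h) (mderiv P P (\<lambda>u. act u h) u v) = ?L (\<omega> u v)" for v
    by (rule form_act[OF overD(1)[OF u] h])
qed

text \<open>The chosen point of the fibre is a right translate of \<open>w\<close>, and right
  translations are symmetries over the identity of the base.\<close>

lemma nabla_eq:
  assumes W: "openin (mtop N) W" and w: "w \<in> over \<xi> W"
    and Y: "\<And>u. u \<in> over \<xi> W \<Longrightarrow> smooth_map_at P model_atlas (equivariant_rep Y) u"
  shows "nabla X Y (proj w) = nabla_at w X Y"
proof -
  define w' where "w' = (SOME w'. w' \<in> mcarrier P \<and> proj w' = proj w)"
  have "w' \<in> mcarrier P \<and> proj w' = proj w"
    unfolding w'_def by (rule someI[of _ w]) (use overD(1)[OF w] in simp)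
  then obtain h where h: "h \<in> mcarrier H" "w' = act w h"
    using proj_eq_iff[OF overD(1)[OF w]] by metis
  have w'W: "act w h \<in> over \<xi> W"
    using proj_act[OF overD(1)[OF w] h(1)] act_in[OF overD(1)[OF w] h(1)] overD(2)[OF w]
    by (intro overI) simp_all
  have id: "mderiv N N (\<lambda>x. x) (proj u) = (\<lambda>v. v)" if "u \<in> over \<xi> W" for u
    by (rule mderiv_id[OF N_atlas proj_in[OF overD(1)[OF that]]])
  have "nabla_at (act w h) X Y = mderiv N N (\<lambda>x. x) (proj w) (nabla_at w X Y)"
    by (rule nabla_at_symm[OF right_translation_symmetry[OF h(1) W w] w _ _ Y[OF w] Y[OF w'W]])
      (use w in \<open>auto simp: id\<close>)
  then show ?thesis
    unfolding nabla_def w'_def[symmetric] h(2) id[OF w] .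
qed

text \<open>Along a local section \<open>nabla\<close> is \<open>nabla_at\<close> at the points of
  the section, and \<open>nabla_at\<close> is already smooth in charts of the total space.\<close>

lemma nabla_smooth:
  assumes W: "openin (mtop N) W" and X: "X \<in> vector_fields N W" and Y: "Y \<in> vector_fields N W"
  shows "nabla X Y \<in> vector_fields N W"
  unfolding vector_fields_def
proof (rule CollectI, rule ballI)
  fix c assume c: "c \<in> N"
  let ?F = "\<lambda>y. mderiv N model_atlas (cmap c) (cinv c y) (nabla X Y (cinv c y))"
  show "smooth_on (cmap c ` (W \<inter> cdom c)) ?F"
    unfolding smooth_on_iff_smooth_at[OF open_image_chart[OF N_atlas W c]]
  proof
    fix y assume "y \<in> cmap c ` (W \<inter> cdom c)"
    then obtain x where x: "x \<in> W" "x \<in> cdom c" "y = cmap c x" by blast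
    have "x \<in> mcarrier N" using c x(2) by (auto simp: mcarrier_def)
    then obtain w where w: "w \<in> mcarrier P" "proj w = x" using proj_onto by blast
    obtain U \<sigma> where U: "openin (mtop N) U" "proj w \<in> U" and \<sigma>w: "\<sigma> (proj w) = w"
      and \<sigma>: "\<forall>x\<in>U. smooth_map_at N P \<sigma> x \<and> proj (\<sigma> x) = x"
      using local_section[OF w(1)] by (elim exE conjE)
    let ?d = "chart_at P w"
    note d = chart_at[OF w(1)]
    let ?S = "cmap ?d ` (over \<xi> (W \<inter> cdom c) \<inter> cdom ?d)"
    let ?G = "\<lambda>z. mderiv N model_atlas (cmap c) (proj (cinv ?d z)) (nabla_at (cinv ?d z) X Y)"
    let ?s = "\<lambda>y. cmap ?d (\<sigma> (cinv c y))"
    have sx: "smooth_map_at N P \<sigma> x" using \<sigma> U(2) w(2) by simp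
    have xUW: "x \<in> U \<inter> W" using U(2) w(2) x(1) by simp
    have \<sigma>d: "\<sigma> x \<in> cdom ?d" using \<sigma>w w(2) d(2) by simp
    note s = smooth_map_atD[OF sx c x(2) d(1) \<sigma>d]
    have sy: "?s (cmap c x) = cmap ?d w"
      using cinv_cmap[OF N_atlas c x(2)] \<sigma>w w(2) by simp
    have "w \<in> over \<xi> (W \<inter> cdom c)" using w x by (simp add: overI)
    then have "cmap ?d w \<in> ?S" using d(2) by blast
    moreover have "open ?S"
      by (rule open_image_chart[OF P_atlas over_open[OF openin_Int[OF W openin_cdom[OF N_atlas c]]] d(1)])
    ultimately have "smooth_at ?G (cmap ?d w)"
      using nabla_at_loc_smooth[OF W c d(1) X Y] unfolding smooth_at_def by blast
    then have "smooth_at (\<lambda>y. ?G (?s y)) (cmap c x)"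
      by (intro smooth_at_compose[OF s(2), of ?G]) (simp only: sy)
    moreover have "\<forall>\<^sub>F y in nhds (cmap c x). ?G (?s y) = ?F y"
      using s(1) eventually_cinv[OF N_atlas openin_Int[OF U(1) W] c xUW x(2)]
    proof eventually_elim
      case (elim y)
      let ?q = "cinv c y"
      have q: "?q \<in> U" "?q \<in> W" using elim(2) by auto
      have 1: "cinv ?d (?s y) = \<sigma> ?q" by (rule cinv_cmap[OF P_atlas d(1) elim(1)])
      have 2: "proj (\<sigma> ?q) = ?q" using \<sigma> q(1) by blast
      have "\<sigma> ?q \<in> mcarrier P" using \<sigma> q(1) smooth_map_at_carrier(2) by metis
      then have "\<sigma> ?q \<in> over \<xi> W" using 2 q(2) by (simp add: overI)
      from nabla_eq[OF W this equivariant_rep_smooth[OF W Y]] show ?case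
        unfolding 1 2 by simp
    qed
    ultimately show "smooth_at ?F y" unfolding x(3) by (rule smooth_at_cong)
  qed
qed

text \<open>One \<open>w\<close> serves all \<open>X\<close>, so the rules in the first argument
  reduce to linear algebra at that point.\<close>

lemma nabla_at_vector_field:
  assumes W: "openin (mtop N) W" and Y: "Y \<in> vector_fields N W" and x: "x \<in> W"
  shows "\<exists>w. w \<in> over \<xi> W \<and> proj w = x \<and> smooth_map_at P model_atlas (equivariant_rep Y) w \<and>
    (\<forall>X. nabla X Y x = nabla_at w X Y)"
proof -
  have "x \<in> mcarrier N" using x W openin_atlas[OF N_atlas] by blast
  then obtain w where w: "w \<in> mcarrier P" "proj w = x" using proj_onto by blast
  then have wW: "w \<in> over \<xi> W" using x by (simp add: overI)
  show ?thesis
    using wW w(2) equivariant_rep_smooth[OF W Y wW] nabla_eq[OF W wW equivariant_rep_smooth[OF W Y]]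
    by (intro exI[of _ w]) simp
qed

lemma nabla_linear_connection:
  assumes W: "openin (mtop N) W"
  shows "linear_connection_on N W nabla"
  unfolding linear_connection_on_def
proof (intro conjI ballI impI allI)
  show "nabla X Y \<in> vector_fields N W" if "X \<in> vector_fields N W" "Y \<in> vector_fields N W" for X Y
    by (rule nabla_smooth[OF W that])
next
  fix X X' Y Y' :: "'n \<Rightarrow> 'q" and x
  assume "Y \<in> vector_fields N W" "Y' \<in> vector_fields N W"
    and eq: "(\<forall>p\<in>W. X p = X' p) \<and> (\<forall>p\<in>W. Y p = Y' p)" and x: "x \<in> W"
  obtain w where w: "w \<in> over \<xi> W" "proj w = x" and "\<forall>X. nabla X Y x = nabla_at w X Y"
    using nabla_at_vector_field[OF W \<open>Y \<in> vector_fields N W\<close> x] by (elim exE conjE)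
  note n = this(3)[rule_format]
  have "nabla X' Y' x = nabla_at w X' Y'"
    using nabla_eq[OF W w(1) equivariant_rep_smooth[OF W \<open>Y' \<in> vector_fields N W\<close>]] w(2) by simp
  \<comment> \<open>The fields agree on \<open>W\<close> only; this suffices for the derivative
    because the part of the total space over \<open>W\<close> is open.\<close>
  moreover have "mderiv P model_atlas (equivariant_rep Y) w = mderiv P model_atlas (equivariant_rep Y') w"
    by (rule mderiv_cong[OF P_atlas over_open[OF W] w(1)]) (use eq overD(2) in \<open>simp add: equivariant_rep_def\<close>)
  ultimately show "nabla X Y x = nabla X' Y' x"
    using eq x w(2) by (simp add: n nabla_at_def)
next
  fix X X' Y :: "'n \<Rightarrow> 'q" and x
  assume Y: "Y \<in> vector_fields N W" and x: "x \<in> W"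
  obtain w where w: "w \<in> over \<xi> W" "proj w = x" and s: "smooth_map_at P model_atlas (equivariant_rep Y) w"
    and "\<forall>X. nabla X Y x = nabla_at w X Y"
    using nabla_at_vector_field[OF W Y x] by (elim exE conjE)
  note n = this(4)[rule_format]
  note P = overD(1)[OF w(1)]
  show "nabla (\<lambda>q. X q + X' q) Y x = nabla X Y x + nabla X' Y x"
    unfolding n nabla_at_def
    by (simp add: linear_add[OF hlift_linear[OF P]] linear_add[OF linear_mderiv[OF s]]
        linear_add[OF form_inv_linear[OF P]] linear_add[OF dproj_linear[OF P]])
next
  fix X Y Y' :: "'n \<Rightarrow> 'q" and x
  assume Y: "Y \<in> vector_fields N W" and Y': "Y' \<in> vector_fields N W" and x: "x \<in> W"
  obtain w where w: "w \<in> over \<xi> W" "proj w = x" and s: "smooth_map_at P model_atlas (equivariant_rep Y) w"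
    and "\<forall>X. nabla X Y x = nabla_at w X Y"
    using nabla_at_vector_field[OF W Y x] by (elim exE conjE)
  note n = this(4)[rule_format]
  note P = overD(1)[OF w(1)]
  have s': "smooth_map_at P model_atlas (equivariant_rep Y') w"
    by (rule equivariant_rep_smooth[OF W Y' w(1)])
  have n': "nabla X Y' x = nabla_at w X Y'"
    using nabla_eq[OF W w(1) equivariant_rep_smooth[OF W Y']] w(2) by simp
  have rep: "equivariant_rep Y u + equivariant_rep Y' u = equivariant_rep (\<lambda>q. Y q + Y' q) u"
    if "u \<in> over \<xi> W" for u
    using overD(1)[OF that]
    by (simp add: equivariant_rep_def linear_add[OF hlift_linear] linear_add[OF form_linear])
  \<comment> \<open>\<open>nabla_eq\<close> asks for a smooth representation over all of
    \<open>W\<close>. Here it is obtained as the sum of two smooth functions on the total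
    space.\<close>
  have sm: "smooth_map_at P model_atlas (equivariant_rep (\<lambda>q. Y q + Y' q)) u" if u: "u \<in> over \<xi> W" for u
    by (rule smooth_map_at_cong[OF P_atlas over_open[OF W] u rep smooth_map_at_model_add])
      (use equivariant_rep_smooth[OF W _ u] Y Y' P_atlas in auto)
  have "nabla X (\<lambda>q. Y q + Y' q) x = nabla_at w X (\<lambda>q. Y q + Y' q)"
    using nabla_eq[OF W w(1) sm] w(2) by simp
  moreover have "mderiv P model_atlas (equivariant_rep (\<lambda>q. Y q + Y' q)) w v =
      mderiv P model_atlas (equivariant_rep Y) w v + mderiv P model_atlas (equivariant_rep Y') w v" for v
    using mderiv_cong[where B = model_atlas, OF P_atlas over_open[OF W] w(1) rep] mderiv_model_add[OF P_atlas s s', of v]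
    by simp
  ultimately show "nabla X (\<lambda>q. Y q + Y' q) x = nabla X Y x + nabla X Y' x"
    unfolding n n' nabla_at_def
    by (simp add: linear_add[OF form_inv_linear[OF P]] linear_add[OF dproj_linear[OF P]])
next
  fix f :: "'n \<Rightarrow> real" and X Y :: "'n \<Rightarrow> 'q" and x
  assume f: "msmooth_on N model_atlas W f" and Y: "Y \<in> vector_fields N W" and x: "x \<in> W"
  obtain w where w: "w \<in> over \<xi> W" "proj w = x" and s: "smooth_map_at P model_atlas (equivariant_rep Y) w"
    and "\<forall>X. nabla X Y x = nabla_at w X Y"
    using nabla_at_vector_field[OF W Y x] by (elim exE conjE)
  note n = this(4)[rule_format]
  note P = overD(1)[OF w(1)]
  show "nabla (\<lambda>q. f q *\<^sub>R X q) Y x = f x *\<^sub>R nabla X Y x"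
    unfolding n nabla_at_def
    by (simp add: linear_scale[OF hlift_linear[OF P]] linear_scale[OF linear_mderiv[OF s]]
        linear_scale[OF form_inv_linear[OF P]] linear_scale[OF dproj_linear[OF P]] w(2))
  have sf: "smooth_map_at N model_atlas f (proj u)" if "u \<in> over \<xi> W" for u
    by (rule msmooth_on_imp_smooth_map_at[OF N_atlas smooth_atlas_model W overD(2)[OF that] f])
  have sfp: "smooth_map_at P model_atlas (\<lambda>u. f (proj u)) u" if "u \<in> over \<xi> W" for u
    by (rule smooth_map_at_compose[OF P_atlas N_atlas proj_smooth[OF overD(1)[OF that]] sf[OF that]])
  have rep: "f (proj u) *\<^sub>R equivariant_rep Y u = equivariant_rep (\<lambda>q. f q *\<^sub>R Y q) u"
    if "u \<in> over \<xi> W" for u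
    using overD(1)[OF that]
    by (simp add: equivariant_rep_def linear_scale[OF hlift_linear] linear_scale[OF form_linear])
  have sm: "smooth_map_at P model_atlas (equivariant_rep (\<lambda>q. f q *\<^sub>R Y q)) u" if u: "u \<in> over \<xi> W" for u
    by (rule smooth_map_at_cong[OF P_atlas over_open[OF W] u rep
          smooth_map_at_model_scaleR[OF P_atlas sfp[OF u] equivariant_rep_smooth[OF W Y u]]])
  have "nabla X (\<lambda>q. f q *\<^sub>R Y q) x = nabla_at w X (\<lambda>q. f q *\<^sub>R Y q)"
    using nabla_eq[OF W w(1) sm] w(2) by simp
  moreover have "mderiv P model_atlas (equivariant_rep (\<lambda>q. f q *\<^sub>R Y q)) w v =
      f x *\<^sub>R mderiv P model_atlas (equivariant_rep Y) w v +
      mderiv N model_atlas f x (dproj w v) *\<^sub>R equivariant_rep Y w" for v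
    using mderiv_cong[where B = model_atlas, OF P_atlas over_open[OF W] w(1) rep]
      mderiv_model_scaleR[OF P_atlas sfp[OF w(1)] s, of v]
      mderiv_compose[OF P_atlas N_atlas proj_smooth[OF P] sf[OF w(1)], of v] w(2)
    by simp
  \<comment> \<open>This turns the extra term of the product rule on the total space back into the
    Leibniz term with \<open>Y x\<close>.\<close>
  moreover have "dproj w (form_inv w (equivariant_rep Y w)) = Y x"
    by (simp add: equivariant_rep_def form_inv_form[OF P] hlift[OF P] w(2))
  ultimately show "nabla X (\<lambda>q. f q *\<^sub>R Y q) x = mderiv N model_atlas f x (X x) *\<^sub>R Y x + f x *\<^sub>R nabla X Y x"
    unfolding n nabla_at_def
    by (simp add: linear_add[OF form_inv_linear[OF P]] linear_add[OF dproj_linear[OF P]]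
        linear_scale[OF form_inv_linear[OF P]] linear_scale[OF dproj_linear[OF P]] hlift[OF P] w(2))
qed

text \<open>An isomorphism of Cartan geometries is a symmetry with \<open>L\<close> the identity, so
  \<open>nabla_at\<close> at \<open>w\<close> and at \<open>\<Gamma> w\<close> correspond.\<close>

lemma cartan_iso_connection_iso:
  assumes W: "openin (mtop N) W" and W': "openin (mtop N) W'" and iso: "cartan_iso \<xi> W W' \<Gamma> \<gamma>"
  shows "connection_iso N nabla W W' \<gamma>"
proof -
  have d\<Gamma>: "mdiffeo P P (over \<xi> W) (over \<xi> W') \<Gamma>" and d\<gamma>: "mdiffeo N N W W' \<gamma>"
    and proj\<Gamma>: "\<forall>w\<in>over \<xi> W. proj (\<Gamma> w) = \<gamma> (proj w)"
    and form\<Gamma>: "\<forall>w\<in>over \<xi> W. \<forall>v. \<omega> (\<Gamma> w) (mderiv P P \<Gamma> w v) = \<omega> w v"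
    using iso unfolding cartan_iso_def by blast+
  note oW = over_open[OF W] and oW' = over_open[OF W']
  have symm: "local_symmetry (over \<xi> W) \<Gamma> \<gamma> (\<lambda>a. a)"
    unfolding local_symmetry_def
  proof (intro conjI ballI allI oW)
    show "linear (\<lambda>a::'a. a)" by (rule linearI) simp_all
    fix u assume u: "u \<in> over \<xi> W"
    show "smooth_map_at P P \<Gamma> u"
      using d\<Gamma> unfolding mdiffeo_def
      by (intro msmooth_on_imp_smooth_map_at[OF P_atlas P_atlas oW u]) blast
    show "smooth_map_at N N \<gamma> (proj u)"
      using d\<gamma> unfolding mdiffeo_def
      by (intro msmooth_on_imp_smooth_map_at[OF N_atlas N_atlas W overD(2)[OF u]]) blast
    show "proj (\<Gamma> u) = \<gamma> (proj u)" "\<omega> (\<Gamma> u) (mderiv P P \<Gamma> u v) = \<omega> u v" for v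
      using proj\<Gamma> form\<Gamma> u by blast+
  qed simp
  have bij\<gamma>: "bij_betw \<gamma> W W'" and bij\<Gamma>: "bij_betw \<Gamma> (over \<xi> W) (over \<xi> W')"
    using d\<gamma> d\<Gamma> unfolding mdiffeo_def by blast+
  have push: "push_field N W \<gamma> X (\<gamma> x) = mderiv N N \<gamma> x (X x)" if "x \<in> W" for X x
    unfolding push_field_def inv_into_f_f[OF bij_betw_imp_inj_on[OF bij\<gamma>] that] ..
  have ind: "induced_connection N nabla U nabla" if "openin (mtop N) U" for U
    unfolding induced_connection_def using nabla_linear_connection[OF that] by blast
  have "push_field N W \<gamma> (nabla X Y) q = nabla (push_field N W \<gamma> X) (push_field N W \<gamma> Y) q"
    if X: "X \<in> vector_fields N W" and Y: "Y \<in> vector_fields N W" and q: "q \<in> W'" for X Y q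
  proof -
    let ?X = "push_field N W \<gamma> X" and ?Y = "push_field N W \<gamma> Y"
    obtain x where x: "x \<in> W" "q = \<gamma> x"
      using bij\<gamma> q unfolding bij_betw_def by blast
    obtain w where w: "w \<in> over \<xi> W" "proj w = x" and n: "\<forall>X. nabla X Y x = nabla_at w X Y"
      using nabla_at_vector_field[OF W Y x(1)] by (elim exE conjE)
    \<comment> \<open>The representation of the pushed field is that of \<open>Y\<close> composed
      with the inverse of \<open>\<Gamma>\<close>; its smoothness follows without examining the
      pushed field in charts of the base.\<close>
    have sY: "smooth_map_at P model_atlas (equivariant_rep ?Y) v" if v: "v \<in> over \<xi> W'" for v
    proof -
      let ?I = "inv_into (over \<xi> W) \<Gamma>"
      have v': "v' \<in> \<Gamma> ` over \<xi> W" if "v' \<in> over \<xi> W'" for v'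
        using bij\<Gamma> that unfolding bij_betw_def by simp
      have I: "smooth_map_at P P ?I v"
        using d\<Gamma> unfolding mdiffeo_def
        by (intro msmooth_on_imp_smooth_map_at[OF P_atlas P_atlas oW' v]) blast
      show ?thesis
      proof (rule smooth_map_at_cong[OF P_atlas oW' v])
        show "smooth_map_at P model_atlas (\<lambda>v. equivariant_rep Y (?I v)) v"
          by (rule smooth_map_at_compose[OF P_atlas P_atlas I
                equivariant_rep_smooth[OF W Y inv_into_into[OF v'[OF v]]]])
        fix v' assume "v' \<in> over \<xi> W'"
        note u = inv_into_into[OF v'[OF this]] and \<Gamma>u = f_inv_into_f[OF v'[OF this]]
        show "equivariant_rep Y (?I v') = equivariant_rep ?Y v'"
          using equivariant_rep_symm[OF symm u, of ?Y Y, OF push[OF overD(2)[OF u]]] by (simp add: \<Gamma>u)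
      qed
    qed
    have \<Gamma>w: "\<Gamma> w \<in> over \<xi> W'" using bij_betwE[OF bij\<Gamma>] w(1) by blast
    have "nabla ?X ?Y q = nabla_at (\<Gamma> w) ?X ?Y"
      using nabla_eq[OF W' \<Gamma>w sY] proj\<Gamma> w x(2) by simp
    also have "\<dots> = mderiv N N \<gamma> (proj w) (nabla_at w X Y)"
    proof (rule nabla_at_symm[OF symm w(1)])
      show "?X (\<gamma> (proj w)) = mderiv N N \<gamma> (proj w) (X (proj w))"
        by (rule push[OF overD(2)[OF w(1)]])
      show "?Y (\<gamma> (proj u)) = mderiv N N \<gamma> (proj u) (Y (proj u))" if "u \<in> over \<xi> W" for u
        by (rule push[OF overD(2)[OF that]])
    qed (rule equivariant_rep_smooth[OF W Y w(1)] sY[OF \<Gamma>w])+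
    also have "\<dots> = push_field N W \<gamma> (nabla X Y) q"
      unfolding x(2) push[OF x(1)] n[rule_format] w(2) ..
    finally show ?thesis by simp
  qed
  then show ?thesis
    unfolding connection_iso_def using d\<gamma> ind[OF W] ind[OF W'] by blast
qed

end

section \<open>From a cocycle of Cartan isomorphisms to one of connection isomorphisms\<close>

theorem theorem4:
  fixes M :: "('m, 'e::finite_dim_normed) atlas"
    and F :: "('m, 'q::finite_dim_normed) foliation"
  assumes "reductive_cartan_foliation
     TYPE('i \<times> ('g, 'n, 'p, 'a::finite_dim_normed, 'h::finite_dim_normed, 'q,
                'r::finite_dim_normed) cartan_data) M F"
  shows "foliation_with_transversal_linear_connection TYPE('i \<times> 'n) M F"
proof -
  have F: "foliation M F"
    using assms unfolding reductive_cartan_foliation_def by blast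
  obtain \<xi> :: "('g, 'n, 'p, 'a, 'h, 'q, 'r) cartan_data" and J :: "'i set" and U f \<Gamma>
    where \<xi>: "cartan_geometry \<xi>" "reductive \<xi>" "cartan_foliation_cocycle \<xi> M F J U f \<Gamma>"
    using assms unfolding reductive_cartan_foliation_def by blast
  obtain V where V: "subspace V"
    "\<forall>h\<in>mcarrier (SubA \<xi>). Ad (Grp \<xi>) (GrpA \<xi>) h ` V \<subseteq> V"
    "range (lie_incl (Grp \<xi>) (GrpA \<xi>) (SubA \<xi>)) \<inter> V = {0}"
    "\<forall>x. \<exists>a\<in>range (lie_incl (Grp \<xi>) (GrpA \<xi>) (SubA \<xi>)). \<exists>b\<in>V. x = a + b"
    using \<xi>(2) unfolding reductive_def Let_def by (elim exE conjE)
  interpret reductive_geometry \<xi> V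
    by unfold_locales (use \<xi>(1) V in auto)
  obtain \<gamma> where \<gamma>: "cocycle M N J U f \<gamma>" "cocycle_defines N J U f F"
    "\<forall>i\<in>J. \<forall>j\<in>J. U i \<inter> U j \<noteq> {} \<longrightarrow>
       cartan_iso \<xi> (f j ` (U i \<inter> U j)) (f i ` (U i \<inter> U j)) (\<Gamma> i j) (\<gamma> i j)"
    using \<xi>(3) unfolding cartan_foliation_cocycle_def by blast
  have M: "smooth_atlas M"
    using F manifold_smooth_atlas unfolding foliation_def by blast
  have U: "openin (mtop M) (U i)" "submersion_on M N (U i) (f i)" if "i \<in> J" for i
    using \<gamma>(1) that unfolding cocycle_def by simp_all
  have open_image: "openin (mtop N) (f i ` A)" if "i \<in> J" "openin (mtop M) A" "A \<subseteq> U i" for i A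
    by (rule submersion_image_open[OF M N_atlas U(1)[OF that(1)] U(2)[OF that(1)] that(2,3)])
  have "connection_iso N nabla (f j ` (U i \<inter> U j)) (f i ` (U i \<inter> U j)) (\<gamma> i j)"
    if "i \<in> J" "j \<in> J" "U i \<inter> U j \<noteq> {}" for i j
  proof (rule cartan_iso_connection_iso)
    have "openin (mtop M) (U i \<inter> U j)" using U(1) that by blast
    then show "openin (mtop N) (f j ` (U i \<inter> U j))" "openin (mtop N) (f i ` (U i \<inter> U j))"
      using open_image that by blast+
    show "cartan_iso \<xi> (f j ` (U i \<inter> U j)) (f i ` (U i \<inter> U j)) (\<Gamma> i j) (\<gamma> i j)"
      using \<gamma>(3) that by blast
  qed
  then show ?thesis
    unfolding foliation_with_transversal_linear_connection_def
    using F N_manifold nabla_linear_connection[OF openin_mcarrier[OF N_atlas]] \<gamma>(1,2)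
    by blast
qed

end
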